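(* Let $M$ be a non-quasianalytic weight sequence of moderate growth such that $m=(M_k/k!)_k$ is log-convex. Then for every $d\ge1$ the ring ${}_d\mathcal{E}^{(M)}$ has property $(\mathscr{D})$.
   Context: A weight sequence is a sequence $M=(M_k)_{k\ge0}$ of positive reals with $M_k=\mu_1\cdots\mu_k$, $M_0=1$, where $(\mu_k)$ is positive and increasing with $\mu_0=1$, and $M_k^{1/k}\to\infty$. $M$ is non-quasianalytic if $\sum_{k\ge1}1/\mu_k<\infty$; $M$ has moderate growth if $\exists C>0\ \forall j,k: M_{j+k}\le C^{j+k}M_jM_k$. For open $U\subseteq\mathbb{R}^d$ and $\sigma>0$, $\mathcal{B}^M_\sigma(U)$ is the set of $f\in C^\infty(U)$ with $\sup_{x\in U,\alpha\in\mathbb{N}^d}|\partial^\alpha f(x)|/(\sigma^{|\alpha|}M_{|\alpha|})<\infty$. $\mathcal{E}^{(M)}(U)$ is the set of $f\in C^\infty(U)$ such that $f|_V\in\mathcal{B}^M_\sigma(V)$ for every relatively compact open $V\subseteq U$ and every $\sigma>0$. ${}_d\mathcal{E}^{(M)}$ is the ring of germs at $0\in\mathbb{R}^d$ of complex valued $\mathcal{E}^{(M)}$-functions. A subring $\mathcal{S}$ of the ring of germs at $0\in\mathbb{R}^d$ of complex valued $C^\infty$ functions has property $(\mathscr{D})$ if for every complex valued function germ $f$ at $0\in\mathbb{R}^d$: if $f^j,f^{j+1}\in\mathcal{S}$ for some integer $j\ge1$, then $f\in\mathcal{S}$. *)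

theory Defs
  imports "HOL-Analysis.Analysis"
begin

definition weight_sequence :: "(nat \<Rightarrow> real) \<Rightarrow> bool" where
  "weight_sequence M \<longleftrightarrow>
     (\<exists>\<mu> :: nat \<Rightarrow> real. \<mu> 0 = 1 \<and> (\<forall>k. \<mu> k > 0) \<and> mono \<mu> \<and>
        (\<forall>k. M k = (\<Prod>i\<in>{1..k}. \<mu> i))) \<and>
     filterlim (\<lambda>k. M k powr (1 / real k)) at_top sequentially"

text \<open>For a weight sequence, mu (k+1) = M (k+1) / M k.\<close>
definition non_quasianalytic :: "(nat \<Rightarrow> real) \<Rightarrow> bool" where
  "non_quasianalytic M \<longleftrightarrow> summable (\<lambda>k. 1 / (M (Suc k) / M k))"

definition moderate_growth :: "(nat \<Rightarrow> real) \<Rightarrow> bool" where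
  "moderate_growth M \<longleftrightarrow> (\<exists>C>0. \<forall>j k. M (j + k) \<le> C ^ (j + k) * M j * M k)"

definition log_convex :: "(nat \<Rightarrow> real) \<Rightarrow> bool" where
  "log_convex m \<longleftrightarrow> (\<forall>k\<ge>1. (m k)\<^sup>2 \<le> m (k - 1) * m (k + 1))"

definition partial :: "'n::finite \<Rightarrow> (real^'n \<Rightarrow> complex) \<Rightarrow> real^'n \<Rightarrow> complex" where
  "partial i f x = vector_derivative (\<lambda>t. f (x + t *\<^sub>R axis i 1)) (at 0)"

fun partials :: "'n::finite list \<Rightarrow> (real^'n \<Rightarrow> complex) \<Rightarrow> real^'n \<Rightarrow> complex" where
  "partials [] f = f"
| "partials (i # is) f = partial i (partials is f)"

definition dpartial :: "('n::finite \<Rightarrow> nat) \<Rightarrow> (real^'n \<Rightarrow> complex) \<Rightarrow> real^'n \<Rightarrow> complex" where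
  "dpartial \<alpha> f = partials (concat (map (\<lambda>i. replicate (\<alpha> i) i)
                       (SOME xs. distinct xs \<and> set xs = (UNIV :: 'n set)))) f"

definition mi_length :: "('n::finite \<Rightarrow> nat) \<Rightarrow> nat" where
  "mi_length \<alpha> = (\<Sum>i\<in>UNIV. \<alpha> i)"

definition smooth_on :: "(real^'n::finite) set \<Rightarrow> (real^'n \<Rightarrow> complex) \<Rightarrow> bool" where
  "smooth_on U f \<longleftrightarrow>
     (\<forall>is. continuous_on U (partials is f) \<and>
        (\<forall>x\<in>U. \<forall>i. (\<lambda>t. partials is f (x + t *\<^sub>R axis i 1)) differentiable (at 0)))"

definition B_M :: "(nat \<Rightarrow> real) \<Rightarrow> real \<Rightarrow> (real^'n::finite) set \<Rightarrow> (real^'n \<Rightarrow> complex) set" where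
  "B_M M \<sigma> U = {f. smooth_on U f \<and>
      (\<exists>C. \<forall>x\<in>U. \<forall>\<alpha>. norm (dpartial \<alpha> f x) / (\<sigma> ^ mi_length \<alpha> * M (mi_length \<alpha>)) \<le> C)}"

definition E_M :: "(nat \<Rightarrow> real) \<Rightarrow> (real^'n::finite) set \<Rightarrow> (real^'n \<Rightarrow> complex) set" where
  "E_M M U = {f. smooth_on U f \<and>
      (\<forall>V \<sigma>. open V \<and> compact (closure V) \<and> closure V \<subseteq> U \<and> \<sigma> > 0 \<longrightarrow> f \<in> B_M M \<sigma> V)}"

text \<open>A function represents a germ at 0 belonging to the ring of germs of E^(M) functions.\<close>
definition germ_E_M :: "(nat \<Rightarrow> real) \<Rightarrow> (real^'n::finite \<Rightarrow> complex) \<Rightarrow> bool" where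
  "germ_E_M M f \<longleftrightarrow> (\<exists>U. open U \<and> 0 \<in> U \<and> f \<in> E_M M U)"

text \<open>Property (D) of a ring of germs (given by a germ-invariant predicate on representatives).\<close>
definition property_D :: "((real^'n::finite \<Rightarrow> complex) \<Rightarrow> bool) \<Rightarrow> bool" where
  "property_D S \<longleftrightarrow>
     (\<forall>f j. j \<ge> (1::nat) \<and> S (\<lambda>x. f x ^ j) \<and> S (\<lambda>x. f x ^ (j + 1)) \<longrightarrow> S f)"

end

theory Submission
  imports Defs "HOL-Complex_Analysis.Complex_Analysis"
    "HOL-Computational_Algebra.Fundamental_Theorem_Algebra"
begin

text \<open>
  With \<open>m\<^sub>k = M\<^sub>k/k!\<close>, Taylor's formula shows that \<open>f\<^sup>j\<close> and \<open>f\<^sup>j\<^sup>+\<^sup>1\<close> are, on every axis-parallel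
  segment of length \<open>~ r\<close>, within \<open>\<delta> = A (\<rho> r)\<^sup>N m\<^sub>N\<close> of polynomials \<open>P\<close>, \<open>Q\<close> of degree at most \<open>N\<close>. Factors
  \<open>C\<^sup>N\<close> are harmless throughout: \<open>\<rho>\<close> is arbitrary and \<open>M\<close> has moderate growth.

  After rescaling, \<open>P\<^sup>j\<^sup>+\<^sup>1 - Q\<^sup>j\<close> is tiny on a large complex disc. The smooth substitute
  \<open>\<Psi> = Q \<bar>P/(|P|\<^sup>2 + \<tau>)\<close> for \<open>Q/P\<close> has \<open>\<partial>\<Psi>/\<partial>\<bar>z\<close> dominated by a small multiple of a power of \<open>|P'/P|\<close>
  with exponent less than one, so that by Green's formula the Fourier coefficients of \<open>\<Psi>\<close> of negative
  degree are small on the bounding circle. The remaining coefficients give a polynomial \<open>F\<close> with \<open>P F\<close>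
  close to \<open>Q\<close>; on a circle where \<open>|P|\<close> is not small this forces \<open>F\<^sup>j\<close> close to \<open>P\<close>, and by the maximum
  principle \<open>f\<close> is within \<open>C\<^sup>N \<delta>\<^sup>c\<close> of \<open>F\<close>, where \<open>c > 0\<close> depends only on \<open>j\<close>.

  Hence \<open>f\<close> has polynomial approximations of the same kind along all axis-parallel segments. Finite
  differences of \<open>f\<close> at dyadic scales then converge to its partial derivatives, which inherit the
  approximation property, so mixed derivatives are reached by treating one axis at a time.
\<close>

section \<open>Polynomials bounded on an interval\<close>

text \<open>Dividing \<open>f ^ (j + 1)\<close> by \<open>f ^ j\<close> breaks down at zeros, and
  the polynomials P and Q need not share theirs, so Q/P may have poles. What survives is that |Q|^j
  is close to |P|^(j+1): above the error level, |Q| is at most of order |P|^(1 + 1/j). The surplus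
  exponent 1/j = 2 \<beta> is the source of every gain, and the regularisation \<tau> is placed at
  the error level.

  The price is that \<delta> weakens to a small power \<delta>^c. It is recovered by expanding
  \<open>f ^ j\<close> and \<open>f ^ (j + 1)\<close> to order qN with q \<ge> 1/c: moderate growth
  bounds \<open>M (q * N)\<close> by H^(q^2 N) (M N)^q, and N!^q \<le> (qN)!, so \<delta>^c is again
  of the size (const r)^N M N / N!.

  The polynomials found for different r are unrelated, so no Taylor polynomial of \<open>f\<close>
  is at hand; difference quotients can be compared only at neighbouring scales, through a common
  polynomial. Differentiating k times creates k!, which the factor 1/N! of the error at N = k + 4
  cancels. The sup bound of \<open>f\<close> enters with an uncancelled k! a^k, and
  non-quasianalyticity absorbs that.\<close>

lemma power_div_fact_le_exp:
  fixes x :: real assumes "0 \<le> x" shows "x ^ n / fact n \<le> exp x"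
proof -
  have s: "(\<lambda>k. x ^ k /\<^sub>R fact k) sums exp x"
    unfolding exp_def using summable_exp_generic[of x] by (simp add: summable_sums)
  have "sum (\<lambda>k. x ^ k /\<^sub>R fact k) {n} \<le> exp x"
    using s assms by (intro sum_le_suminf[of "\<lambda>k. x ^ k /\<^sub>R fact k" "{n}", THEN order_trans])
       (auto simp: sums_iff)
  then show ?thesis by (simp add: divide_inverse mult.commute)
qed

lemma prod_linear_coeff_bound:
  fixes t :: "nat \<Rightarrow> real"
  assumes "finite A" "\<And>l. l \<in> A \<Longrightarrow> \<bar>t l\<bar> \<le> 1"
  shows "cmod (coeff (\<Prod>l\<in>A. [:-complex_of_real (t l), 1:]) b) \<le> 2 ^ card A"
  using assms
proof (induction A arbitrary: b rule: finite_induct)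
  case empty
  then show ?case by (cases b) auto
next
  case (insert x A)
  let ?q = "\<Prod>l\<in>A. [:-complex_of_real (t l), 1:]"
  have x: "\<bar>t x\<bar> \<le> 1" using insert by auto
  have IH: "cmod (coeff ?q b) \<le> 2 ^ card A" for b using insert by auto
  have "cmod (- complex_of_real (t x) * coeff ?q b) \<le> 1 * 2 ^ card A"
    unfolding norm_mult using x IH by (intro mult_mono) auto
  moreover have "cmod (coeff (pCons 0 ?q) b) \<le> 2 ^ card A"
    using IH by (cases b) auto
  ultimately have "cmod (- complex_of_real (t x) * coeff ?q b + coeff (pCons 0 ?q) b) \<le> 2 ^ card A + 2 ^ card A"
    by (intro norm_triangle_le add_mono) auto
  then show ?case using insert by simp
qed

lemma prod_node_distances:
  assumes "k \<le> L"
  shows "(\<Prod>l\<in>{..L}-{k}. \<bar>real k - real l\<bar>) = fact k * fact (L - k)"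
proof -
  have eq: "{..L}-{k} = {0..<k} \<union> {Suc k..L}" using assms by auto
  have "(\<Prod>l\<in>{..L}-{k}. \<bar>real k - real l\<bar>) =
      (\<Prod>l\<in>{0..<k}. \<bar>real k - real l\<bar>) * (\<Prod>l\<in>{Suc k..L}. \<bar>real k - real l\<bar>)"
    unfolding eq by (rule prod.union_disjoint) auto
  also have "(\<Prod>l\<in>{0..<k}. \<bar>real k - real l\<bar>) = (\<Prod>l\<in>{1..k}. real l)"
    by (rule prod.reindex_bij_witness[of _ "\<lambda>l. k - l" "\<lambda>l. k - l"]) auto
  also have "\<dots> = fact k" by (simp add: fact_prod)
  also have "(\<Prod>l\<in>{Suc k..L}. \<bar>real k - real l\<bar>) = (\<Prod>l\<in>{1..L-k}. real l)"
    by (rule prod.reindex_bij_witness[of _ "\<lambda>l. l + k" "\<lambda>l. l - k"]) auto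
  also have "\<dots> = fact (L - k)" by (simp add: fact_prod)
  finally show ?thesis .
qed

text \<open>Lagrange interpolation at the nodes k/(L+1): numerators have coefficients at most 2^L,
  and the node products are k! (L-k)!/(L+1)^L, whose reciprocals are at most 2^L e^(L+1). Hence the
  total weight is exponential in L (24 would do in place of 60). Having the functional explicitly
  matters: it is applied later to functions that are not polynomials, as a finite
  difference.\<close>

lemma lagrange_functional:
  "\<exists>t c. (\<forall>k\<le>L. 0 \<le> t k \<and> t k \<le> (1::real)) \<and> (\<forall>b. (\<Sum>k\<le>L. cmod (c b k)) \<le> 60 ^ Suc L) \<and>
     (\<forall>p b. degree p \<le> L \<longrightarrow> coeff p b = (\<Sum>k\<le>L. c b k * poly p (of_real (t k))))"
proof -
  define t where "t k = real k / real (Suc L)" for k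
  define num where "num k = (\<Prod>l\<in>{..L}-{k}. [:-complex_of_real (t l), 1:])" for k
  define den where "den k = (\<Prod>l\<in>{..L}-{k}. complex_of_real (t k - t l))" for k
  define c where "c b k = coeff (num k) b / den k" for b k
  have t01: "0 \<le> t k \<and> t k \<le> 1" if "k \<le> L" for k using that by (auto simp: t_def)
  have tinj: "inj_on t {..L}" by (auto simp: inj_on_def t_def)
  have poly_num: "poly (num k) z = (\<Prod>l\<in>{..L}-{k}. z - of_real (t l))" for k z
    by (simp add: num_def poly_prod)
  have den0: "den k \<noteq> 0" if "k \<le> L" for k
    using tinj that by (auto simp: den_def inj_on_def)
  have den: "poly (num k) (of_real (t k)) = den k" for k by (simp add: poly_num den_def)
  have numz: "poly (num k) (of_real (t l)) = 0" if "l \<le> L" "l \<noteq> k" for k l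
    using that by (auto simp: poly_num)
  have degnum: "degree (num k) \<le> L" if "k \<le> L" for k
  proof -
    have "degree (num k) \<le> (\<Sum>l\<in>{..L}-{k}. degree [:-complex_of_real (t l), 1:])"
      unfolding num_def using degree_prod_sum_le[of "{..L}-{k}" "\<lambda>l. [:-complex_of_real (t l), 1:]"] by (simp add: o_def)
    also have "\<dots> = L" using that by simp
    finally show ?thesis .
  qed
  have interp: "p = (\<Sum>k\<le>L. smult (poly p (of_real (t k)) / den k) (num k))" if d: "degree p \<le> L" for p
  proof (rule poly_eqI_degree[where A = "of_real ` t ` {..L}"])
    fix x :: complex assume "x \<in> of_real ` t ` {..L}"
    then obtain l where l: "l \<le> L" "x = of_real (t l)" by auto
    have "(\<Sum>k\<le>L. poly p (of_real (t k)) / den k * poly (num k) x) =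
        (\<Sum>k\<le>L. if k = l then poly p x else 0)"
      using l den0 numz by (intro sum.cong) (auto simp: den)
    then show "poly p x = poly (\<Sum>k\<le>L. smult (poly p (of_real (t k)) / den k) (num k)) x"
      using l by (simp add: poly_sum)
  next
    have card: "card (complex_of_real ` t ` {..L}) = Suc L"
      using tinj by (subst card_image) (auto simp: card_image inj_on_def)
    show "degree p < card (complex_of_real ` t ` {..L})" using card d by simp
    have "degree (\<Sum>k\<le>L. smult (poly p (of_real (t k)) / den k) (num k)) \<le> L"
      using degnum by (intro degree_sum_le) (auto intro: order_trans[OF degree_smult_le])
    then show "degree (\<Sum>k\<le>L. smult (poly p (of_real (t k)) / den k) (num k)) < card (complex_of_real ` t ` {..L})"
      using card by simp
  qed
  have coeffs: "coeff p b = (\<Sum>k\<le>L. c b k * poly p (of_real (t k)))" if "degree p \<le> L" for p b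
    by (subst interp[OF that]) (simp add: coeff_sum c_def mult.commute)
  have normden: "cmod (den k) = fact k * fact (L - k) / real (Suc L) ^ L" if "k \<le> L" for k
  proof -
    have "cmod (den k) = (\<Prod>l\<in>{..L}-{k}. \<bar>t k - t l\<bar>)"
      unfolding den_def by (simp add: prod_norm[symmetric] del: of_real_diff)
    also have "\<dots> = (\<Prod>l\<in>{..L}-{k}. \<bar>real k - real l\<bar> / real (Suc L))"
      by (intro prod.cong refl) (simp add: t_def diff_divide_distrib[symmetric] del: of_nat_Suc)
    also have "\<dots> = fact k * fact (L - k) / real (Suc L) ^ L"
      using prod_node_distances[OF that] that by (simp add: prod_dividef del: of_nat_Suc)
    finally show ?thesis .
  qed
  have cb: "cmod (c b k) \<le> 2 ^ L * (2 ^ L * 3 ^ Suc L)" if "k \<le> L" for b k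
  proof -
    have "cmod (coeff (num k) b) \<le> 2 ^ L"
      unfolding num_def using prod_linear_coeff_bound[of "{..L}-{k}" t b] t01 that by force
    moreover have "1 / cmod (den k) \<le> 2 ^ L * 3 ^ Suc L"
    proof -
      have "1 / cmod (den k) = real (L choose k) * (real (Suc L) ^ L / fact L)"
        unfolding normden[OF that] binomial_fact[OF that, where 'a=real] by (simp del: of_nat_Suc)
      also have "\<dots> \<le> 2 ^ L * exp (real (Suc L))"
      proof (rule mult_mono)
        show "real (L choose k) \<le> 2 ^ L"
          by (metis binomial_le_pow2 of_nat_le_iff of_nat_numeral of_nat_power)
        show "real (Suc L) ^ L / fact L \<le> exp (real (Suc L))"
          by (rule power_div_fact_le_exp) simp
      qed auto
      also have "exp (real (Suc L)) = exp 1 ^ Suc L" using exp_of_nat_mult[of "Suc L" "1::real"] by (simp only: mult_1_right)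
      also have "\<dots> \<le> 3 ^ Suc L" using exp_le by (intro power_mono) auto
      finally show ?thesis by (simp add: mult_left_mono)
    qed
    ultimately have "cmod (coeff (num k) b) * (1 / cmod (den k)) \<le> 2 ^ L * (2 ^ L * 3 ^ Suc L)"
      by (intro mult_mono) auto
    then show ?thesis by (simp add: c_def norm_divide)
  qed
  have "(\<Sum>k\<le>L. cmod (c b k)) \<le> 60 ^ Suc L" for b
  proof -
    have "(\<Sum>k\<le>L. cmod (c b k)) \<le> (\<Sum>k\<le>L. 2 ^ L * (2 ^ L * 3 ^ Suc L))"
      using cb by (intro sum_mono) auto
    also have "\<dots> = real (Suc L) * (2 ^ L * (2 ^ L * 3 ^ Suc L))" by simp
    also have "\<dots> \<le> 2 ^ Suc L * (2 ^ Suc L * (2 ^ Suc L * 3 ^ Suc L))"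
      using of_nat_less_two_power[of "Suc L", where 'a=real]
      by (intro mult_mono order_refl power_increasing mult_nonneg_nonneg zero_le_power) simp_all
    also have "\<dots> = (2 * (2 * (2 * 3))) ^ Suc L" by (simp only: power_mult_distrib)
    also have "\<dots> \<le> 60 ^ Suc L" by (rule power_mono) simp_all
    finally show ?thesis .
  qed
  with t01 coeffs show ?thesis by blast
qed

lemma poly_coeff_bound:
  fixes p :: "complex poly"
  assumes "degree p \<le> L" "0 < R" "\<And>t. 0 \<le> t \<Longrightarrow> t \<le> R \<Longrightarrow> cmod (poly p (of_real t)) \<le> \<eta>"
  shows "cmod (coeff p b) * R ^ b \<le> 60 ^ Suc L * \<eta>"
proof -
  obtain t c where t: "\<And>k. k \<le> L \<Longrightarrow> 0 \<le> t k \<and> t k \<le> (1::real)"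
    and c: "\<And>b. (\<Sum>k\<le>L. cmod (c b k)) \<le> 60 ^ Suc L"
    and eq: "\<And>p b. degree p \<le> L \<Longrightarrow> coeff p b = (\<Sum>k\<le>L. c b k * poly p (of_real (t k)))"
    using lagrange_functional[of L] by blast
  define q where "q = pcompose p [:0, of_real R:]"
  have dq: "degree q \<le> L" using assms by (simp add: q_def degree_pcompose)
  have "coeff q b = of_real R ^ b * coeff p b" by (simp add: q_def coeff_pcompose_linear)
  then have "cmod (coeff p b) * R ^ b = cmod (coeff q b)" using assms(2) by (simp add: norm_mult norm_power)
  also have "\<dots> = cmod (\<Sum>k\<le>L. c b k * poly q (of_real (t k)))" using eq[OF dq] by simp
  also have "\<dots> \<le> (\<Sum>k\<le>L. cmod (c b k) * \<eta>)"
  proof (rule sum_norm_le)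
    fix k assume "k \<in> {..L}"
    then have "0 \<le> R * t k" "R * t k \<le> R" using t[of k] assms(2) by (auto simp: mult_le_cancel_left1)
    from assms(3)[OF this] have "cmod (poly q (of_real (t k))) \<le> \<eta>"
      by (simp add: q_def poly_pcompose mult.commute)
    then show "cmod (c b k * poly q (of_real (t k))) \<le> cmod (c b k) * \<eta>"
      by (simp add: norm_mult mult_left_mono)
  qed
  also have "\<dots> \<le> 60 ^ Suc L * \<eta>"
    using c[of b] order_trans[OF norm_ge_zero assms(3)[of 0]] assms(2)
    by (simp add: sum_distrib_right[symmetric] mult_right_mono)
  finally show ?thesis .
qed

lemma poly_norm_le_coeffs:
  fixes p :: "complex poly"
  assumes "degree p \<le> L" "\<And>b. cmod (coeff p b) \<le> B" "cmod z \<le> T" "1 \<le> T"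
  shows "cmod (poly p z) \<le> 2 ^ Suc L * B * T ^ L"
proof -
  have B0: "0 \<le> B" using order_trans[OF norm_ge_zero assms(2)] .
  have "poly p z = (\<Sum>i\<le>L. coeff p i * z ^ i)"
    unfolding poly_altdef using assms(1) by (intro sum.mono_neutral_left) (auto simp: coeff_eq_0)
  also have "cmod \<dots> \<le> (\<Sum>i\<le>L. B * T ^ L)"
  proof (rule sum_norm_le)
    fix i assume "i \<in> {..L}"
    then have "cmod z ^ i \<le> T ^ L"
      using assms by (meson atMost_iff norm_ge_zero order_trans power_increasing power_mono)
    then show "cmod (coeff p i * z ^ i) \<le> B * T ^ L"
      unfolding norm_mult norm_power using assms(2) B0 by (intro mult_mono) auto
  qed
  also have "\<dots> = real (Suc L) * (B * T ^ L)" by simp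
  also have "\<dots> \<le> 2 ^ Suc L * (B * T ^ L)"
    using of_nat_less_two_power[of "Suc L", where 'a=real] B0 assms(4) by (intro mult_right_mono) auto
  finally show ?thesis by (simp add: mult.assoc)
qed

text \<open>A crude Bernstein-Walsh inequality: passing from the interval to a disc costs only a
  factor exponential in the degree. Here 120 = 2 * 60, from the coefficient bound and the number of
  coefficients.\<close>

lemma poly_disc_bound:
  fixes p :: "complex poly"
  assumes "degree p \<le> L" "\<And>t. 0 \<le> t \<Longrightarrow> t \<le> 1 \<Longrightarrow> cmod (poly p (of_real t)) \<le> \<eta>"
    "cmod z \<le> T" "1 \<le> T"
  shows "cmod (poly p z) \<le> 120 ^ Suc L * \<eta> * T ^ L"
proof -
  have "cmod (poly p z) \<le> 2 ^ Suc L * (60 ^ Suc L * \<eta>) * T ^ L"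
    using poly_coeff_bound[OF assms(1), of 1 \<eta>] assms by (intro poly_norm_le_coeffs) auto
  also have "\<dots> = (2 * 60) ^ Suc L * \<eta> * T ^ L" by (simp only: power_mult_distrib mult.assoc)
  finally show ?thesis by simp
qed

text \<open>The radius comes from interpolating \<open>s \<mapsto> \<Prod>(s - \<bar>a\<^sub>i\<bar>)\<close>, whose value at \<open>-1\<close>
  dominates \<open>P\<close> on the unit disc.\<close>
lemma good_circle:
  fixes P :: "complex poly"
  assumes "degree P \<le> N"
  obtains s where "1/2 \<le> s" "s \<le> 1"
    "\<And>z w. cmod z = s \<Longrightarrow> cmod w \<le> 1 \<Longrightarrow> cmod (poly P w) \<le> 1000 ^ Suc N * cmod (poly P z)"
proof -
  obtain a where P: "smult (lead_coeff P) (\<Prod>i<degree P. [:-a i, 1:]) = P"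
    by (rule complex_poly_decompose')
  define q where "q = (\<Prod>i<degree P. [:- complex_of_real (cmod (a i)), 1:])"
  have dq: "degree q \<le> N"
    unfolding q_def using degree_prod_sum_le[of "{..<degree P}" "\<lambda>i. [:- complex_of_real (cmod (a i)), 1:]"] assms
    by (simp add: o_def)
  have pq: "poly q z = (\<Prod>i<degree P. z - of_real (cmod (a i)))" for z
    by (simp add: q_def poly_prod)
  have PP: "poly P z = lead_coeff P * (\<Prod>i<degree P. z - a i)" for z
    by (subst P[symmetric]) (simp add: poly_prod)
  have nonz: "cmod (complex_of_real (-1) - of_real (cmod x)) = 1 + cmod x" for x
    using norm_of_real[of "-1 - cmod x", where 'a=complex] norm_ge_zero[of x] by (simp del: norm_ge_zero)
  have lower: "cmod (poly q (of_real (cmod z))) \<le> (\<Prod>i<degree P. cmod (z - a i))" for z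
    unfolding pq prod_norm[symmetric]
  proof (rule prod_mono)
    fix i
    show "0 \<le> cmod (complex_of_real (cmod z) - complex_of_real (cmod (a i))) \<and>
       cmod (complex_of_real (cmod z) - complex_of_real (cmod (a i))) \<le> cmod (z - a i)"
      by (metis norm_ge_zero norm_of_real norm_triangle_ineq3 of_real_diff)
  qed
  have upper: "(\<Prod>i<degree P. cmod (w - a i)) \<le> cmod (poly q (-1))" if "cmod w \<le> 1" for w
  proof -
    have "(\<Prod>i<degree P. cmod (w - a i)) \<le> (\<Prod>i<degree P. cmod (complex_of_real (-1) - of_real (cmod (a i))))"
    proof (rule prod_mono)
      fix i
      have "cmod (w - a i) \<le> cmod w + cmod (a i)" by (rule norm_triangle_ineq4)
      then show "0 \<le> cmod (w - a i) \<and> cmod (w - a i) \<le> cmod (complex_of_real (-1) - of_real (cmod (a i)))"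
        using that unfolding nonz by auto
    qed
    then show ?thesis by (simp add: pq prod_norm)
  qed
  have q1: "poly q (-1) \<noteq> 0"
  proof -
    have "complex_of_real (-1) - of_real (cmod x) \<noteq> 0" for x
    proof
      assume "complex_of_real (-1) - of_real (cmod x) = 0"
      then have "1 + cmod x = 0" using nonz[of x] by simp
      then show False using norm_ge_zero[of x] by linarith
    qed
    then show ?thesis unfolding pq by auto
  qed
  have "\<exists>s. 1/2 \<le> s \<and> s \<le> 1 \<and> cmod (poly q (-1)) \<le> 1000 ^ Suc N * cmod (poly q (of_real s))"
  proof (rule ccontr)
    assume "\<not> ?thesis"
    then have small: "1000 ^ Suc N * cmod (poly q (of_real s)) < cmod (poly q (-1))" if "1/2 \<le> s" "s \<le> 1" for s
      using that by (meson not_le)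
    \<comment> \<open>The substitution s = 1/2 + t/2 carries [0,1] to [1/2,1] and -3 to -1.
      Smallness on [1/2,1] would then give |q(-1)| at most (120 * 3/1000)^(N+1) |q(-1)|; any base
      above 360 would do in place of 1000.\<close>
    define r where "r = pcompose q [:1/2, 1/2:]"
    have dr: "degree r \<le> N" using dq by (simp add: r_def degree_pcompose)
    have r: "cmod (poly r (of_real t)) \<le> cmod (poly q (-1)) / 1000 ^ Suc N" if "0 \<le> t" "t \<le> 1" for t
    proof -
      have "poly r (of_real t) = poly q (of_real (1/2 + t/2))" by (simp add: r_def poly_pcompose add_divide_distrib)
      then show ?thesis using small[of "1/2 + t/2"] that by (simp add: field_simps less_imp_le)
    qed
    have "poly r (-3) = poly q (-1)" by (simp add: r_def poly_pcompose)
    then have "cmod (poly q (-1)) \<le> 120 ^ Suc N * (cmod (poly q (-1)) / 1000 ^ Suc N) * 3 ^ N"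
      using poly_disc_bound[OF dr, of "cmod (poly q (-1)) / 1000 ^ Suc N" "-3" 3] r by simp
    also have "\<dots> \<le> 120 ^ Suc N * (cmod (poly q (-1)) / 1000 ^ Suc N) * 3 ^ Suc N"
      by (intro mult_left_mono) (auto intro: divide_nonneg_nonneg)
    also have "\<dots> = (120 * 3 / 1000) ^ Suc N * cmod (poly q (-1))"
      by (simp only: power_mult_distrib power_divide times_divide_eq_right times_divide_eq_left mult.commute mult.left_commute)
    also have "\<dots> < 1 * cmod (poly q (-1))"
      using q1 by (intro mult_strict_right_mono power_Suc_less_one) auto
    finally show False by simp
  qed
  then obtain s where s: "1/2 \<le> s" "s \<le> 1" "cmod (poly q (-1)) \<le> 1000 ^ Suc N * cmod (poly q (of_real s))"
    by blast
  show ?thesis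
  proof (rule that[OF s(1,2)])
    fix z w assume z: "cmod z = s" and w: "cmod w \<le> 1"
    have "(\<Prod>i<degree P. cmod (w - a i)) \<le> cmod (poly q (-1))" by (rule upper[OF w])
    also have "\<dots> \<le> 1000 ^ Suc N * cmod (poly q (of_real s))" by (rule s(3))
    also have "\<dots> \<le> 1000 ^ Suc N * (\<Prod>i<degree P. cmod (z - a i))"
      using lower[of z] z by (intro mult_left_mono) auto
    finally show "cmod (poly P w) \<le> 1000 ^ Suc N * cmod (poly P z)"
      unfolding PP norm_mult prod_norm[symmetric]
      by (subst mult.left_commute) (rule mult_left_mono, auto)
  qed
qed

section \<open>Green's formula for a regularised quotient\<close>

text \<open>The terms are grouped by type: those linear in \<open>a'\<close> and \<open>b'\<close>
  will form the derivative in z, the one in \<open>cnj a'\<close> the derivative in the conjugate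
  variable. The factor \<tau> of the latter is what remains of D after subtracting
  \<open>a t * cnj (a t)\<close>.\<close>

lemma has_vector_derivative_regularised_quotient:
  fixes a b :: "real \<Rightarrow> complex"
  assumes a: "(a has_vector_derivative a') (at t)" and b: "(b has_vector_derivative b') (at t)"
    and \<tau>: "\<tau> > 0"
  defines "D \<equiv> a t * cnj (a t) + complex_of_real \<tau>"
  shows "((\<lambda>t. b t * cnj (a t) / (a t * cnj (a t) + of_real \<tau>)) has_vector_derivative
     (b' * cnj (a t) / D - b t * cnj (a t)^2 * a' / D\<^sup>2 + of_real \<tau> * b t * cnj a' / D\<^sup>2)) (at t)"
proof -
  have D0: "D \<noteq> 0"
  proof -
    have "D = of_real ((cmod (a t))\<^sup>2 + \<tau>)" unfolding D_def of_real_add complex_norm_square ..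
    moreover have "(cmod (a t))\<^sup>2 + \<tau> \<noteq> 0" using \<tau> by (smt (verit) zero_le_power2)
    ultimately show ?thesis by (metis of_real_eq_0_iff)
  qed
  have c: "((\<lambda>t. cnj (a t)) has_vector_derivative cnj a') (at t)"
    using a by (rule has_vector_derivative_cnj)
  have d: "((\<lambda>t. a t * cnj (a t) + of_real \<tau>) has_vector_derivative (a t * cnj a' + a' * cnj (a t) + 0)) (at t)"
    by (intro has_vector_derivative_add has_vector_derivative_mult a c has_vector_derivative_const)
  have i: "((inverse \<circ> (\<lambda>t. a t * cnj (a t) + of_real \<tau>)) has_vector_derivative
      ((a t * cnj a' + a' * cnj (a t) + 0) * (- (inverse D * inverse D)))) (at t)"
    unfolding D_def
    by (rule field_vector_diff_chain_at[OF d]) (use D0 in \<open>auto intro!: derivative_eq_intros simp: D_def power2_eq_square\<close>)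
  have "((\<lambda>t. b t * cnj (a t) * (inverse \<circ> (\<lambda>t. a t * cnj (a t) + of_real \<tau>)) t) has_vector_derivative
     (b t * cnj (a t) * ((a t * cnj a' + a' * cnj (a t) + 0) * (- (inverse D * inverse D)))
       + (b t * cnj a' + b' * cnj (a t)) * (inverse \<circ> (\<lambda>t. a t * cnj (a t) + of_real \<tau>)) t)) (at t)"
    by (intro has_vector_derivative_mult b c i)
  moreover have "b t * cnj (a t) * ((a t * cnj a' + a' * cnj (a t) + 0) * (- (inverse D * inverse D)))
       + (b t * cnj a' + b' * cnj (a t)) * inverse D =
     b' * cnj (a t) / D - b t * cnj (a t)^2 * a' / D\<^sup>2 + of_real \<tau> * b t * cnj a' / D\<^sup>2"
  proof -
    have "b t * cnj a' * inverse D = b t * cnj a' * (a t * cnj (a t) + of_real \<tau>) * (inverse D * inverse D)"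
      using D0 by (simp add: D_def[symmetric])
    then have "(b t * cnj a' + b' * cnj (a t)) * inverse D =
        b t * cnj a' * (a t * cnj (a t) + of_real \<tau>) * (inverse D * inverse D) + b' * cnj (a t) * inverse D"
      by (simp only: distrib_right)
    then show ?thesis
      by (simp only:) (simp add: divide_inverse power2_eq_square algebra_simps)
  qed
  ultimately show ?thesis by (simp add: divide_inverse D_def o_def)
qed

lemma has_vector_derivative_poly_comp:
  fixes P :: "complex poly"
  assumes "(z has_vector_derivative z') (at t)"
  shows "((\<lambda>t. poly P (z t)) has_vector_derivative (z' * poly (pderiv P) (z t))) (at t)"
  using field_vector_diff_chain_at[OF assms poly_DERIV[of P "z t"]] by (simp add: o_def)

definition reg_quotient :: "complex poly \<Rightarrow> complex poly \<Rightarrow> real \<Rightarrow> complex \<Rightarrow> complex" where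
  "reg_quotient R P \<tau> z = poly R z * cnj (poly P z) / (poly P z * cnj (poly P z) + of_real \<tau>)"

text \<open>The \<open>\<partial>/\<partial>z\<close> and \<open>\<partial>/\<partial>\<bar>z\<close> derivatives of the regularised quotient.\<close>
definition reg_dz :: "complex poly \<Rightarrow> complex poly \<Rightarrow> real \<Rightarrow> complex \<Rightarrow> complex" where
  "reg_dz R P \<tau> z = poly (pderiv R) z * cnj (poly P z) / (poly P z * cnj (poly P z) + of_real \<tau>)
    - poly R z * cnj (poly P z)^2 * poly (pderiv P) z / (poly P z * cnj (poly P z) + of_real \<tau>)\<^sup>2"

definition reg_dbar :: "complex poly \<Rightarrow> complex poly \<Rightarrow> real \<Rightarrow> complex \<Rightarrow> complex" where
  "reg_dbar R P \<tau> z = of_real \<tau> * poly R z * cnj (poly (pderiv P) z) / (poly P z * cnj (poly P z) + of_real \<tau>)\<^sup>2"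

lemma has_vector_derivative_reg_quotient:
  assumes "(z has_vector_derivative z') (at t)" "\<tau> > 0"
  shows "((\<lambda>t. reg_quotient R P \<tau> (z t)) has_vector_derivative
     (reg_dz R P \<tau> (z t) * z' + reg_dbar R P \<tau> (z t) * cnj z')) (at t)"
proof -
  have "((\<lambda>t. reg_quotient R P \<tau> (z t)) has_vector_derivative
     (z' * poly (pderiv R) (z t) * cnj (poly P (z t)) / (poly P (z t) * cnj (poly P (z t)) + of_real \<tau>)
     - poly R (z t) * cnj (poly P (z t))^2 * (z' * poly (pderiv P) (z t)) / (poly P (z t) * cnj (poly P (z t)) + of_real \<tau>)\<^sup>2
     + of_real \<tau> * poly R (z t) * cnj (z' * poly (pderiv P) (z t)) / (poly P (z t) * cnj (poly P (z t)) + of_real \<tau>)\<^sup>2)) (at t)"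
    unfolding reg_quotient_def
    by (rule has_vector_derivative_regularised_quotient has_vector_derivative_poly_comp assms)+
  then show ?thesis
    by (rule back_subst[of "\<lambda>d. (_ has_vector_derivative d) _"])
       (simp add: reg_dz_def reg_dbar_def algebra_simps)
qed

lemma reg_denominator: "poly P z * cnj (poly P z) + of_real \<tau> = of_real ((cmod (poly P z))\<^sup>2 + \<tau>)"
  unfolding of_real_add complex_norm_square ..

lemma reg_denominator_nonzero:
  assumes "\<tau> > 0" shows "poly P z * cnj (poly P z) + complex_of_real \<tau> \<noteq> 0"
  unfolding reg_denominator of_real_eq_0_iff using assms by (smt (verit) zero_le_power2)

lemma continuous_on_reg [continuous_intros]:
  assumes "\<tau> > 0" "continuous_on S f"
  shows "continuous_on S (\<lambda>x. reg_quotient R P \<tau> (f x))" "continuous_on S (\<lambda>x. reg_dz R P \<tau> (f x))"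
    "continuous_on S (\<lambda>x. reg_dbar R P \<tau> (f x))"
  unfolding reg_quotient_def reg_dz_def reg_dbar_def using assms
  by (auto intro!: continuous_intros simp: reg_denominator_nonzero)

text \<open>Polar form of Green's theorem: the angular part of the gradient integrates to zero
  over the circle, which leaves twice the \<open>\<partial>/\<partial>\<bar>z\<close> part.\<close>
lemma has_vector_derivative_circle_integral:
  assumes \<tau>: "\<tau> > 0" and s: "s > 0"
  shows "((\<lambda>s. integral {0..2*pi} (\<lambda>\<theta>. reg_quotient R P \<tau> (of_real s * cis \<theta>))) has_vector_derivative
     2 * integral {0..2*pi} (\<lambda>\<theta>. reg_dbar R P \<tau> (of_real s * cis \<theta>) * cis (-\<theta>))) (at s)"
proof -
  let ?A = "\<lambda>s \<theta>. reg_dz R P \<tau> (of_real s * cis \<theta>) * cis \<theta>"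
  let ?B = "\<lambda>s \<theta>. reg_dbar R P \<tau> (of_real s * cis \<theta>) * cis (-\<theta>)"
  have ds: "((\<lambda>s. reg_quotient R P \<tau> (of_real s * cis \<theta>)) has_vector_derivative ?A s \<theta> + ?B s \<theta>) (at s)" for s \<theta>
  proof -
    have "((\<lambda>s. of_real s * cis \<theta>) has_vector_derivative (1 * cis \<theta>)) (at s)"
      by (auto intro!: derivative_eq_intros)
    from has_vector_derivative_reg_quotient[OF this \<tau>, of R P] show ?thesis
      by (simp add: cis_cnj)
  qed
  have "((\<lambda>s. integral (cbox 0 (2*pi)) (\<lambda>\<theta>. reg_quotient R P \<tau> (of_real s * cis \<theta>))) has_vector_derivative
     integral (cbox 0 (2*pi)) (\<lambda>\<theta>. ?A s \<theta> + ?B s \<theta>)) (at s within UNIV)"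
    using ds \<tau>
    by (intro leibniz_rule_vector_derivative)
       (auto intro!: integrable_continuous_real continuous_intros simp: split_beta)
  moreover have int: "(\<lambda>\<theta>. ?A s \<theta>) integrable_on {0..2*pi}" "(\<lambda>\<theta>. ?B s \<theta>) integrable_on {0..2*pi}"
    using \<tau> by (auto intro!: integrable_continuous_real continuous_intros)
  moreover have "integral {0..2*pi} (?A s) = integral {0..2*pi} (?B s)"
  proof -
    have dt: "((\<lambda>\<theta>. reg_quotient R P \<tau> (of_real s * cis \<theta>)) has_vector_derivative
       (\<i> * of_real s) * (?A s \<theta> - ?B s \<theta>)) (at \<theta>)" for \<theta>
    proof -
      have "(cis has_vector_derivative (\<i> * cis \<theta>)) (at \<theta>)"
      proof -
        have "((\<lambda>b. \<i> * of_real b) has_vector_derivative (\<i> * 1)) (at \<theta>)"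
          by (auto intro!: derivative_eq_intros)
        from field_vector_diff_chain_at[OF this DERIV_exp] show ?thesis
          by (simp add: o_def cis_conv_exp[abs_def])
      qed
      then have "((\<lambda>\<theta>. of_real s * cis \<theta>) has_vector_derivative (of_real s * (\<i> * cis \<theta>))) (at \<theta>)"
        by (rule has_vector_derivative_mult_right)
      from has_vector_derivative_reg_quotient[OF this \<tau>, of R P] show ?thesis
        by (rule back_subst[of "\<lambda>d. (_ has_vector_derivative d) _"]) (simp add: cis_cnj algebra_simps)
    qed
    have "((\<lambda>\<theta>. (\<i> * of_real s) * (?A s \<theta> - ?B s \<theta>)) has_integral
       (reg_quotient R P \<tau> (of_real s * cis (2*pi)) - reg_quotient R P \<tau> (of_real s * cis 0))) {0..2*pi}"
      by (intro fundamental_theorem_of_calculus has_vector_derivative_at_within[OF dt]) auto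
    then have "((\<lambda>\<theta>. (\<i> * of_real s) * (?A s \<theta> - ?B s \<theta>)) has_integral 0) {0..2*pi}"
      by simp
    then have "(\<i> * of_real s) * (integral {0..2*pi} (?A s) - integral {0..2*pi} (?B s)) = 0"
      using int by (simp add: integral_unique integral_diff[symmetric] flip: integral_mult_right)
    then show ?thesis using s by simp
  qed
  ultimately show ?thesis by (simp add: integral_add)
qed

text \<open>Integrates the radial derivative of the circle integral from 0, where it vanishes
  because R does, up to T. The bound \<open>g\<close> may blow up at the finitely many radii in
  \<open>S\<close>; its integral is encoded by the continuous primitive \<open>H\<close>. The factor
  4 pi is the 2 from Green's formula times the length 2 pi of the angular interval.\<close>

lemma circle_integral_bound:
  assumes \<tau>: "\<tau> > 0" and R0: "poly R 0 = 0" and T: "0 \<le> T" and fin: "finite S"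
    and H: "\<And>s. s \<in> {0<..<T} - S \<Longrightarrow> (H has_vector_derivative g s) (at s)" "continuous_on {0..T} H"
    and bd: "\<And>s \<theta>. s \<in> {0<..<T} - S \<Longrightarrow> cmod (reg_dbar R P \<tau> (of_real s * cis \<theta>)) \<le> g s"
  shows "cmod (integral {0..2*pi} (\<lambda>\<theta>. reg_quotient R P \<tau> (of_real T * cis \<theta>))) \<le> 4 * pi * (H T - H 0)"
proof -
  define J where "J s = integral {0..2*pi} (\<lambda>\<theta>. reg_quotient R P \<tau> (of_real s * cis \<theta>))" for s
  \<comment> \<open>At the exceptional radii nothing is known about \<open>g\<close>, while the norm
    comparison below is needed at every point of {0..T}; both integrands are therefore set to 0
    there.\<close>
  define J' where "J' s = (if s \<in> insert 0 (insert T S) then 0 else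
      2 * integral {0..2*pi} (\<lambda>\<theta>. reg_dbar R P \<tau> (of_real s * cis \<theta>) * cis (-\<theta>)))" for s
  define g' where "g' s = (if s \<in> insert 0 (insert T S) then 0 else g s)" for s
  have J0: "J 0 = 0" using R0 by (simp add: J_def reg_quotient_def)
  have contJ: "continuous_on {0..T} J"
    unfolding J_def using \<tau>
    by (intro integral_continuous_on_param[of "{0..T}" 0 "2*pi", unfolded cbox_interval])
       (auto simp: split_beta intro!: continuous_intros)
  have 1: "(J' has_integral (J T - J 0)) {0..T}"
  proof (rule fundamental_theorem_of_calculus_interior_strong[of "insert 0 (insert T S)"])
    fix s assume "s \<in> {0<..<T} - insert 0 (insert T S)"
    then show "(J has_vector_derivative J' s) (at s)"
      using has_vector_derivative_circle_integral[OF \<tau>, of s R P] by (auto simp: J_def[abs_def] J'_def)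
  qed (use fin T contJ in auto)
  have 2: "(g' has_integral (H T - H 0)) {0..T}"
  proof (rule fundamental_theorem_of_calculus_interior_strong[of "insert 0 (insert T S)"])
    fix s assume "s \<in> {0<..<T} - insert 0 (insert T S)"
    then show "(H has_vector_derivative g' s) (at s)"
      using H(1)[of s] by (auto simp: g'_def)
  qed (use fin T H in auto)
  have "norm (J' s) \<le> (4 * pi) * g' s" if "s \<in> {0..T}" for s
  proof (cases "s \<in> insert 0 (insert T S)")
    case False
    then have s: "s \<in> {0<..<T} - S" using that by auto
    have "norm (integral (cbox 0 (2*pi)) (\<lambda>\<theta>. reg_dbar R P \<tau> (of_real s * cis \<theta>) * cis (-\<theta>))) \<le>
        g s * measure lborel (cbox 0 (2*pi))"
      using bd[OF s] \<tau> order_trans[OF norm_ge_zero bd[OF s]]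
      by (intro integrable_bound integrable_continuous continuous_intros) (auto simp: norm_mult)
    then show ?thesis using False by (simp add: J'_def g'_def norm_mult algebra_simps)
  qed (auto simp: J'_def g'_def)
  then have "norm (J T - J 0) \<le> 4 * pi * (H T - H 0)"
    using 1 has_integral_mult_right[OF 2, of "4*pi"]
    by (metis has_integral_integrable integral_norm_bound_integral integral_unique)
  then show ?thesis unfolding J0 by (simp add: J_def)
qed

section \<open>Integrability of powers of the logarithmic derivative of a polynomial\<close>

lemma powr_add_le:
  fixes x y p :: real
  assumes "0 \<le> x" "0 \<le> y" "0 < p" "p \<le> 1"
  shows "(x + y) powr p \<le> x powr p + y powr p"
proof (cases "x + y = 0")
  case False
  then have xy: "x + y > 0" using assms by auto
  have *: "u / (x + y) \<le> (u / (x + y)) powr p" if "0 \<le> u" "u \<le> x + y" for u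
  proof (cases "u = 0")
    case False
    then have "u / (x+y) > 0" "u / (x+y) \<le> 1" using that xy by auto
    then show ?thesis using powr_mono'[of p 1 "u / (x+y)"] powr_one[of "u / (x+y)"] assms by linarith
  qed auto
  have "1 = x / (x + y) + y / (x + y)" using xy by (simp add: add_divide_distrib[symmetric])
  also have "\<dots> \<le> (x / (x + y)) powr p + (y / (x + y)) powr p"
    using assms by (intro add_mono *) auto
  also have "\<dots> = (x powr p + y powr p) / (x + y) powr p"
    using assms xy by (simp add: powr_divide add_divide_distrib)
  finally show ?thesis using xy by (simp add: field_simps)
qed auto

lemma powr_sum_le:
  fixes f :: "'a \<Rightarrow> real"
  assumes "finite A" "\<And>i. i \<in> A \<Longrightarrow> 0 \<le> f i" "0 < p" "p \<le> 1"
  shows "(\<Sum>i\<in>A. f i) powr p \<le> (\<Sum>i\<in>A. f i powr p)"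
  using assms(1,2)
proof (induction A rule: finite_induct)
  case (insert x A)
  have "(f x + sum f A) powr p \<le> f x powr p + sum f A powr p"
    using insert assms by (intro powr_add_le sum_nonneg) auto
  then show ?case using insert by auto
qed auto

text \<open>P'/P is the sum of 1/(z - a_i), and |z - a_i| is at least the difference of the moduli.
  The resulting bound depends on the radius alone, so it serves for a whole circle at once.\<close>

lemma norm_log_pderiv_le:
  fixes P :: "complex poly" and N :: nat
  assumes P: "smult (lead_coeff P) (\<Prod>i<N. [:-a i, 1:]) = P" and nz: "poly P z \<noteq> 0"
    and s: "\<And>i. i < N \<Longrightarrow> cmod z \<noteq> cmod (a i)"
  shows "cmod (poly (pderiv P) z) \<le> cmod (poly P z) * (\<Sum>i<N. 1 / \<bar>cmod z - cmod (a i)\<bar>)"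
proof -
  have za: "z - a i \<noteq> 0" if "i < N" for i using s[OF that] by auto
  have "poly (pderiv P) z = lead_coeff P * (\<Sum>m<N. \<Prod>i\<in>{..<N}-{m}. z - a i)"
    by (subst (1) P[symmetric]) (simp add: pderiv_smult pderiv_prod poly_sum poly_prod pderiv_pCons)
  also have "(\<Sum>m<N. \<Prod>i\<in>{..<N}-{m}. z - a i) = (\<Sum>m<N. (\<Prod>i<N. z - a i) * (1 / (z - a m)))"
  proof (intro sum.cong refl)
    fix m assume "m \<in> {..<N}"
    then have "(\<Prod>i<N. z - a i) = (z - a m) * (\<Prod>i\<in>{..<N}-{m}. z - a i)"
      by (intro prod.remove) auto
    then show "(\<Prod>i\<in>{..<N}-{m}. z - a i) = (\<Prod>i<N. z - a i) * (1 / (z - a m))"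
      using za[of m] \<open>m \<in> {..<N}\<close> by simp
  qed
  also have "lead_coeff P * \<dots> = poly P z * (\<Sum>m<N. 1 / (z - a m))"
    by (subst (3) P[symmetric]) (simp add: poly_prod sum_distrib_left mult.assoc)
  finally have "cmod (poly (pderiv P) z) = cmod (poly P z) * cmod (\<Sum>m<N. 1 / (z - a m))"
    by (simp add: norm_mult)
  also have "cmod (\<Sum>m<N. 1 / (z - a m)) \<le> (\<Sum>m<N. 1 / \<bar>cmod z - cmod (a m)\<bar>)"
  proof (rule sum_norm_le)
    fix m assume "m \<in> {..<N}"
    then show "cmod (1 / (z - a m)) \<le> 1 / \<bar>cmod z - cmod (a m)\<bar>"
      using s[of m] norm_triangle_ineq3[of z "a m"] by (auto simp: norm_divide intro!: divide_left_mono mult_pos_pos)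
  qed
  finally show ?thesis by (simp add: mult_left_mono)
qed

text \<open>The odd function sgn(x) |x|^\<beta>, a primitive of the singular density \<beta>
  |x|^(\<beta>-1) that stays continuous at 0 when \<beta> > 0.\<close>

definition signed_powr :: "real \<Rightarrow> real \<Rightarrow> real" where
  "signed_powr \<beta> x = max x 0 powr \<beta> - max (-x) 0 powr \<beta>"

lemma continuous_on_signed_powr:
  assumes "\<beta> > 0" shows "continuous_on S (\<lambda>s. signed_powr \<beta> (s - a))"
  unfolding signed_powr_def using assms
  by (intro continuous_intros continuous_on_powr') auto

lemma has_vector_derivative_signed_powr:
  assumes "s \<noteq> a"
  shows "((\<lambda>s. signed_powr \<beta> (s - a)) has_vector_derivative \<beta> * \<bar>s - a\<bar> powr (\<beta> - 1)) (at s)"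
proof (cases "s > a")
  case True
  have "((\<lambda>s. (s - a) powr \<beta>) has_real_derivative \<beta> * \<bar>s - a\<bar> powr (\<beta> - 1)) (at s)"
    using True by (auto intro!: derivative_eq_intros simp: powr_diff field_simps)
  then have "((\<lambda>s. signed_powr \<beta> (s - a)) has_real_derivative \<beta> * \<bar>s - a\<bar> powr (\<beta> - 1)) (at s)"
    by (rule has_field_derivative_transform_within_open[where S="{a<..}"]) (use True in \<open>auto simp: signed_powr_def\<close>)
  then show ?thesis by (simp add: has_real_derivative_iff_has_vector_derivative)
next
  case False
  with assms have l: "s < a" by simp
  have "((\<lambda>s. - ((a - s) powr \<beta>)) has_real_derivative \<beta> * \<bar>s - a\<bar> powr (\<beta> - 1)) (at s)"
    using l by (auto intro!: derivative_eq_intros simp: powr_diff field_simps)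
  then have "((\<lambda>s. signed_powr \<beta> (s - a)) has_real_derivative \<beta> * \<bar>s - a\<bar> powr (\<beta> - 1)) (at s)"
    by (rule has_field_derivative_transform_within_open[where S="{..<a}"]) (use l in \<open>auto simp: signed_powr_def\<close>)
  then show ?thesis by (simp add: has_real_derivative_iff_has_vector_derivative)
qed

text \<open>The bound is uniform in \<open>a\<close>, so every zero of P contributes the same amount
  wherever it lies. Beyond T this is subadditivity of the power function, applied to a = (a - T) +
  T.\<close>

lemma signed_powr_diff_le:
  assumes "0 \<le> a" "0 \<le> T" "0 < \<beta>" "\<beta> \<le> 1"
  shows "signed_powr \<beta> (T - a) - signed_powr \<beta> (0 - a) \<le> 2 * T powr \<beta>"
proof (cases "a \<le> T")
  case True
  have "(T - a) powr \<beta> \<le> T powr \<beta>" "a powr \<beta> \<le> T powr \<beta>"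
    using assms True by (auto intro!: powr_mono2)
  then show ?thesis using True assms by (simp add: signed_powr_def max_def)
next
  case False
  have "((a - T) + T) powr \<beta> \<le> (a - T) powr \<beta> + T powr \<beta>"
    using assms False by (intro powr_add_le) auto
  then show ?thesis using False assms by (simp add: signed_powr_def max_def) (smt (verit) powr_ge_zero)
qed

lemma norm_reg_dbar:
  assumes "\<tau> > 0"
  shows "cmod (reg_dbar R P \<tau> z) = \<tau> * cmod (poly R z) * cmod (poly (pderiv P) z) / ((cmod (poly P z))\<^sup>2 + \<tau>)\<^sup>2"
proof -
  have "cmod (poly P z * cnj (poly P z) + of_real \<tau>) = (cmod (poly P z))\<^sup>2 + \<tau>"
    unfolding reg_denominator norm_of_real using assms by simp
  then show ?thesis using assms by (simp add: reg_dbar_def norm_mult norm_divide norm_power)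
qed

text \<open>An exponent count with y = max |P| (sqrt \<tau>): the numerator is at most \<tau> times
  y^(1+2\<beta>) times X^\<beta> (y u)^(1-\<beta>), the denominator at least y^4. This leaves \<tau>
  y^(\<beta>-2), at most \<tau>^(\<beta>/2) since y \<ge> sqrt \<tau>. Without the surplus 2\<beta>
  in the bound on R the same count would end at \<tau>^(-\<beta>/2). Taking u only to the power
  1-\<beta> makes the bound integrable over the radius.\<close>

lemma norm_reg_dbar_le:
  assumes \<tau>: "\<tau> > 0" and \<beta>: "0 < \<beta>" "\<beta> \<le> 1"
    and R: "cmod (poly R z) \<le> B * max (cmod (poly P z)) (sqrt \<tau>) powr (1 + 2*\<beta>)" and B: "0 \<le> B"
    and X: "cmod (poly (pderiv P) z) \<le> X" and u: "cmod (poly (pderiv P) z) \<le> cmod (poly P z) * u" "0 \<le> u"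
  shows "cmod (reg_dbar R P \<tau> z) \<le> B * \<tau> powr (\<beta>/2) * X powr \<beta> * u powr (1 - \<beta>)"
proof -
  define x where "x = cmod (poly P z)"
  define y where "y = max x (sqrt \<tau>)"
  define d where "d = cmod (poly (pderiv P) z)"
  have y0: "y > 0" and xy: "0 \<le> x" "x \<le> y" and y\<tau>: "sqrt \<tau> \<le> y" using \<tau> by (auto simp: y_def x_def max_def)
  have d: "0 \<le> d" "d \<le> X" "d \<le> y * u" using X u xy mult_right_mono[of x y u] by (auto simp: d_def x_def)
  have D: "y\<^sup>2 \<le> x\<^sup>2 + \<tau>"
    using \<tau> by (auto simp: y_def max_def)
  have dd: "d \<le> X powr \<beta> * (y powr (1 - \<beta>) * u powr (1 - \<beta>))"
  proof (cases "d = 0")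
    case False
    then have "d = d powr \<beta> * d powr (1 - \<beta>)" using d by (simp add: powr_add[symmetric])
    also have "\<dots> \<le> X powr \<beta> * (y * u) powr (1 - \<beta>)"
      using d \<beta> by (intro mult_mono powr_mono2) auto
    finally show ?thesis using y0 u by (simp add: powr_mult)
  qed (use y0 in auto)
  have "cmod (reg_dbar R P \<tau> z) = \<tau> * cmod (poly R z) * d / (x\<^sup>2 + \<tau>)\<^sup>2"
    using norm_reg_dbar[OF \<tau>] by (simp add: d_def x_def)
  also have "\<dots> \<le> \<tau> * (B * y powr (1 + 2*\<beta>)) * (X powr \<beta> * (y powr (1 - \<beta>) * u powr (1 - \<beta>))) / (y\<^sup>2)\<^sup>2"
    using R dd D \<tau> B y0 d by (intro frac_le mult_mono power_mono) (auto simp: x_def y_def)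
  also have "\<dots> = B * X powr \<beta> * u powr (1 - \<beta>) * (\<tau> * y powr (\<beta> - 2))"
  proof -
    have "(y\<^sup>2)\<^sup>2 = y powr 4" using y0 by (simp add: power_mult[symmetric])
    then have "y powr (1 + 2*\<beta>) * y powr (1 - \<beta>) / (y\<^sup>2)\<^sup>2 = y powr ((1 + 2*\<beta>) + (1 - \<beta>) - 4)"
      by (simp only: powr_add powr_diff)
    also have "(1 + 2*\<beta>) + (1 - \<beta>) - 4 = \<beta> - 2" by simp
    finally have "y powr (1 + 2*\<beta>) * y powr (1 - \<beta>) / (y\<^sup>2)\<^sup>2 = y powr (\<beta> - 2)" .
    from this[symmetric] show ?thesis
      by (simp only: \<open>y powr (\<beta> - 2) = _\<close> times_divide_eq_right times_divide_eq_left mult_ac)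
  qed
  also have "\<dots> \<le> B * X powr \<beta> * u powr (1 - \<beta>) * (\<tau> * sqrt \<tau> powr (\<beta> - 2))"
    using B \<tau> y0 y\<tau> \<beta> by (intro mult_left_mono powr_mono2') auto
  also have "\<tau> * sqrt \<tau> powr (\<beta> - 2) = \<tau> powr (\<beta>/2)"
  proof -
    have "\<tau> * sqrt \<tau> powr (\<beta> - 2) = \<tau> powr 1 * \<tau> powr (1/2 * (\<beta> - 2))"
      using \<tau> by (simp add: powr_half_sqrt[symmetric] powr_powr)
    also have "\<dots> = \<tau> powr (\<beta>/2)" unfolding powr_add[symmetric] by (simp add: field_simps)
    finally show ?thesis .
  qed
  finally show ?thesis by (simp add: mult_ac)
qed

text \<open>Bounding \<open>|P'|\<close> by a geometric mean of \<open>X\<close> and \<open>|P| \<Sum> 1/||z| - |a\<^sub>i||\<close> keeps the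
  singularities at the radii \<open>|a\<^sub>i|\<close> integrable.\<close>
lemma circle_moment_bound:
  assumes \<tau>: "\<tau> > 0" and \<beta>: "0 < \<beta>" "\<beta> \<le> 1/2" and T: "0 < T" and R0: "poly R 0 = 0" and P0: "P \<noteq> 0"
    and R: "\<And>z. cmod z \<le> T \<Longrightarrow> cmod (poly R z) \<le> B * max (cmod (poly P z)) (sqrt \<tau>) powr (1 + 2*\<beta>)" and B: "0 \<le> B"
    and X: "\<And>z. cmod z \<le> T \<Longrightarrow> cmod (poly (pderiv P) z) \<le> X"
  shows "cmod (integral {0..2*pi} (\<lambda>\<theta>. reg_quotient R P \<tau> (of_real T * cis \<theta>)))
    \<le> 8 * pi / \<beta> * B * \<tau> powr (\<beta>/2) * X powr \<beta> * real (degree P) * T powr \<beta>"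
proof -
  obtain a where P: "smult (lead_coeff P) (\<Prod>i<degree P. [:-a i, 1:]) = P"
    by (rule complex_poly_decompose')
  define N where "N = degree P"
  define K where "K = B * \<tau> powr (\<beta>/2) * X powr \<beta>"
  have K0: "0 \<le> K" using B by (simp add: K_def)
  define r where "r i = cmod (a i)" for i
  define S where "S = r ` {..<N}"
  define H where "H s = K / \<beta> * (\<Sum>i<N. signed_powr \<beta> (s - r i))" for s
  define g where "g s = K / \<beta> * (\<Sum>i<N. \<beta> * \<bar>s - r i\<bar> powr (\<beta> - 1))" for s
  have "cmod (integral {0..2*pi} (\<lambda>\<theta>. reg_quotient R P \<tau> (of_real T * cis \<theta>))) \<le> 4 * pi * (H T - H 0)"
  proof (rule circle_integral_bound[where S=S and g=g])
    show "finite S" by (simp add: S_def)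
    show "continuous_on {0..T} H"
      unfolding H_def using \<beta> by (intro continuous_intros continuous_on_signed_powr) auto
    fix s assume s: "s \<in> {0<..<T} - S"
    then have sr: "s \<noteq> r i" if "i < N" for i using that by (auto simp: S_def)
    show "(H has_vector_derivative g s) (at s)"
      unfolding H_def g_def using sr
      by (intro has_vector_derivative_mult_right has_vector_derivative_sum has_vector_derivative_signed_powr) auto
    fix \<theta>
    define z where "z = of_real s * cis \<theta>"
    have z: "cmod z = s" using s by (simp add: z_def norm_mult)
    have Pz: "poly P z \<noteq> 0"
    proof -
      have "z - a i \<noteq> 0" if "i < N" for i using sr[OF that] z by (auto simp: r_def)
      then show ?thesis by (subst P[symmetric]) (use P0 in \<open>auto simp: poly_prod N_def\<close>)
    qed
    define u where "u = (\<Sum>i<N. 1 / \<bar>cmod z - cmod (a i)\<bar>)"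
    have "cmod (poly (pderiv P) z) \<le> cmod (poly P z) * u"
      unfolding u_def N_def using norm_log_pderiv_le[OF P Pz] sr z by (auto simp: r_def N_def)
    then have "cmod (reg_dbar R P \<tau> z) \<le> K * u powr (1 - \<beta>)"
      unfolding K_def using \<beta> s z R[of z] X[of z] by (intro norm_reg_dbar_le \<tau> B) (auto simp: u_def intro!: sum_nonneg)
    also have "u powr (1 - \<beta>) \<le> (\<Sum>i<N. (1 / \<bar>cmod z - cmod (a i)\<bar>) powr (1 - \<beta>))"
      unfolding u_def using \<beta> by (intro powr_sum_le) auto
    also have "\<dots> = (\<Sum>i<N. \<bar>s - r i\<bar> powr (\<beta> - 1))"
      using sr by (intro sum.cong refl) (auto simp: z r_def powr_divide powr_minus_divide[symmetric])
    also have "K * \<dots> = g s" using \<beta> by (simp add: g_def sum_distrib_left[symmetric])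
    finally show "cmod (reg_dbar R P \<tau> (of_real s * cis \<theta>)) \<le> g s" using K0 by (simp add: z_def mult_left_mono)
  qed (use \<tau> R0 T in auto)
  also have "H T - H 0 = K / \<beta> * (\<Sum>i<N. signed_powr \<beta> (T - r i) - signed_powr \<beta> (0 - r i))"
    by (simp add: H_def sum_subtractf right_diff_distrib)
  also have "\<dots> \<le> K / \<beta> * (\<Sum>i<N. 2 * T powr \<beta>)"
    using K0 \<beta> T by (intro mult_left_mono sum_mono signed_powr_diff_le) (auto simp: r_def)
  finally show ?thesis by (simp add: K_def N_def mult_ac)
qed

section \<open>Approximate division of polynomials\<close>

text \<open>Applied to \<open>f z / z ^ k\<close> or \<open>f z * z ^ l\<close>, this is the Fourier
  coefficient of degree k or -l of \<open>f\<close> on the circle, normalised so that a polynomial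
  returns its own coefficients.\<close>

definition circle_mean :: "real \<Rightarrow> (complex \<Rightarrow> complex) \<Rightarrow> complex" where
  "circle_mean T f = integral {0..2*pi} (\<lambda>\<theta>. f (of_real T * cis \<theta>)) / of_real (2*pi)"

lemma circle_mean_norm_le:
  assumes "T > 0" "continuous_on (sphere 0 T) f" "\<And>z. cmod z = T \<Longrightarrow> cmod (f z) \<le> B"
  shows "cmod (circle_mean T f) \<le> B"
proof -
  have B0: "0 \<le> B" using order_trans[OF norm_ge_zero assms(3)[of "of_real T"]] assms(1) by simp
  have "norm (integral (cbox 0 (2*pi)) (\<lambda>\<theta>. f (of_real T * cis \<theta>))) \<le> B * measure lborel (cbox 0 (2*pi))"
    using assms
    by (intro integrable_bound B0 integrable_continuous continuous_on_compose2[OF assms(2)] continuous_intros)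
       (auto simp: norm_mult)
  then show ?thesis by (simp add: circle_mean_def norm_divide norm_mult field_simps)
qed

lemma circle_integrable:
  fixes f :: "complex \<Rightarrow> complex"
  assumes "T > 0" "continuous_on (sphere 0 T) f"
  shows "(\<lambda>\<theta>. f (of_real T * cis \<theta>)) integrable_on {0..2*pi}"
  using assms
  by (intro integrable_continuous_real continuous_on_compose2[OF assms(2)] continuous_intros)
     (auto simp: norm_mult)

lemma circle_mean_add:
  assumes "T > 0" "continuous_on (sphere 0 T) f" "continuous_on (sphere 0 T) g"
  shows "circle_mean T (\<lambda>z. f z + g z) = circle_mean T f + circle_mean T g"
  using circle_integrable[OF assms(1,2)] circle_integrable[OF assms(1,3)]
  by (simp add: circle_mean_def integral_add add_divide_distrib)

lemma circle_mean_cmult: "circle_mean T (\<lambda>z. c * f z) = c * circle_mean T f"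
  by (simp add: circle_mean_def integral_mult_right)

lemma circle_mean_sum:
  assumes "T > 0" "finite A" "\<And>i. i \<in> A \<Longrightarrow> continuous_on (sphere 0 T) (f i)"
  shows "circle_mean T (\<lambda>z. \<Sum>i\<in>A. f i z) = (\<Sum>i\<in>A. circle_mean T (f i))"
  using circle_integrable[OF assms(1,3)] assms(2)
  by (simp add: circle_mean_def integral_sum sum_divide_distrib)

lemma circle_mean_cong:
  assumes "T > 0" "\<And>z. cmod z = T \<Longrightarrow> f z = g z"
  shows "circle_mean T f = circle_mean T g"
  unfolding circle_mean_def using assms by (simp add: norm_mult)

lemma circle_mean_monomials:
  assumes "T > 0"
  shows "circle_mean T (\<lambda>z. z ^ a / z ^ k) = (if a = k then 1 else 0)"
proof (cases "a = k")
  case True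
  have "circle_mean T (\<lambda>z. z ^ a / z ^ k) = circle_mean T (\<lambda>z. 1)"
    using assms True by (intro circle_mean_cong) auto
  also have "\<dots> = 1"
    by (simp add: circle_mean_def complex_eq_iff)
  finally show ?thesis using True by simp
next
  case False
  define n where "n = real a - real k"
  have n: "n \<noteq> 0" using False by (simp add: n_def)
  have eq: "(of_real T * cis \<theta>) ^ a / (of_real T * cis \<theta>) ^ k = of_real T ^ a / of_real T ^ k * exp (\<i> * of_real n * of_real \<theta>)" for \<theta>
  proof -
    have "(of_real T * cis \<theta>) ^ a / (of_real T * cis \<theta>) ^ k = of_real T ^ a / of_real T ^ k * (cis \<theta> ^ a / cis \<theta> ^ k)"
      unfolding power_mult_distrib times_divide_times_eq ..
    also have "cis \<theta> ^ a / cis \<theta> ^ k = cis (real a * \<theta> - real k * \<theta>)"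
      unfolding Complex.DeMoivre cis_divide ..
    also have "real a * \<theta> - real k * \<theta> = n * \<theta>" unfolding n_def left_diff_distrib ..
    also have "cis (n * \<theta>) = exp (\<i> * of_real n * of_real \<theta>)"
      unfolding cis_conv_exp of_real_mult mult.assoc ..
    finally show ?thesis .
  qed
  have "((\<lambda>\<theta>. exp (\<i> * of_real n * of_real \<theta>)) has_integral
     (exp (\<i> * of_real n * of_real (2*pi)) / (\<i> * of_real n) - exp (\<i> * of_real n * of_real 0) / (\<i> * of_real n))) {0..2*pi}"
  proof (rule fundamental_theorem_of_calculus)
    fix \<theta> :: real
    have "((\<lambda>b. \<i> * of_real n * of_real b) has_vector_derivative (\<i> * of_real n * 1)) (at \<theta>)"
      by (auto intro!: derivative_eq_intros)
    then have "((\<lambda>b. exp (\<i> * of_real n * of_real b)) has_vector_derivative (\<i> * of_real n * 1 * exp (\<i> * of_real n * of_real \<theta>))) (at \<theta>)"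
      using field_vector_diff_chain_at[OF _ DERIV_exp] unfolding o_def by blast
    then have "((\<lambda>b. exp (\<i> * of_real n * of_real b) / (\<i> * of_real n)) has_vector_derivative
       (\<i> * of_real n * 1 * exp (\<i> * of_real n * of_real \<theta>) / (\<i> * of_real n))) (at \<theta>)"
      by (rule has_vector_derivative_divide)
    moreover have "\<i> * of_real n * 1 * exp (\<i> * of_real n * of_real \<theta>) / (\<i> * of_real n) = exp (\<i> * of_real n * of_real \<theta>)"
      using n by (simp only: nonzero_mult_div_cancel_left mult_eq_0_iff of_real_eq_0_iff complex_i_not_zero simp_thms mult_1_right)
    ultimately have "((\<lambda>b. exp (\<i> * of_real n * of_real b) / (\<i> * of_real n)) has_vector_derivative
       (exp (\<i> * of_real n * of_real \<theta>))) (at \<theta>)"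
      by (simp only:)
    then show "((\<lambda>\<theta>. exp (\<i> * of_real n * of_real \<theta>) / (\<i> * of_real n)) has_vector_derivative
       (exp (\<i> * of_real n * of_real \<theta>))) (at \<theta> within {0..2*pi})"
      by (rule has_vector_derivative_at_within)
  qed simp
  moreover have "exp (\<i> * of_real n * of_real (2*pi)) = 1"
  proof -
    have "exp (\<i> * of_real n * of_real (2*pi)) = cis (2 * pi * n)"
      unfolding cis_conv_exp of_real_mult by (simp only: mult_ac)
    also have "\<dots> = 1" by (rule cis_multiple_2pi) (simp add: n_def)
    finally show ?thesis .
  qed
  ultimately have "integral {0..2*pi} (\<lambda>\<theta>. exp (\<i> * of_real n * of_real \<theta>)) = 0"
    by (simp add: integral_unique)
  then show ?thesis using False by (simp add: circle_mean_def eq integral_mult_right)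
qed

lemma circle_mean_poly_coeff:
  assumes "T > 0"
  shows "circle_mean T (\<lambda>z. poly Q z / z ^ k) = coeff Q k"
proof -
  have "circle_mean T (\<lambda>z. poly Q z / z ^ k) = circle_mean T (\<lambda>z. \<Sum>i\<le>degree Q. coeff Q i * (z ^ i / z ^ k))"
    by (simp add: poly_altdef sum_divide_distrib)
  also have "\<dots> = (\<Sum>i\<le>degree Q. coeff Q i * circle_mean T (\<lambda>z. z ^ i / z ^ k))"
    using assms by (subst circle_mean_sum) (auto simp: circle_mean_cmult simp del: times_divide_eq_right intro!: continuous_intros)
  also have "\<dots> = coeff Q k"
    using assms by (simp add: circle_mean_monomials if_distrib[of "\<lambda>x. _ * x"] sum.delta' coeff_eq_0 cong: if_cong)
  finally show ?thesis .
qed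

text \<open>The first bound is |Q| |P|/(|P|^2 + \<tau>) \<le> 2 y^(2\<beta>) with y = max |P| (sqrt
  \<tau>). For the second, Q minus P times the quotient is exactly Q \<tau>/(|P|^2 + \<tau>), at
  most 2 \<tau> y^(2\<beta>-1); since 2\<beta> \<le> 1 this is largest at y = sqrt \<tau>.\<close>

lemma reg_quotient_norm_le:
  assumes \<tau>: "\<tau> > 0" and \<beta>: "0 < \<beta>" "\<beta> \<le> 1/2" and X: "cmod (poly P z) \<le> X" "sqrt \<tau> \<le> X" "1 \<le> X"
    and Q: "cmod (poly Q z) \<le> 2 * max (cmod (poly P z)) (sqrt \<tau>) powr (1 + 2*\<beta>)"
  shows "cmod (reg_quotient Q P \<tau> z) \<le> 2 * X"
    and "cmod (poly Q z - poly P z * reg_quotient Q P \<tau> z) \<le> 2 * \<tau> powr (1/2 + \<beta>)"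
proof -
  define x where "x = cmod (poly P z)"
  define y where "y = max x (sqrt \<tau>)"
  have y: "0 < y" "0 \<le> x" "x \<le> y" "sqrt \<tau> \<le> y" "y \<le> X" using \<tau> X by (auto simp: y_def x_def max_def)
  have D: "y\<^sup>2 \<le> x\<^sup>2 + \<tau>" using \<tau> by (auto simp: y_def max_def)
  have Q': "cmod (poly Q z) \<le> 2 * y powr (1 + 2*\<beta>)" using Q by (simp add: y_def x_def)
  have nD: "cmod (poly P z * cnj (poly P z) + of_real \<tau>) = x\<^sup>2 + \<tau>"
    unfolding reg_denominator norm_of_real using \<tau> by (simp add: x_def)
  have "cmod (reg_quotient Q P \<tau> z) = cmod (poly Q z) * x / (x\<^sup>2 + \<tau>)"
    by (simp add: reg_quotient_def norm_divide norm_mult nD x_def)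
  also have "\<dots> \<le> (2 * y powr (1 + 2*\<beta>)) * y / y\<^sup>2"
    using Q' y D by (intro frac_le mult_mono) auto
  also have "\<dots> = 2 * y powr (2*\<beta>)"
    using y by (simp add: powr_add power2_eq_square)
  also have "\<dots> \<le> 2 * X powr (2*\<beta>)" using y \<beta> by (intro mult_left_mono powr_mono2) auto
  also have "\<dots> \<le> 2 * X powr 1" using X \<beta> by (intro mult_left_mono powr_mono) auto
  finally show "cmod (reg_quotient Q P \<tau> z) \<le> 2 * X" using X by simp
  have "poly Q z - poly P z * reg_quotient Q P \<tau> z =
      poly Q z * (of_real \<tau> / (poly P z * cnj (poly P z) + of_real \<tau>))"
    using reg_denominator_nonzero[OF \<tau>, of P z] by (simp add: reg_quotient_def field_simps)
  then have "cmod (poly Q z - poly P z * reg_quotient Q P \<tau> z) = cmod (poly Q z) * (\<tau> / (x\<^sup>2 + \<tau>))"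
    using \<tau> by (simp add: norm_divide norm_mult nD)
  also have "\<dots> \<le> (2 * y powr (1 + 2*\<beta>)) * (\<tau> / y\<^sup>2)"
    using Q' y D \<tau> by (intro mult_mono frac_le) auto
  also have "\<dots> = 2 * (\<tau> * y powr (2*\<beta> - 1))"
    using y by (simp add: powr_add powr_diff power2_eq_square)
  also have "\<dots> \<le> 2 * (\<tau> * sqrt \<tau> powr (2*\<beta> - 1))"
    using y \<tau> \<beta> by (intro mult_left_mono powr_mono2') auto
  also have "\<tau> * sqrt \<tau> powr (2*\<beta> - 1) = \<tau> powr (1/2 + \<beta>)"
  proof -
    have "\<tau> * sqrt \<tau> powr (2*\<beta> - 1) = \<tau> powr 1 * \<tau> powr (1/2 * (2*\<beta> - 1))"
      using \<tau> by (simp add: powr_half_sqrt[symmetric] powr_powr)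
    also have "\<dots> = \<tau> powr (1/2 + \<beta>)" unfolding powr_add[symmetric] by (simp add: field_simps)
    finally show ?thesis .
  qed
  finally show "cmod (poly Q z - poly P z * reg_quotient Q P \<tau> z) \<le> 2 * \<tau> powr (1/2 + \<beta>)" .
qed

text \<open>\<open>F\<close> collects the Fourier coefficients of the regularised quotient in degrees \<open>0\<close> to \<open>5N\<close>.\<close>
lemma approximate_quotient:
  fixes P Q :: "complex poly"
  assumes \<tau>: "\<tau> > 0" and \<beta>: "0 < \<beta>" "\<beta> \<le> 1/2" and P0: "P \<noteq> 0" and deg: "degree P \<le> N" "degree Q \<le> N"
    and T: "1 \<le> T" and X: "1 \<le> X" "sqrt \<tau> \<le> X" "real N \<le> X"
    and PX: "\<And>z. cmod z \<le> T \<Longrightarrow> cmod (poly P z) \<le> X" and pX: "\<And>a. cmod (coeff P a) \<le> X"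
    and P'X: "\<And>z. cmod z \<le> T \<Longrightarrow> cmod (poly (pderiv P) z) \<le> X"
    and Q: "\<And>z. cmod z \<le> T \<Longrightarrow> cmod (poly Q z) \<le> 2 * max (cmod (poly P z)) (sqrt \<tau>) powr (1 + 2*\<beta>)"
  defines "\<mu> \<equiv> 8 / \<beta> * T ^ N * \<tau> powr (\<beta>/2) * X powr \<beta> * X * T powr \<beta>"
  obtains F where "degree F \<le> 5 * N" "\<And>z. cmod z \<le> 1 \<Longrightarrow>
    cmod (poly P z * poly F z - poly Q z) \<le> 2 ^ (6 * N + 1) * (2 * \<tau> powr (1/2 + \<beta>) + X * X * \<mu> + (X + 1) * X * 2 * X / T ^ (4 * N))"
proof -
  define \<Psi> where "\<Psi> = reg_quotient Q P \<tau>"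
  define cpos where "cpos k = circle_mean T (\<lambda>z. \<Psi> z / z ^ k)" for k :: nat
  define cneg where "cneg l = circle_mean T (\<lambda>z. \<Psi> z * z ^ l)" for l :: nat
  define F where "F = (\<Sum>i\<le>5*N. monom (cpos i) i)"
  define \<epsilon> where "\<epsilon> = 2 * \<tau> powr (1/2 + \<beta>)"
  have T0: "T > 0" using T by simp
  have cont: "continuous_on (sphere 0 T) \<Psi>"
    unfolding \<Psi>_def using \<tau> by (intro continuous_intros)
  have coeffF: "coeff F k = (if k \<le> 5*N then cpos k else 0)" for k
    by (auto simp: F_def coeff_sum coeff_monom)
  have degF: "degree F \<le> 5*N" by (intro degree_le) (simp add: coeffF)
  have \<Psi>X: "cmod (\<Psi> z) \<le> 2 * X" and \<Psi>Q: "cmod (poly Q z - poly P z * \<Psi> z) \<le> \<epsilon>" if "cmod z = T" for z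
    using reg_quotient_norm_le[OF \<tau> \<beta> PX[of z] X(2) X(1) Q[of z]] that by (auto simp: \<Psi>_def \<epsilon>_def)
  have cpos_le: "cmod (cpos k) \<le> 2 * X / T ^ k" for k
    unfolding cpos_def using T0 cont \<Psi>X
    by (intro circle_mean_norm_le) (auto intro!: continuous_intros divide_right_mono simp: norm_divide norm_power)
  have cneg_le: "cmod (cneg l) \<le> \<mu>" if l: "1 \<le> l" "l \<le> N" for l
  proof -
    \<comment> \<open>The coefficient of degree -l is the plain mean of the regularised quotient of
      z^l Q by P. Since l \<ge> 1, the new numerator vanishes at 0, as the Green estimate demands;
      the factor |z|^l costs at most \<open>T ^ N\<close>.\<close>
    define R where "R = Q * monom 1 l"
    have pR: "poly R z = poly Q z * z ^ l" for z by (simp add: R_def poly_monom)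
    have "cneg l = integral {0..2*pi} (\<lambda>\<theta>. reg_quotient R P \<tau> (of_real T * cis \<theta>)) / of_real (2*pi)"
      by (simp add: cneg_def circle_mean_def \<Psi>_def reg_quotient_def pR mult_ac)
    also have "cmod \<dots> = cmod (integral {0..2*pi} (\<lambda>\<theta>. reg_quotient R P \<tau> (of_real T * cis \<theta>))) / (2*pi)"
      by (simp add: norm_divide norm_mult)
    also have "\<dots> \<le> (8 * pi / \<beta> * (2 * T ^ N) * \<tau> powr (\<beta>/2) * X powr \<beta> * real (degree P) * T powr \<beta>) / (2*pi)"
    proof (intro divide_right_mono circle_moment_bound)
      show "poly R 0 = 0" using l by (simp add: pR)
      fix z assume z: "cmod z \<le> T"
      have "cmod (poly R z) = cmod (poly Q z) * cmod z ^ l" by (simp add: pR norm_mult norm_power)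
      also have "\<dots> \<le> (2 * max (cmod (poly P z)) (sqrt \<tau>) powr (1 + 2*\<beta>)) * T ^ N"
      proof (intro mult_mono Q[OF z])
        have "cmod z ^ l \<le> T ^ l" using z by (intro power_mono) auto
        also have "\<dots> \<le> T ^ N" using l T by (intro power_increasing) auto
        finally show "cmod z ^ l \<le> T ^ N" .
      qed auto
      finally show "cmod (poly R z) \<le> 2 * T ^ N * max (cmod (poly P z)) (sqrt \<tau>) powr (1 + 2*\<beta>)"
        by (simp add: mult_ac)
    qed (use \<tau> \<beta> T0 P0 P'X in auto)
    also have "\<dots> = 8 / \<beta> * T ^ N * \<tau> powr (\<beta>/2) * X powr \<beta> * real (degree P) * T powr \<beta>"
      by (simp add: field_simps)
    also have "\<dots> \<le> \<mu>"
      unfolding \<mu>_def using \<beta> T0 X deg by (intro mult_right_mono mult_left_mono) auto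
    finally show ?thesis .
  qed
  \<comment> \<open>\<open>d a k\<close> is the Fourier coefficient of \<Psi> of degree k - a,
    whatever its sign: it is what the monomial z^a of P contributes to degree k of the
    product.\<close>
  define d where "d a k = (if a \<le> k then cpos (k - a) else cneg (a - k))" for a k
  have d: "circle_mean T (\<lambda>z. \<Psi> z * z ^ a / z ^ k) = d a k" for a k
    unfolding d_def cpos_def cneg_def using T0
    by (auto intro!: circle_mean_cong simp: power_diff)
  have coeffQ: "cmod (coeff Q k - (\<Sum>a\<le>N. coeff P a * d a k)) \<le> \<epsilon>" for k
  proof -
    have "coeff Q k = circle_mean T (\<lambda>z. (\<Sum>a\<le>N. coeff P a * (\<Psi> z * z ^ a / z ^ k)) + (poly Q z - poly P z * \<Psi> z) / z ^ k)"
    proof -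
      have "poly P z = (\<Sum>a\<le>N. coeff P a * z ^ a)" for z
        unfolding poly_altdef using deg by (intro sum.mono_neutral_left) (auto simp: coeff_eq_0)
      then have "(\<Sum>a\<le>N. coeff P a * (\<Psi> z * z ^ a / z ^ k)) = poly P z * \<Psi> z / z ^ k" for z
        by (simp add: sum_distrib_left sum_divide_distrib mult_ac)
      then show ?thesis
        unfolding circle_mean_poly_coeff[OF T0, symmetric] by (simp add: diff_divide_distrib)
    qed
    also have "\<dots> = (\<Sum>a\<le>N. coeff P a * d a k) + circle_mean T (\<lambda>z. (poly Q z - poly P z * \<Psi> z) / z ^ k)"
    proof -
      have c: "continuous_on (sphere 0 T) (\<lambda>z. coeff P a * (\<Psi> z * z ^ a / z ^ k))" for a
        using T0 cont by (auto intro!: continuous_intros)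
      have "circle_mean T (\<lambda>z. \<Sum>a\<le>N. coeff P a * (\<Psi> z * z ^ a / z ^ k)) = (\<Sum>a\<le>N. coeff P a * d a k)"
        by (subst circle_mean_sum[OF T0 _ c]) (simp_all only: circle_mean_cmult d finite_atMost)
      moreover have "continuous_on (sphere 0 T) (\<lambda>z. \<Sum>a\<le>N. coeff P a * (\<Psi> z * z ^ a / z ^ k))"
        by (intro continuous_on_sum c)
      moreover have "continuous_on (sphere 0 T) (\<lambda>z. (poly Q z - poly P z * \<Psi> z) / z ^ k)"
        using T0 cont by (auto intro!: continuous_intros)
      ultimately show ?thesis using circle_mean_add[OF T0] by simp
    qed
    finally have "coeff Q k - (\<Sum>a\<le>N. coeff P a * d a k) = circle_mean T (\<lambda>z. (poly Q z - poly P z * \<Psi> z) / z ^ k)"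
      by simp
    also have "cmod \<dots> \<le> \<epsilon>"
    proof (intro circle_mean_norm_le T0)
      fix z :: complex assume z: "cmod z = T"
      have "cmod ((poly Q z - poly P z * \<Psi> z) / z ^ k) \<le> \<epsilon> / 1"
        unfolding norm_divide norm_power z using \<Psi>Q[OF z] T order_trans[OF norm_ge_zero \<Psi>Q[OF z]]
        by (intro frac_le) auto
      then show "cmod ((poly Q z - poly P z * \<Psi> z) / z ^ k) \<le> \<epsilon>" by simp
    qed (use cont T0 in \<open>auto intro!: continuous_intros\<close>)
    finally show ?thesis .
  qed
  have \<mu>0: "0 \<le> \<mu>" using \<beta> X T0 by (simp add: \<mu>_def)
  have \<epsilon>0: "0 \<le> \<epsilon>" by (simp add: \<epsilon>_def)
  \<comment> \<open>Three errors: the regularisation, the neglected coefficients of negative degree,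
    and the cut at degree 5N. A coefficient of \<open>P * F\<close> beyond 5N meets only entries of
    \<open>F\<close> of index above 4N, whence \<open>T ^ (4 * N)\<close>; this outweighs the three
    factors X, each of which will be a constant times T^N.\<close>
  define E where "E = \<epsilon> + X * X * \<mu> + (X + 1) * X * 2 * X / T ^ (4 * N)"
  have E: "cmod (coeff (P * F - Q) k) \<le> E" for k
  proof (cases "k \<le> 5*N")
    case True
    have "coeff (P * F) k = (\<Sum>a\<le>k. coeff P a * cpos (k - a))"
      unfolding coeff_mult using True by (intro sum.cong refl) (simp add: coeffF)
    also have "\<dots> = (\<Sum>a\<in>{..k}\<inter>{..N}. coeff P a * cpos (k - a))"
      using deg by (intro sum.mono_neutral_right) (auto simp: coeff_eq_0)
    also have "\<dots> = (\<Sum>a\<in>{..N}. if a \<le> k then coeff P a * cpos (k - a) else 0)"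
      by (subst Int_commute, subst sum.inter_restrict) auto
    finally have PF: "coeff (P * F) k = (\<Sum>a\<in>{..N}. if a \<le> k then coeff P a * cpos (k - a) else 0)" .
    have "(\<Sum>a\<le>N. coeff P a * d a k) - coeff (P * F) k = (\<Sum>a\<in>{..N}. if a \<le> k then 0 else coeff P a * cneg (a - k))"
      unfolding PF by (subst sum_subtractf[symmetric]) (auto intro!: sum.cong simp: d_def)
    also have "\<dots> = (\<Sum>a\<in>{1..N}. if a \<le> k then 0 else coeff P a * cneg (a - k))"
      by (rule sum.mono_neutral_right) auto
    also have "cmod \<dots> \<le> (\<Sum>a\<in>{1..N}. X * \<mu>)"
    proof (rule sum_norm_le)
      fix a assume "a \<in> {1..N}"
      then show "cmod (if a \<le> k then 0 else coeff P a * cneg (a - k)) \<le> X * \<mu>"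
        using pX[of a] cneg_le[of "a - k"] X \<mu>0 by (auto simp: norm_mult intro!: mult_mono)
    qed
    also have "\<dots> \<le> X * X * \<mu>" using X \<mu>0 by (simp add: mult_right_mono mult.assoc)
    finally have 1: "cmod ((\<Sum>a\<le>N. coeff P a * d a k) - coeff (P * F) k) \<le> X * X * \<mu>" .
    have "coeff (P * F - Q) k = - ((coeff Q k - (\<Sum>a\<le>N. coeff P a * d a k)) + ((\<Sum>a\<le>N. coeff P a * d a k) - coeff (P * F) k))"
      by simp
    also have "cmod \<dots> \<le> \<epsilon> + X * X * \<mu>"
      unfolding norm_minus_cancel using coeffQ[of k] 1 by (intro norm_triangle_le add_mono)
    also have "\<dots> \<le> E" using X T0 by (simp add: E_def)
    finally show ?thesis .
  next
    case False
    have "coeff (P * F - Q) k = (\<Sum>a\<le>k. coeff P a * coeff F (k - a))"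
      using False deg by (simp add: coeff_mult coeff_eq_0)
    also have "\<dots> = (\<Sum>a\<in>{..N}. coeff P a * coeff F (k - a))"
      using deg False by (intro sum.mono_neutral_right) (auto simp: coeff_eq_0)
    also have "cmod \<dots> \<le> (\<Sum>a\<in>{..N}. X * (2 * X / T ^ (4 * N)))"
    proof (rule sum_norm_le)
      fix a assume a: "a \<in> {..N}"
      have "cmod (coeff F (k - a)) \<le> 2 * X / T ^ (4 * N)"
      proof (cases "k - a \<le> 5 * N")
        case True
        have "cmod (cpos (k - a)) \<le> 2 * X / T ^ (k - a)" by (rule cpos_le)
        also have "\<dots> \<le> 2 * X / T ^ (4 * N)"
          using a False T X by (intro divide_left_mono power_increasing) auto
        finally show ?thesis using True by (simp add: coeffF)
      qed (use X T0 in \<open>simp add: coeffF\<close>)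
      then show "cmod (coeff P a * coeff F (k - a)) \<le> X * (2 * X / T ^ (4 * N))"
        unfolding norm_mult using pX X by (intro mult_mono) auto
    qed
    also have "\<dots> = (real N + 1) * X * 2 * X / T ^ (4 * N)" by (simp add: algebra_simps)
    also have "\<dots> \<le> (X + 1) * X * 2 * X / T ^ (4 * N)"
      using X T0 by (intro divide_right_mono mult_right_mono) auto
    also have "\<dots> \<le> E" using \<epsilon>0 \<mu>0 X by (simp add: E_def)
    finally show ?thesis .
  qed
  show ?thesis
  proof (rule that[OF degF])
    fix z assume z: "cmod z \<le> 1"
    have "degree (P * F - Q) \<le> 6 * N"
      using deg degF by (intro degree_diff_le order_trans[OF degree_mult_le]) auto
    from poly_norm_le_coeffs[OF this E z]
    show "cmod (poly P z * poly F z - poly Q z) \<le> 2 ^ (6 * N + 1) * (2 * \<tau> powr (1/2 + \<beta>) + X * X * \<mu> + (X + 1) * X * 2 * X / T ^ (4 * N))"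
      by (simp add: E_def \<epsilon>_def)
  qed
qed

section \<open>A quantitative Joris theorem on an interval\<close>

lemma norm_power_diff_le:
  fixes x y :: complex
  assumes "cmod x \<le> m" "cmod y \<le> m"
  shows "cmod (x ^ n - y ^ n) \<le> real n * m ^ (n - 1) * cmod (x - y)"
proof -
  have m: "0 \<le> m" using order_trans[OF norm_ge_zero assms(1)] .
  show ?thesis
  proof (cases n)
    case (Suc k)
    have "x ^ n - y ^ n = (x - y) * (\<Sum>i<Suc k. x ^ i * y ^ (k - i))"
      unfolding Suc by (rule diff_power_eq_sum)
    also have "cmod \<dots> \<le> cmod (x - y) * (\<Sum>i<Suc k. m ^ k)"
      unfolding norm_mult
    proof (intro mult_left_mono sum_norm_le norm_ge_zero)
      fix i assume i: "i \<in> {..<Suc k}"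
      have "cmod (x ^ i * y ^ (k - i)) \<le> m ^ i * m ^ (k - i)"
        unfolding norm_mult norm_power using assms m by (intro mult_mono power_mono) auto
      then show "cmod (x ^ i * y ^ (k - i)) \<le> m ^ k" using i by (simp add: power_add[symmetric])
    qed
    finally show ?thesis by (simp add: Suc mult_ac)
  qed simp
qed

text \<open>The source of the surplus exponent: 1 + 2\<beta> = (j+1)/j, and the square root on the
  right is \<epsilon>^(1/(j+1)), the size of x at which x^(j+1) equals the error \<epsilon>. Above
  that size the main term dominates, below it the maximum takes over.\<close>

lemma root_of_perturbed_power:
  fixes q x \<epsilon> :: real
  assumes j: "1 \<le> j" and q: "0 \<le> q" "q ^ j \<le> x ^ (j + 1) + \<epsilon>" and x: "0 \<le> x" and \<epsilon>: "0 < \<epsilon>"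
  defines "\<beta> \<equiv> 1 / (2 * real j)"
  shows "q \<le> 2 * max x (sqrt (\<epsilon> powr (2 / (real j + 1)))) powr (1 + 2*\<beta>)"
proof -
  have j0: "real j > 0" using j by simp
  define y where "y = max x (sqrt (\<epsilon> powr (2 / (real j + 1))))"
  have sq: "sqrt (\<epsilon> powr (2 / (real j + 1))) = \<epsilon> powr (1 / (real j + 1))"
  proof -
    have "2 / (real j + 1) * (1/2) = 1 / (real j + 1)" by (simp add: divide_simps)
    then show ?thesis using \<epsilon> by (simp only: powr_half_sqrt[symmetric] powr_powr powr_ge_zero)
  qed
  have y: "0 < y" "x \<le> y" "\<epsilon> powr (1 / (real j + 1)) \<le> y" using \<epsilon> by (auto simp: y_def sq less_max_iff_disj)
  have "\<epsilon> = (\<epsilon> powr (1 / (real j + 1))) powr (real j + 1)" using \<epsilon> j0 by (simp add: powr_powr)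
  also have "\<dots> \<le> y powr (real j + 1)" using y j0 by (intro powr_mono2) auto
  also have "\<dots> = y ^ (j + 1)" using y by (subst powr_realpow[symmetric]) (auto simp: add.commute)
  finally have "q ^ j \<le> 2 * y ^ (j + 1)" using q x y power_mono[of x y "j+1"] by simp
  also have "\<dots> = 2 * (y powr (1 + 2*\<beta>)) ^ j"
  proof -
    have "(y powr (1 + 2*\<beta>)) ^ j = y powr ((1 + 2*\<beta>) * real j)"
    proof -
      have "0 < y powr (1 + 2*\<beta>)" using y by simp
      then show ?thesis by (simp only: powr_realpow[symmetric] powr_powr)
    qed
    also have "(1 + 2*\<beta>) * real j = real (j + 1)" using j0 by (simp add: \<beta>_def field_simps)
    finally show ?thesis using y by (simp add: powr_realpow del: of_nat_add of_nat_Suc)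
  qed
  also have "\<dots> \<le> 2 ^ j * (y powr (1 + 2*\<beta>)) ^ j"
    using j power_increasing[of 1 j "2::real"] by (intro mult_right_mono) auto
  also have "\<dots> = (2 * y powr (1 + 2*\<beta>)) ^ j" by (simp add: power_mult_distrib)
  finally have "q ^ j \<le> (2 * y powr (1 + 2*\<beta>)) ^ j" .
  then show ?thesis using j q by (subst (asm) power_mono_iff) (auto simp: y_def)
qed

lemma max_modulus_poly_disc:
  assumes "s > 0" "\<And>z. cmod z = s \<Longrightarrow> cmod (poly G z) \<le> B" "cmod w \<le> s"
  shows "cmod (poly G w) \<le> B"
  using assms
  by (intro maximum_modulus_frontier[of "poly G" "cball 0 s" B w])
     (auto intro!: holomorphic_intros continuous_intros)

text \<open>Closeness of the j-th powers leaves F undetermined up to a root of unity; the second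
  hypothesis selects the right one. If |a| \<ge> \<eta>, it can be divided by a^j; otherwise the
  first hypothesis makes F as small as a, and nothing needs selecting.\<close>

lemma close_roots:
  fixes a F :: complex and \<eta> K :: real
  assumes j: "1 \<le> j" and K: "1 \<le> K" and \<eta>: "0 < \<eta>" "\<eta> \<le> 1"
    and 1: "cmod (F ^ j - a ^ j) \<le> K * \<eta> ^ (2 * j)" and 2: "cmod (a ^ j * F - a ^ (j + 1)) \<le> K * \<eta> ^ (2 * j)"
  shows "cmod (a - F) \<le> (K + 2) * \<eta>"
proof (cases "\<eta> \<le> cmod a")
  case True
  have "cmod (a ^ j * F - a ^ (j + 1)) = cmod a ^ j * cmod (a - F)"
    by (metis (no_types, opaque_lifting) norm_minus_commute norm_mult norm_power power_add power_one_right right_diff_distrib)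
  moreover have "\<eta> ^ j * cmod (a - F) \<le> cmod a ^ j * cmod (a - F)"
    using True \<eta> by (intro mult_right_mono power_mono) auto
  ultimately have "\<eta> ^ j * cmod (a - F) \<le> \<eta> ^ j * (K * \<eta> ^ j)"
    using 2 by (simp add: mult_2[of j] power_add mult.left_commute)
  then have "cmod (a - F) \<le> K * \<eta> ^ j" using \<eta> by simp
  also have "\<dots> \<le> K * \<eta>" using K \<eta> j power_decreasing[of 1 j \<eta>] by (intro mult_left_mono) auto
  also have "\<dots> \<le> (K + 2) * \<eta>" using \<eta> by (intro mult_right_mono) auto
  finally show ?thesis .
next
  case False
  have "cmod F ^ j = cmod (a ^ j + (F ^ j - a ^ j))" by (simp add: norm_power)
  also have "\<dots> \<le> cmod a ^ j + K * \<eta> ^ (2 * j)"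
    using 1 by (intro norm_triangle_le) (simp add: norm_power)
  also have "\<dots> \<le> \<eta> ^ j + K * \<eta> ^ j"
    using False \<eta> K by (intro add_mono power_mono mult_left_mono power_decreasing) auto
  also have "\<dots> = (1 + K) * \<eta> ^ j" by (simp add: distrib_right)
  also have "\<dots> \<le> (1 + K) ^ j * \<eta> ^ j"
    using K \<eta> j power_increasing[of 1 j "1 + K"] by (intro mult_right_mono) auto
  finally have "cmod F ^ j \<le> ((1 + K) * \<eta>) ^ j" by (simp add: power_mult_distrib)
  then have "cmod F \<le> (1 + K) * \<eta>" using j K \<eta> by (subst (asm) power_mono_iff) auto
  then show ?thesis using False norm_triangle_ineq4[of a F] by (simp add: algebra_simps)
qed

text \<open>Hides a constant factor in the base of an exponential; this is why orders and degrees
  are taken with N \<ge> 1.\<close>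

lemma power_le_power_base:
  fixes K c :: real
  assumes "1 \<le> N" "1 \<le> c" "c * b \<le> K" "1 \<le> b"
  shows "c * b ^ N \<le> K ^ N"
proof -
  have "c * b ^ N \<le> c ^ N * b ^ N"
    using assms power_increasing[of 1 N c] by (intro mult_right_mono) auto
  also have "\<dots> \<le> K ^ N" unfolding power_mult_distrib[symmetric] using assms by (intro power_mono) auto
  finally show ?thesis .
qed

lemma powr_le_self_of_one_le:
  fixes x p :: real
  assumes "1 \<le> x" "p \<le> 1" shows "x powr p \<le> x"
  using powr_mono[of p 1 x] assms by simp

lemma poly_pderiv_disc_bounds:
  fixes P :: "complex poly"
  assumes N: "1 \<le> N" and deg: "degree P \<le> N" and P: "\<And>t. 0 \<le> t \<Longrightarrow> t \<le> 1 \<Longrightarrow> cmod (poly P (of_real t)) \<le> 2"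
    and W: "100000 ^ N \<le> W" and T: "1 \<le> T"
  shows "cmod (coeff P a) \<le> W * T ^ N"
    and "cmod z \<le> T \<Longrightarrow> cmod (poly P z) \<le> W * T ^ N"
    and "cmod z \<le> T \<Longrightarrow> cmod (poly (pderiv P) z) \<le> W * T ^ N"
proof -
  have c: "cmod (coeff P a) \<le> 60 ^ Suc N * 2" for a
    using poly_coeff_bound[OF deg, of 1 2 a] P by simp
  have TN: "1 \<le> T ^ N" using T by simp
  \<comment> \<open>The three uses have b * c equal to 7200, 28800 and 57600; the base 100000 covers
    them all.\<close>
  have w: "b * c ^ N \<le> W" if "1 \<le> b" "1 \<le> c" "b * c \<le> 100000" for b c :: real
    using power_le_power_base[OF N that(1,3,2)] W by linarith
  have W0: "0 \<le> W" using W by (meson order_trans zero_le_numeral zero_le_power)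
  have "60 ^ Suc N * 2 \<le> W" using w[of 120 60] by simp
  moreover have "W * 1 \<le> W * T ^ N" using W0 TN by (intro mult_left_mono)
  ultimately show "cmod (coeff P a) \<le> W * T ^ N" using c[of a] by linarith
  {
    assume z: "cmod z \<le> T"
    have "cmod (poly P z) \<le> 120 ^ Suc N * 2 * T ^ N" by (rule poly_disc_bound[OF deg P z T])
    also have "\<dots> \<le> W * T ^ N" using w[of 240 120] TN by (intro mult_right_mono) auto
    finally show "cmod (poly P z) \<le> W * T ^ N" .
    have "cmod (coeff (pderiv P) b) \<le> real N * (60 ^ Suc N * 2)" for b
    proof (cases "Suc b \<le> N")
      case True
      then show ?thesis unfolding coeff_pderiv norm_mult using c[of "Suc b"] by (intro mult_mono) (auto simp del: of_nat_Suc)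
    next
      case False
      then show ?thesis using deg by (simp add: coeff_pderiv coeff_eq_0)
    qed
    then have "cmod (poly (pderiv P) z) \<le> 2 ^ Suc N * (real N * (60 ^ Suc N * 2)) * T ^ N"
      using deg z T by (intro poly_norm_le_coeffs) (auto simp: degree_pderiv)
    also have "\<dots> \<le> 2 ^ Suc N * (2 ^ N * (60 ^ Suc N * 2)) * T ^ N"
      using of_nat_less_two_power[of N, where 'a=real] TN by (intro mult_right_mono mult_left_mono) auto
    also have "\<dots> = 240 * 240 ^ N * T ^ N"
    proof -
      have "(240::real) ^ N = 2 ^ N * 2 ^ N * 60 ^ N" by (simp add: power_mult_distrib[symmetric])
      then show ?thesis by simp
    qed
    also have "\<dots> \<le> W * T ^ N" using w[of 240 240] TN by (intro mult_right_mono) auto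
    finally show "cmod (poly (pderiv P) z) \<le> W * T ^ N" .
  }
qed

text \<open>Chooses the parameters of the approximate quotient. The \<delta>-part of
  \<open>\<tau> powr (\<beta>/2)\<close> is \<delta>^(1/(2j(j+1))), which equals
  \<open>D ^ 8\<close>; the bounds X and T^N cost at most 1/D each apart from W, seven times in all,
  so one factor D is left. This is the origin of 16 = 2 * 8 in the exponent of D.\<close>

lemma quotient_on_unit_disc:
  fixes P Q :: "complex poly" and W \<delta> :: real
  assumes j: "1 \<le> j" and N: "1 \<le> N" and \<delta>: "0 < \<delta>" "\<delta> \<le> 1" and deg: "degree P \<le> N" "degree Q \<le> N" and P0: "P \<noteq> 0"
    and P2: "\<And>t. 0 \<le> t \<Longrightarrow> t \<le> 1 \<Longrightarrow> cmod (poly P (of_real t)) \<le> 2"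
    and W: "100000 ^ N \<le> W" "16 * real j + 6 \<le> W"
    and E: "\<And>z T. 1 \<le> T \<Longrightarrow> cmod z \<le> T \<Longrightarrow> cmod (poly Q z ^ j - poly P z ^ (j + 1)) \<le> (W * T ^ N) ^ (j + 1) * \<delta>"
  defines "D \<equiv> \<delta> powr (1 / (16 * real j * (real j + 1)))"
  obtains F where "degree F \<le> 5 * N" "\<And>z. cmod z \<le> 1 \<Longrightarrow> cmod (poly P z * poly F z - poly Q z) \<le> W ^ 9 * D"
proof -
  define \<beta> where "\<beta> = 1 / (2 * real j)"
  have j0: "real j \<ge> 1" using j by simp
  have \<beta>: "0 < \<beta>" "\<beta> \<le> 1/2" using j0 by (auto simp: \<beta>_def divide_simps)
  have D: "0 < D" "D \<le> 1" using \<delta> by (auto simp: D_def intro!: powr_le1)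
  \<comment> \<open>Enlarging the disc costs factors T^N in the bounds for P but makes the
    truncation error decay like T^(-4N). Tying the radius to \<delta> by T^N = 1/D turns both into
    powers of D.\<close>
  define T where "T = D powr (- 1 / real N)"
  have T: "1 \<le> T" unfolding T_def using D powr_mono'[of "- 1 / real N" 0 D] by simp
  have TN: "T ^ N = 1 / D"
  proof -
    have "T ^ N = T powr real N" using T by (simp add: powr_realpow)
    also have "\<dots> = D powr (-1)" unfolding T_def powr_powr using N by simp
    finally show ?thesis using D by (simp add: powr_minus_divide)
  qed
  define X where "X = W * T ^ N"
  have W1: "1 \<le> W" using W j0 by linarith
  have TN1: "1 \<le> T ^ N" using T by simp
  have WX: "W \<le> X" using W1 TN1 mult_left_mono[of 1 "T^N" W] by (simp add: X_def)
  have X1: "1 \<le> X" using W1 WX by linarith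
  have TNX: "T ^ N \<le> X" using W1 TN1 mult_right_mono[of 1 W "T^N"] by (simp add: X_def)
  have TX: "T \<le> X" using TNX power_increasing[of 1 N T] N T by simp
  have NX: "real N \<le> X"
  proof -
    have "real N \<le> 2 ^ N" using of_nat_less_two_power[of N, where 'a=real] by simp
    also have "\<dots> \<le> 100000 ^ N" by (intro power_mono) auto
    finally show ?thesis using W WX by linarith
  qed
  have XD: "X = W / D" by (simp add: X_def TN)
  define \<epsilon> where "\<epsilon> = X ^ (j + 1) * \<delta>"
  have \<epsilon>: "0 < \<epsilon>" using X1 \<delta> by (simp add: \<epsilon>_def)
  \<comment> \<open>\<open>sqrt \<tau>\<close> is the modulus of P at which |P|^(j+1) equals the
    error \<epsilon>, below which Q/P carries no information.\<close>
  define \<tau> where "\<tau> = \<epsilon> powr (2 / (real j + 1))"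
  have \<tau>: "0 < \<tau>" using \<epsilon> by (simp add: \<tau>_def)
  have \<epsilon>p: "\<epsilon> powr p = X powr ((real j + 1) * p) * \<delta> powr p" for p
  proof -
    have "X powr (real j + 1) = X ^ (j + 1)"
      using X1 powr_realpow[of X "j + 1"] by (simp add: add.commute)
    then have "\<epsilon> powr p = (X powr (real j + 1)) powr p * \<delta> powr p"
      using X1 \<delta> by (simp only: \<epsilon>_def powr_mult)
    then show ?thesis by (simp add: powr_powr)
  qed
  have D8: "\<delta> powr p \<le> D ^ 8" if "1 / (2 * real j * (real j + 1)) \<le> p" for p
  proof -
    have "\<delta> powr p \<le> \<delta> powr (1 / (2 * real j * (real j + 1)))" using that \<delta> by (intro powr_mono') auto
    also have "\<dots> = D powr 8" using j0 by (simp add: D_def powr_powr mult.assoc)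
    also have "\<dots> = D ^ 8" using D by simp
    finally show ?thesis .
  qed
  have sq\<tau>: "sqrt \<tau> \<le> X"
  proof -
    have "sqrt \<tau> = \<epsilon> powr (1 / (real j + 1))"
    proof -
      have "2 / (real j + 1) * (1/2) = 1 / (real j + 1)" by (simp add: divide_simps)
      then show ?thesis by (simp only: \<tau>_def powr_half_sqrt[symmetric] powr_powr powr_ge_zero)
    qed
    also have "\<dots> = X * \<delta> powr (1 / (real j + 1))" using X1 j0 by (simp add: \<epsilon>p)
    also have "\<dots> \<le> X * 1" using X1 \<delta> j0 by (intro mult_left_mono powr_le1) auto
    finally show ?thesis by simp
  qed
  have \<tau>1: "\<tau> powr (1/2 + \<beta>) \<le> W ^ 7 * D"
  proof -
    have "\<tau> powr (1/2 + \<beta>) = \<epsilon> powr (1 / real j)"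
    proof -
      have "2 / (real j + 1) * (1/2 + \<beta>) = 1 / real j" using j0 by (simp add: \<beta>_def divide_simps)
      then show ?thesis by (simp only: \<tau>_def powr_powr)
    qed
    also have "\<dots> = X powr ((real j + 1) * (1 / real j)) * \<delta> powr (1 / real j)" by (rule \<epsilon>p)
    also have "\<dots> \<le> X powr 2 * D ^ 8"
      using X1 j0 by (intro mult_mono powr_mono D8) (auto simp: divide_simps)
    also have "\<dots> = W ^ 2 * D ^ 6" using X1 D by (simp add: XD power_divide field_simps eval_nat_numeral)
    also have "\<dots> \<le> W ^ 7 * D"
      using W1 D power_decreasing[of 1 6 D] by (intro mult_mono power_increasing) auto
    finally show ?thesis .
  qed
  have \<tau>2: "\<tau> powr (\<beta>/2) \<le> X * D ^ 8"
  proof -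
    have "\<tau> powr (\<beta>/2) = \<epsilon> powr (1 / (2 * real j * (real j + 1)))"
    proof -
      have "2 / (real j + 1) * (\<beta>/2) = 1 / (2 * real j * (real j + 1))" using j0 by (simp add: \<beta>_def divide_simps)
      then show ?thesis by (simp only: \<tau>_def powr_powr)
    qed
    also have "\<dots> = X powr ((real j + 1) * (1 / (2 * real j * (real j + 1)))) * \<delta> powr (1 / (2 * real j * (real j + 1)))" by (rule \<epsilon>p)
    also have "\<dots> \<le> X * D ^ 8"
      using X1 j0 by (intro mult_mono powr_le_self_of_one_le D8) (auto simp: divide_simps)
    finally show ?thesis .
  qed
  obtain F where F: "degree F \<le> 5 * N" "\<And>z. cmod z \<le> 1 \<Longrightarrow>
    cmod (poly P z * poly F z - poly Q z) \<le> 2 ^ (6 * N + 1) * (2 * \<tau> powr (1/2 + \<beta>)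
      + X * X * (8 / \<beta> * T ^ N * \<tau> powr (\<beta>/2) * X powr \<beta> * X * T powr \<beta>) + (X + 1) * X * 2 * X / T ^ (4 * N))"
  proof (rule approximate_quotient[OF \<tau> \<beta> P0 deg T X1 sq\<tau> NX])
    fix z assume z: "cmod z \<le> T"
    show "cmod (poly P z) \<le> X" "cmod (poly (pderiv P) z) \<le> X"
      using poly_pderiv_disc_bounds(2,3)[OF N deg(1) P2 W(1) T z] by (auto simp: X_def)
    have "cmod (poly Q z) ^ j \<le> cmod (poly P z) ^ (j + 1) + \<epsilon>"
    proof -
      have "cmod (poly Q z ^ j) \<le> cmod (poly P z ^ (j + 1)) + cmod (poly Q z ^ j - poly P z ^ (j + 1))"
        by (metis add_diff_cancel_left' add_diff_eq norm_triangle_ineq)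
      then show ?thesis using E[OF T z] unfolding norm_power \<epsilon>_def X_def by linarith
    qed
    from root_of_perturbed_power[OF j norm_ge_zero this norm_ge_zero \<epsilon>]
    show "cmod (poly Q z) \<le> 2 * max (cmod (poly P z)) (sqrt \<tau>) powr (1 + 2 * \<beta>)" by (simp add: \<beta>_def \<tau>_def)
  next
    fix a show "cmod (coeff P a) \<le> X"
      using poly_pderiv_disc_bounds(1)[OF N deg(1) P2 W(1) T] by (auto simp: X_def)
  qed blast
  \<comment> \<open>Five factors X here and two more in front, against \<open>D ^ 8\<close>: as X =
    W/D, the product is W^7 D up to 16 j.\<close>
  have "8 / \<beta> * T ^ N * \<tau> powr (\<beta>/2) * X powr \<beta> * X * T powr \<beta> \<le> (16 * real j) * X * (X * D ^ 8) * X * X * X"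
  proof (intro mult_mono TNX \<tau>2 order_refl)
    show "8 / \<beta> \<le> 16 * real j" by (simp add: \<beta>_def)
    show "X powr \<beta> \<le> X" using X1 \<beta> by (intro powr_le_self_of_one_le) auto
    show "T powr \<beta> \<le> X" using T \<beta> TX powr_le_self_of_one_le[of T \<beta>] by linarith
  qed (use X1 T \<beta> D j0 in auto)
  then have "X * X * (8 / \<beta> * T ^ N * \<tau> powr (\<beta>/2) * X powr \<beta> * X * T powr \<beta>) \<le> X * X * ((16 * real j) * X * (X * D ^ 8) * X * X * X)"
    using X1 by (intro mult_left_mono) auto
  also have "\<dots> = 16 * real j * (X ^ 7 * D ^ 8)" by (simp add: eval_nat_numeral)
  also have "X ^ 7 * D ^ 8 = W ^ 7 * D" using D by (simp add: XD power_divide) (simp add: eval_nat_numeral)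
  finally have e2: "X * X * (8 / \<beta> * T ^ N * \<tau> powr (\<beta>/2) * X powr \<beta> * X * T powr \<beta>) \<le> 16 * real j * (W ^ 7 * D)" .
  have "(X + 1) * X * 2 * X / T ^ (4 * N) \<le> (X + X) * X * 2 * X / T ^ (4 * N)"
    using X1 T by (intro divide_right_mono mult_right_mono) auto
  also have "\<dots> = 4 * (X ^ 3 * D ^ 4)"
  proof -
    have "T ^ (4 * N) = (1 / D) ^ 4" unfolding TN[symmetric] by (simp only: power_mult[symmetric] mult.commute)
    then show ?thesis by (simp add: power_divide eval_nat_numeral)
  qed
  also have "X ^ 3 * D ^ 4 = W ^ 3 * D" using D by (simp add: XD power_divide) (simp add: eval_nat_numeral)
  also have "\<dots> \<le> W ^ 7 * D" using W1 D by (intro mult_right_mono power_increasing) auto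
  finally have e3: "(X + 1) * X * 2 * X / T ^ (4 * N) \<le> 4 * (W ^ 7 * D)" by simp
  have W7: "0 \<le> W ^ 7 * D" using W1 D by simp
  have sum: "2 * \<tau> powr (1/2 + \<beta>) + X * X * (8 / \<beta> * T ^ N * \<tau> powr (\<beta>/2) * X powr \<beta> * X * T powr \<beta>) + (X + 1) * X * 2 * X / T ^ (4 * N)
      \<le> W * (W ^ 7 * D)"
  proof -
    have "(16 * real j + 6) * (W ^ 7 * D) \<le> W * (W ^ 7 * D)" using W W7 by (intro mult_right_mono)
    then show ?thesis using \<tau>1 e2 e3 by (simp add: distrib_right)
  qed
  have pow2: "(2::real) ^ (6 * N + 1) \<le> W"
  proof -
    have "2 * 64 ^ N \<le> (100000::real) ^ N" by (rule power_le_power_base[OF N]) auto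
    then show ?thesis using W by (simp add: power_add power_mult)
  qed
  show ?thesis
  proof (rule that[OF F(1)])
    fix z assume "cmod z \<le> 1"
    note F(2)[OF this]
    also have "2 ^ (6 * N + 1) * (2 * \<tau> powr (1/2 + \<beta>) + X * X * (8 / \<beta> * T ^ N * \<tau> powr (\<beta>/2) * X powr \<beta> * X * T powr \<beta>) + (X + 1) * X * 2 * X / T ^ (4 * N))
      \<le> W * (W * (W ^ 7 * D))"
      using pow2 sum X1 \<beta> T W1 j0 by (intro mult_mono) auto
    also have "\<dots> = W ^ 9 * D" by (simp add: eval_nat_numeral)
    finally show "cmod (poly P z * poly F z - poly Q z) \<le> W ^ 9 * D" .
  qed
qed

text \<open>From P F close to Q and Q^j close to P^(j+1) follows that P^j (F^j - P) is small. On the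
  good circle \<open>w0\<close> forces |P| \<ge> \<eta>^j / W, so removing P^j costs \<eta>^(j*j);
  the remaining \<eta>^(2j) of D is what \<open>close_roots\<close> consumes. The circle has radius
  at least 1/2, hence the restriction on t. The exponent 11j + 12 is mere bookkeeping of powers of
  W.\<close>

lemma root_on_interval:
  fixes P Q F :: "complex poly" and W D \<eta> \<delta> :: real
  assumes j: "1 \<le> j" and W: "3 \<le> W" "real j \<le> W" "1000 ^ Suc N \<le> W" and \<eta>: "0 < \<eta>" "\<eta> \<le> 1"
    and D: "D = \<eta> ^ (j * j + 2 * j)" and \<delta>: "0 < \<delta>" "\<delta> \<le> D" and deg: "degree P \<le> N"
    and f: "\<And>t. \<bar>t\<bar> \<le> 1 \<Longrightarrow> cmod (f t) \<le> 1"
    and fP: "\<And>t. \<bar>t\<bar> \<le> 1 \<Longrightarrow> cmod (f t ^ j - poly P (of_real t)) \<le> \<delta>"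
    and fQ: "\<And>t. \<bar>t\<bar> \<le> 1 \<Longrightarrow> cmod (f t ^ (j + 1) - poly Q (of_real t)) \<le> \<delta>"
    and QW: "\<And>z. cmod z \<le> 1 \<Longrightarrow> cmod (poly Q z) \<le> W"
    and E: "\<And>z. cmod z \<le> 1 \<Longrightarrow> cmod (poly Q z ^ j - poly P z ^ (j + 1)) \<le> W ^ (j + 1) * D"
    and F: "\<And>z. cmod z \<le> 1 \<Longrightarrow> cmod (poly P z * poly F z - poly Q z) \<le> W ^ 9 * D"
    and w0: "cmod w0 \<le> 1" "\<eta> ^ j \<le> cmod (poly P w0)" and t: "\<bar>t\<bar> \<le> 1/2"
  shows "cmod (f t - poly F (of_real t)) \<le> W ^ (11 * j + 12) * \<eta>"
proof -
  have W1: "1 \<le> W" using W by simp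
  have D0: "0 < D" "D \<le> 1" using \<eta> by (auto simp: D power_le_one)
  have D\<eta>: "D \<le> \<eta> ^ (2 * j)" unfolding D using \<eta> by (intro power_decreasing) auto
  have Wm: "W ^ a \<le> W ^ b" if "a \<le> b" for a b using that W1 by (rule power_increasing)
  have Wp: "1 \<le> W ^ a" for a using W1 by simp
  have PF: "cmod (poly P z ^ j * (poly F z ^ j - poly P z)) \<le> W ^ (10 * j + 1) * D" if z: "cmod z \<le> 1" for z
  proof -
    have Q10: "cmod (poly Q z) \<le> W ^ 10" using QW[OF z] Wm[of 1 10] by simp
    have "cmod (poly P z * poly F z) \<le> cmod (poly Q z) + cmod (poly P z * poly F z - poly Q z)"
      by (metis add_diff_cancel_left' add_diff_eq norm_triangle_ineq)
    also have "\<dots> \<le> W + W ^ 9 * 1"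
    proof (intro add_mono QW[OF z] order_trans[OF F[OF z]])
      show "W ^ 9 * D \<le> W ^ 9 * 1" using D0 W1 by (intro mult_left_mono) auto
    qed
    also have "\<dots> \<le> 3 * W ^ 9" using Wm[of 1 9] Wp[of 9] by simp
    also have "\<dots> \<le> W * W ^ 9" using W by (intro mult_right_mono) auto
    finally have PF10: "cmod (poly P z * poly F z) \<le> W ^ 10" by (simp add: eval_nat_numeral)
    have "cmod ((poly P z * poly F z) ^ j - poly Q z ^ j) \<le> real j * (W ^ 10) ^ (j - 1) * cmod (poly P z * poly F z - poly Q z)"
      by (rule norm_power_diff_le[OF PF10 Q10])
    also have "\<dots> \<le> W * (W ^ 10) ^ (j - 1) * (W ^ 9 * D)"
      using W F[OF z] W1 by (intro mult_mono) auto
    also have "\<dots> = W ^ (10 * j) * D"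
    proof -
      have "10 * j = 1 + 10 * (j - 1) + 9" using j by simp
      then have "W ^ (10 * j) = W * (W ^ 10) ^ (j - 1) * W ^ 9" by (simp only: power_add power_mult power_one_right)
      then show ?thesis by simp
    qed
    finally have 1: "cmod ((poly P z * poly F z) ^ j - poly Q z ^ j) \<le> W ^ (10 * j) * D" .
    have "W ^ (j + 1) * D \<le> W ^ (10 * j) * D" using j D0 by (intro mult_right_mono Wm) auto
    with E[OF z] have 2: "cmod (poly Q z ^ j - poly P z ^ (j + 1)) \<le> W ^ (10 * j) * D" by linarith
    have "poly P z ^ j * (poly F z ^ j - poly P z) = ((poly P z * poly F z) ^ j - poly Q z ^ j) + (poly Q z ^ j - poly P z ^ (j + 1))"
      by (simp add: algebra_simps power_mult_distrib)
    also have "cmod \<dots> \<le> W ^ (10 * j) * D + W ^ (10 * j) * D"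
      using 1 2 by (intro norm_triangle_le add_mono)
    also have "\<dots> \<le> W * (W ^ (10 * j) * D)" using W D0 mult_right_mono[of 2 W "W ^ (10 * j) * D"] by simp
    finally show ?thesis by simp
  qed
  obtain s where s: "1/2 \<le> s" "s \<le> 1"
    "\<And>z w. cmod z = s \<Longrightarrow> cmod w \<le> 1 \<Longrightarrow> cmod (poly P w) \<le> 1000 ^ Suc N * cmod (poly P z)"
    using good_circle[OF deg] by blast
  have Gs: "cmod (poly (F ^ j - P) z) \<le> W ^ (11 * j + 1) * \<eta> ^ (2 * j)" if z: "cmod z = s" for z
  proof -
    have "\<eta> ^ j \<le> W * cmod (poly P z)"
      using s(3)[OF z w0(1)] w0(2) mult_right_mono[OF W(3), of "cmod (poly P z)"] by simp
    then have "(\<eta> ^ j) ^ j \<le> (W * cmod (poly P z)) ^ j" using \<eta> by (intro power_mono) auto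
    then have "\<eta> ^ (j * j) * cmod (poly F z ^ j - poly P z) \<le> (W * cmod (poly P z)) ^ j * cmod (poly F z ^ j - poly P z)"
      by (intro mult_right_mono) (auto simp: power_mult)
    also have "\<dots> = W ^ j * cmod (poly P z ^ j * (poly F z ^ j - poly P z))"
      by (simp add: power_mult_distrib norm_mult norm_power)
    also have "\<dots> \<le> W ^ j * (W ^ (10 * j + 1) * D)"
      using PF[of z] s z W1 by (intro mult_left_mono) auto
    also have "\<dots> = \<eta> ^ (j * j) * (W ^ (11 * j + 1) * \<eta> ^ (2 * j))"
    proof -
      have "W ^ (11 * j + 1) = W ^ j * W ^ (10 * j + 1)" by (simp add: power_add[symmetric])
      then show ?thesis by (simp only: D power_add[of \<eta>]) (simp only: mult_ac)
    qed
    finally show ?thesis using \<eta> by simp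
  qed
  have ct: "cmod (complex_of_real t) \<le> s" using t s by simp
  have t1: "\<bar>t\<bar> \<le> 1" using t by simp
  have "cmod (poly (F ^ j - P) (of_real t)) \<le> W ^ (11 * j + 1) * \<eta> ^ (2 * j)"
    using s by (intro max_modulus_poly_disc[OF _ Gs ct]) auto
  then have G: "cmod (poly F (of_real t) ^ j - poly P (of_real t)) \<le> W ^ (11 * j + 1) * \<eta> ^ (2 * j)" by simp
  have d\<eta>: "\<delta> \<le> \<eta> ^ (2 * j)" using \<delta> D\<eta> by linarith
  have "poly F (of_real t) ^ j - f t ^ j = (poly F (of_real t) ^ j - poly P (of_real t)) - (f t ^ j - poly P (of_real t))" by simp
  also have "cmod \<dots> \<le> W ^ (11 * j + 1) * \<eta> ^ (2 * j) + 1 * \<eta> ^ (2 * j)"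
    using G fP[OF t1] d\<eta> by (intro norm_triangle_le_diff) auto
  also have "\<dots> \<le> 2 * (W ^ (11 * j + 1) * \<eta> ^ (2 * j))"
    using Wp[of "11 * j + 1"] \<eta> mult_right_mono[of 1 "W ^ (11 * j + 1)" "\<eta> ^ (2 * j)"] by simp
  also have "\<dots> \<le> W * (W ^ (11 * j + 1) * \<eta> ^ (2 * j))" using W \<eta> by (intro mult_right_mono) auto
  finally have Ff: "cmod (poly F (of_real t) ^ j - f t ^ j) \<le> W ^ (11 * j + 2) * \<eta> ^ (2 * j)" by simp
  have Fb: "cmod (poly F (of_real t)) \<le> W ^ (11 * j + 3)"
  proof (cases "cmod (poly F (of_real t)) \<le> 1")
    case False
    then have "cmod (poly F (of_real t)) \<le> cmod (poly F (of_real t)) ^ j"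
      using j power_increasing[of 1 j "cmod (poly F (of_real t))"] by simp
    also have "\<dots> = cmod (f t ^ j + (poly F (of_real t) ^ j - f t ^ j))" by (simp add: norm_power)
    also have "\<dots> \<le> 1 + W ^ (11 * j + 2) * 1"
    proof (rule norm_triangle_le, rule add_mono)
      show "cmod (f t ^ j) \<le> 1" using f[OF t1] by (simp add: norm_power power_le_one)
      have "W ^ (11 * j + 2) * \<eta> ^ (2 * j) \<le> W ^ (11 * j + 2) * 1"
        using \<eta> W1 by (intro mult_left_mono power_le_one) auto
      then show "cmod (poly F (of_real t) ^ j - f t ^ j) \<le> W ^ (11 * j + 2) * 1" using Ff by linarith
    qed
    also have "\<dots> \<le> 3 * W ^ (11 * j + 2)" using Wp[of "11 * j + 2"] by linarith
    also have "\<dots> \<le> W * W ^ (11 * j + 2)" using W by (intro mult_right_mono) auto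
    finally show ?thesis by (simp add: eval_nat_numeral)
  qed (use Wp[of "11 * j + 3"] in linarith)
  \<comment> \<open>The selection of the correct j-th root: f^j is traded for P, then P F for Q,
    then Q for f^(j+1). The first trade multiplies an error by F, which is why F was bounded
    beforehand.\<close>
  have "f t ^ j * poly F (of_real t) - f t ^ (j + 1) = (f t ^ j - poly P (of_real t)) * poly F (of_real t)
     + (poly P (of_real t) * poly F (of_real t) - poly Q (of_real t)) - (f t ^ (j + 1) - poly Q (of_real t))"
    by (simp add: algebra_simps)
  also have "cmod \<dots> \<le> \<eta> ^ (2 * j) * W ^ (11 * j + 9) + W ^ (11 * j + 9) * \<eta> ^ (2 * j) + 1 * \<eta> ^ (2 * j)"
  proof (rule norm_triangle_le_diff, rule add_mono, rule norm_triangle_le, rule add_mono)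
    show "cmod ((f t ^ j - poly P (of_real t)) * poly F (of_real t)) \<le> \<eta> ^ (2 * j) * W ^ (11 * j + 9)"
      unfolding norm_mult using fP[OF t1] d\<eta> Fb Wm[of "11 * j + 3" "11 * j + 9"] \<eta> by (intro mult_mono) auto
    have "W ^ 9 * D \<le> W ^ (11 * j + 9) * \<eta> ^ (2 * j)" using D\<eta> D0 W1 by (intro mult_mono Wm) auto
    then show "cmod (poly P (of_real t) * poly F (of_real t) - poly Q (of_real t)) \<le> W ^ (11 * j + 9) * \<eta> ^ (2 * j)"
      using F[of "of_real t"] t1 by simp
    show "cmod (f t ^ (j + 1) - poly Q (of_real t)) \<le> 1 * \<eta> ^ (2 * j)" using fQ[OF t1] d\<eta> by simp
  qed
  also have "\<dots> \<le> 3 * (W ^ (11 * j + 9) * \<eta> ^ (2 * j))"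
    using Wp[of "11 * j + 9"] \<eta> mult_right_mono[of 1 "W ^ (11 * j + 9)" "\<eta> ^ (2 * j)"] by (simp add: mult.commute)
  also have "\<dots> \<le> W * (W ^ (11 * j + 9) * \<eta> ^ (2 * j))" using W \<eta> by (intro mult_right_mono) auto
  also have "\<dots> = W ^ (11 * j + 10) * \<eta> ^ (2 * j)" by (simp add: eval_nat_numeral)
  finally have "cmod (f t ^ j * poly F (of_real t) - f t ^ (j + 1)) \<le> W ^ (11 * j + 10) * \<eta> ^ (2 * j)" .
  moreover have "cmod (poly F (of_real t) ^ j - f t ^ j) \<le> W ^ (11 * j + 10) * \<eta> ^ (2 * j)"
    using \<eta> by (intro order_trans[OF Ff] mult_right_mono Wm) auto
  ultimately have "cmod (f t - poly F (of_real t)) \<le> (W ^ (11 * j + 10) + 2) * \<eta>"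
    using close_roots[OF j Wp \<eta>] by blast
  also have "\<dots> \<le> (W * W * W ^ (11 * j + 10)) * \<eta>"
  proof (intro mult_right_mono)
    have "W ^ (11 * j + 10) + 2 \<le> 3 * W ^ (11 * j + 10)" using Wp[of "11 * j + 10"] by linarith
    also have "\<dots> \<le> (W * W) * W ^ (11 * j + 10)" using W W1 mult_mono[of 3 W 1 W] by (intro mult_right_mono) auto
    finally show "W ^ (11 * j + 10) + 2 \<le> W * W * W ^ (11 * j + 10)" .
  qed (use \<eta> in auto)
  also have "W * W * W ^ (11 * j + 10) = W ^ (11 * j + 12)" by (simp add: eval_nat_numeral)
  finally show ?thesis .
qed

text \<open>The scale-free core: C and c depend on j alone. If P is below \<eta>^j on the whole unit
  disc, f is itself negligible; otherwise P is large somewhere, and the good circle makes division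
  by P^j affordable.\<close>

lemma quantitative_joris_interval:
  assumes j: "1 \<le> (j::nat)"
  obtains C c :: real where "1 \<le> C" "0 < c" "c \<le> 1"
    "\<And>N \<delta> f P Q. 1 \<le> N \<Longrightarrow> 0 < \<delta> \<Longrightarrow> \<delta> \<le> 1 \<Longrightarrow> degree P \<le> N \<Longrightarrow> degree Q \<le> N \<Longrightarrow>
      (\<And>t. \<bar>t\<bar> \<le> 1 \<Longrightarrow> cmod (f t) \<le> 1) \<Longrightarrow>
      (\<And>t. \<bar>t\<bar> \<le> 1 \<Longrightarrow> cmod (f t ^ j - poly P (of_real t)) \<le> \<delta>) \<Longrightarrow>
      (\<And>t. \<bar>t\<bar> \<le> 1 \<Longrightarrow> cmod (f t ^ (j + 1) - poly Q (of_real t)) \<le> \<delta>) \<Longrightarrow>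
      \<exists>F. degree F \<le> 5 * N \<and> (\<forall>t. \<bar>t\<bar> \<le> 1/2 \<longrightarrow> cmod (f t - poly F (of_real t)) \<le> C ^ N * \<delta> powr c)"
proof -
  define \<kappa> where "\<kappa> = (2 * real j + 1) * 2 ^ j"
  define K where "K = 10000000 * \<kappa>"
  \<comment> \<open>The product of two losses: 1/(16 j (j+1)) from the approximate quotient, and
    1/(j*j + 2j) from dividing by P^j and extracting the root.\<close>
  define c where "c = 1 / (16 * real j * (real j + 1) * (real j * real j + 2 * real j))"
  have j0: "real j \<ge> 1" using j by simp
  have \<kappa>: "2 * real j + 1 \<le> \<kappa>" unfolding \<kappa>_def using mult_left_mono[of 1 "2 ^ j" "2 * real j + 1"] j0 by simp
  have K1: "1 \<le> K" using \<kappa> j0 by (simp add: K_def)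
  have c: "0 < c" "c \<le> 1"
  proof -
    have "1 \<le> (16 * real j * (real j + 1)) * (real j * real j + 2 * real j)"
      using j0 mult_mono[of 1 "16 * real j * (real j + 1)" 1 "real j * real j + 2 * real j"] mult_mono[of 1 "real j" 1 "real j"]
        mult_mono[of 1 "16 * real j" 1 "real j + 1"] by simp
    then show "0 < c" "c \<le> 1" unfolding c_def by (auto simp: divide_simps)
  qed
  show ?thesis
  proof (rule that[OF _ c])
    show "1 \<le> K ^ (11 * j + 12)" using K1 by simp
    fix N :: nat and \<delta> :: real and f P Q
    assume N: "1 \<le> N" and \<delta>: "0 < \<delta>" "\<delta> \<le> 1" and deg: "degree P \<le> N" "degree Q \<le> N"
      and f: "\<And>t. \<bar>t\<bar> \<le> 1 \<Longrightarrow> cmod (f t) \<le> 1"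
      and fP: "\<And>t. \<bar>t\<bar> \<le> 1 \<Longrightarrow> cmod (f t ^ j - poly P (of_real t)) \<le> \<delta>"
      and fQ: "\<And>t. \<bar>t\<bar> \<le> 1 \<Longrightarrow> cmod (f t ^ (j + 1) - poly Q (of_real t)) \<le> \<delta>"
    define W where "W = K ^ N"
    have KW: "K \<le> W" unfolding W_def using power_increasing[of 1 N K] N K1 by simp
    have W: "100000 ^ N \<le> W" "16 * real j + 6 \<le> W" "3 \<le> W" "real j \<le> W" "1000 ^ Suc N \<le> W"
    proof -
      show "100000 ^ N \<le> W" unfolding W_def using \<kappa> j0 by (intro power_mono) (auto simp: K_def)
      show "16 * real j + 6 \<le> W" "3 \<le> W" "real j \<le> W" using KW \<kappa> j0 by (auto simp: K_def)
      have "1000 * 1000 ^ N \<le> K ^ N" using \<kappa> j0 by (intro power_le_power_base[OF N]) (auto simp: K_def)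
      then show "1000 ^ Suc N \<le> W" by (simp add: W_def)
    qed
    define \<eta> where "\<eta> = \<delta> powr c"
    define D where "D = \<delta> powr (1 / (16 * real j * (real j + 1)))"
    have \<eta>: "0 < \<eta>" "\<eta> \<le> 1" using \<delta> c by (auto simp: \<eta>_def intro!: powr_le1)
    have D: "D = \<eta> ^ (j * j + 2 * j)"
    proof -
      have "\<eta> ^ (j * j + 2 * j) = \<eta> powr real (j * j + 2 * j)" using \<eta> by (simp only: powr_realpow)
      also have "\<dots> = \<delta> powr (c * (real j * real j + 2 * real j))" by (simp add: \<eta>_def powr_powr)
      also have "c * (real j * real j + 2 * real j) = 1 / (16 * real j * (real j + 1))"
      proof -
        have "real j * real j + 2 * real j > 0" using j0 by (intro add_nonneg_pos) auto
        then have nz: "real j * real j + 2 * real j \<noteq> 0" by linarith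
        have "1 / (a * b) * b = 1 / a" if "b \<noteq> 0" for a b :: real using that by simp
        from this[OF nz] show ?thesis unfolding c_def .
      qed
      finally show ?thesis by (simp add: D_def)
    qed
    have "1 \<le> 16 * real j * (real j + 1)" using j0 mult_mono[of 1 "16 * real j" 1 "real j + 1"] by simp
    then have "1 / (16 * real j * (real j + 1)) \<le> 1" by (simp add: divide_simps)
    then have \<delta>D: "\<delta> \<le> D" unfolding D_def using powr_mono'[of _ 1 \<delta>] \<delta> by simp
    have P2: "cmod (poly P (of_real t)) \<le> 2" and Q2: "cmod (poly Q (of_real t)) \<le> 2" if "0 \<le> t" "t \<le> 1" for t
    proof -
      have t: "\<bar>t\<bar> \<le> 1" using that by simp
      have "cmod (f t ^ k) \<le> 1" for k using f[OF t] by (simp add: norm_power power_le_one)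
      then have "cmod (f t ^ k - (f t ^ k - p)) \<le> 2" if "cmod (f t ^ k - p) \<le> \<delta>" for k p
        using that \<delta> by (intro norm_triangle_le_diff) (smt (verit))
      from this[OF fP[OF t]] this[OF fQ[OF t]]
      show "cmod (poly P (of_real t)) \<le> 2" "cmod (poly Q (of_real t)) \<le> 2" by auto
    qed
    have E: "cmod (poly Q z ^ j - poly P z ^ (j + 1)) \<le> (W * T ^ N) ^ (j + 1) * \<delta>" if T: "1 \<le> T" and z: "cmod z \<le> T" for z T
    proof -
      have degE: "degree (Q ^ j - P ^ (j + 1)) \<le> (j + 1) * N"
      proof (rule degree_diff_le)
        show "degree (Q ^ j) \<le> (j + 1) * N"
        proof -
          have "degree Q * j \<le> N * (j + 1)" by (rule mult_le_mono) (use deg in auto)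
          then show ?thesis using degree_power_le[of Q j] by (simp only: mult.commute)
        qed
        show "degree (P ^ (j + 1)) \<le> (j + 1) * N"
          by (rule order_trans[OF degree_power_le]) (metis deg(1) mult.commute mult_le_mono2)
      qed
      \<comment> \<open>P^(j+1) and Q^j approximate the same function, f^(j(j+1)), so their
        difference is small on the interval; the constant \<kappa> comes from factoring differences
        of powers of numbers of modulus at most 2.\<close>
      have real: "cmod (poly (Q ^ j - P ^ (j + 1)) (of_real t)) \<le> \<kappa> * \<delta>" if "0 \<le> t" "t \<le> 1" for t
      proof -
        have t: "\<bar>t\<bar> \<le> 1" using that by simp
        have fk: "cmod (f t ^ k) \<le> 2" for k using f[OF t] power_le_one[of "cmod (f t)" k] by (simp add: norm_power)
        have "poly (Q ^ j - P ^ (j + 1)) (of_real t) = ((f t ^ j) ^ (j + 1) - poly P (of_real t) ^ (j + 1)) - ((f t ^ (j + 1)) ^ j - poly Q (of_real t) ^ j)"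
          by (simp only: power_mult[symmetric] mult.commute poly_diff poly_power) simp
        also have "cmod \<dots> \<le> real (j + 1) * 2 ^ (j + 1 - 1) * \<delta> + real j * 2 ^ (j - 1) * \<delta>"
        proof (rule norm_triangle_le_diff, rule add_mono)
          show "cmod ((f t ^ j) ^ (j + 1) - poly P (of_real t) ^ (j + 1)) \<le> real (j + 1) * 2 ^ (j + 1 - 1) * \<delta>"
            by (rule order_trans[OF norm_power_diff_le[OF fk P2[OF that]]]) (intro mult_left_mono fP[OF t], simp)
          show "cmod ((f t ^ (j + 1)) ^ j - poly Q (of_real t) ^ j) \<le> real j * 2 ^ (j - 1) * \<delta>"
            by (rule order_trans[OF norm_power_diff_le[OF fk Q2[OF that]]]) (intro mult_left_mono fQ[OF t], simp)
        qed
        also have "\<dots> \<le> real (j + 1) * 2 ^ j * \<delta> + real j * 2 ^ j * \<delta>"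
          using \<delta> by (intro add_mono mult_right_mono mult_left_mono power_increasing) auto
        also have "\<dots> = \<kappa> * \<delta>" by (simp add: \<kappa>_def algebra_simps)
        finally show ?thesis .
      qed
      have "cmod (poly (Q ^ j - P ^ (j + 1)) z) \<le> 120 ^ Suc ((j + 1) * N) * (\<kappa> * \<delta>) * T ^ ((j + 1) * N)"
        by (rule poly_disc_bound[OF degE real z T])
      also have "\<dots> = (120 * \<kappa> * 120 ^ ((j + 1) * N)) * T ^ ((j + 1) * N) * \<delta>" by simp
      also have "\<dots> \<le> K ^ ((j + 1) * N) * T ^ ((j + 1) * N) * \<delta>"
        using \<kappa> j0 N \<delta> T by (intro mult_right_mono power_le_power_base) (auto simp: K_def)
      also have "\<dots> = (W * T ^ N) ^ (j + 1) * \<delta>"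
        by (simp only: W_def power_mult_distrib power_mult[symmetric] mult.commute)
      finally show ?thesis by simp
    qed
    show "\<exists>F. degree F \<le> 5 * N \<and> (\<forall>t. \<bar>t\<bar> \<le> 1/2 \<longrightarrow> cmod (f t - poly F (of_real t)) \<le> (K ^ (11 * j + 12)) ^ N * \<delta> powr c)"
    proof (cases "\<exists>w0. cmod w0 \<le> 1 \<and> \<eta> ^ j \<le> cmod (poly P w0)")
      case True
      then obtain w0 where w0: "cmod w0 \<le> 1" "\<eta> ^ j \<le> cmod (poly P w0)" by blast
      have "0 < \<eta> ^ j" using \<eta> by simp
      then have P0: "P \<noteq> 0" using w0 by auto
      obtain F where F: "degree F \<le> 5 * N" "\<And>z. cmod z \<le> 1 \<Longrightarrow> cmod (poly P z * poly F z - poly Q z) \<le> W ^ 9 * D"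
        using quotient_on_unit_disc[OF j N \<delta> deg P0 P2 W(1,2) E] unfolding D_def by blast
      have E1: "cmod (poly Q z ^ j - poly P z ^ (j + 1)) \<le> W ^ (j + 1) * D" if "cmod z \<le> 1" for z
      proof -
        have "W ^ (j + 1) * \<delta> \<le> W ^ (j + 1) * D" using \<delta>D W by (intro mult_left_mono) auto
        then show ?thesis using E[of 1 z] that by simp
      qed
      have QW: "cmod (poly Q z) \<le> W" if "cmod z \<le> 1" for z
        using poly_pderiv_disc_bounds(2)[OF N deg(2) Q2 W(1), of 1 z] that by simp
      have "cmod (f t - poly F (of_real t)) \<le> (K ^ (11 * j + 12)) ^ N * \<delta> powr c" if "\<bar>t\<bar> \<le> 1/2" for t
        using root_on_interval[OF j W(3,4,5) \<eta> D \<delta>(1) \<delta>D deg(1) f fP fQ QW E1 F(2) w0 that]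
        by (simp only: W_def \<eta>_def power_mult[symmetric] mult.commute)
      then show ?thesis using F(1) by blast
    next
      case False
      \<comment> \<open>Here |P| < \<eta>^j throughout the unit disc, so |f|^j \<le> 2 \<eta>^j on
        the interval and the zero polynomial is a good enough approximation.\<close>
      have "cmod (f t) \<le> (K ^ (11 * j + 12)) ^ N * \<delta> powr c" if "\<bar>t\<bar> \<le> 1/2" for t
      proof -
        have t: "\<bar>t\<bar> \<le> 1" using that by simp
        have "\<delta> \<le> \<eta> ^ j" using \<delta>D \<eta> power_decreasing[of j "j * j + 2 * j" \<eta>] by (simp add: D)
        moreover have "cmod (poly P (of_real t)) \<le> \<eta> ^ j" using False t by (metis less_imp_le norm_of_real not_le)
        ultimately have "cmod (poly P (of_real t) + (f t ^ j - poly P (of_real t))) \<le> \<eta> ^ j + \<eta> ^ j"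
          using fP[OF t] by (intro norm_triangle_le add_mono) auto
        then have "cmod (f t) ^ j \<le> 2 * \<eta> ^ j" by (simp add: norm_power)
        also have "\<dots> \<le> 2 ^ j * \<eta> ^ j" using j \<eta> power_increasing[of 1 j "2::real"] by (intro mult_right_mono) auto
        finally have "cmod (f t) ^ j \<le> (2 * \<eta>) ^ j" by (simp add: power_mult_distrib)
        then have "cmod (f t) \<le> 2 * \<eta>" using j \<eta> by (subst (asm) power_mono_iff) auto
        also have "\<dots> \<le> W ^ (11 * j + 12) * \<eta>"
          using W \<eta> power_increasing[of 1 "11 * j + 12" W] by (intro mult_right_mono) auto
        finally show ?thesis by (simp only: W_def \<eta>_def power_mult[symmetric] mult.commute)
      qed
      then show ?thesis by (intro exI[of _ 0]) simp
    qed
  qed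
qed

section \<open>Functions approximable along axis-parallel lines\<close>

text \<open>The sampling scale is \<open>R = |t|\<^sup>1\<^sup>/\<^sup>3\<close>: coarse enough for the quadratic part of \<open>q\<close> to be
  \<open>O(R\<^sup>4) = o(t)\<close>, fine enough for the approximation error to be so.\<close>
lemma has_vector_derivative_from_poly_approx:
  fixes \<phi> :: "real \<Rightarrow> complex"
  assumes K: "0 \<le> K" and R0: "0 < R0" "R0 \<le> 1" and S: "\<And>t. \<bar>t\<bar> \<le> R0 \<Longrightarrow> cmod (\<phi> t) \<le> S"
    and approx: "\<And>R. 0 < R \<Longrightarrow> R \<le> R0 \<Longrightarrow>
      \<exists>q. degree q \<le> L \<and> (\<forall>t. \<bar>t\<bar> \<le> R/2 \<longrightarrow> cmod (\<phi> t - poly q (of_real t)) \<le> K * R^4) \<and> cmod (coeff q 1 - d) \<le> K * R"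
  shows "(\<phi> has_vector_derivative d) (at 0)"
proof -
  define S2 where "S2 = 60 ^ Suc L * (S + K)"
  define B where "B = 3 * K + real L * (4 * S2)"
  have S0: "0 \<le> S" using order_trans[OF norm_ge_zero S[of 0]] R0 by simp
  have S20: "0 \<le> S2" using S0 K by (simp add: S2_def)
  have B0: "0 \<le> B" using K S20 by (simp add: B_def)
  have main: "cmod (\<phi> t - \<phi> 0 - t *\<^sub>R d) \<le> B * R * \<bar>t\<bar>" if R: "0 < R" "R \<le> R0" "R \<le> 1/2" and t: "\<bar>t\<bar> = R ^ 3" for R t
  proof -
    obtain q where q: "degree q \<le> L" "\<And>t. \<bar>t\<bar> \<le> R/2 \<Longrightarrow> cmod (\<phi> t - poly q (of_real t)) \<le> K * R^4"
      and qd: "cmod (coeff q 1 - d) \<le> K * R"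
      using approx[OF R(1,2)] by blast
    have RR: "R * R \<le> 1/4" using R mult_mono[of R "1/2" R "1/2"] by simp
    have tR: "\<bar>t\<bar> \<le> R/2" using R RR mult_right_mono[of "R * R" "1/2" R] by (simp add: t eval_nat_numeral)
    have R4: "R ^ 4 \<le> 1" using R by (intro power_le_one) auto
    have qk: "cmod (coeff q k) * (R/2) ^ k \<le> S2" for k
      unfolding S2_def
    proof (rule poly_coeff_bound[OF q(1)])
      fix u :: real assume u: "0 \<le> u" "u \<le> R/2"
      have "cmod (poly q (of_real u)) \<le> cmod (\<phi> u) + cmod (\<phi> u - poly q (of_real u))"
        by (metis add.commute norm_minus_commute norm_triangle_sub)
      also have "\<dots> \<le> S + K * R ^ 4" using S[of u] q(2)[of u] u R R0 by (intro add_mono) auto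
      also have "\<dots> \<le> S + K" using K R4 by (simp add: mult_left_le)
      finally show "cmod (poly q (of_real u)) \<le> S + K" .
    qed (use R in auto)
    have "poly q (of_real t) = (\<Sum>k\<le>Suc L. coeff q k * of_real t ^ k)"
      unfolding poly_altdef using q(1) by (intro sum.mono_neutral_left) (auto simp: coeff_eq_0)
    also have "{..Suc L} = insert 0 (insert 1 {2..Suc L})" by auto
    finally have qt: "poly q (of_real t) = coeff q 0 + coeff q 1 * of_real t + (\<Sum>k\<in>{2..Suc L}. coeff q k * of_real t ^ k)"
      by simp
    have rest: "cmod (\<Sum>k\<in>{2..Suc L}. coeff q k * of_real t ^ k) \<le> (\<Sum>k\<in>{2..Suc L}. 4 * S2 * R ^ 4)"
    proof (rule sum_norm_le)
      fix k assume k: "k \<in> {2..Suc L}"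
      \<comment> \<open>As |t| = R^3 = 2R^2 * (R/2), the factor R/2 matches the coefficient bound,
        and 2R^2 \<le> 1 with k \<ge> 2 leaves 4 R^4.\<close>
      have "\<bar>t\<bar> ^ k = (2 * R\<^sup>2) ^ k * (R/2) ^ k"
        unfolding power_mult_distrib[symmetric] t by (simp add: eval_nat_numeral)
      then have "cmod (coeff q k * of_real t ^ k) = cmod (coeff q k) * (R/2) ^ k * (2 * R\<^sup>2) ^ k"
        by (simp add: norm_mult norm_power)
      also have "\<dots> \<le> S2 * (2 * R\<^sup>2) ^ k" using qk R by (intro mult_right_mono) auto
      also have "\<dots> \<le> S2 * (2 * R\<^sup>2) ^ 2"
        using k RR S20 by (intro mult_left_mono power_decreasing) (auto simp: power2_eq_square)
      also have "\<dots> = 4 * S2 * R ^ 4" by (simp add: eval_nat_numeral)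
      finally show "cmod (coeff q k * of_real t ^ k) \<le> 4 * S2 * R ^ 4" .
    qed
    have "\<phi> t - \<phi> 0 - t *\<^sub>R d = (\<phi> t - poly q (of_real t)) - (\<phi> 0 - poly q (of_real 0))
        + (\<Sum>k\<in>{2..Suc L}. coeff q k * of_real t ^ k) + of_real t * (coeff q 1 - d)"
      by (simp add: qt poly_0_coeff_0 scaleR_conv_of_real algebra_simps)
    also have "cmod \<dots> \<le> K * R^4 + K * R^4 + (\<Sum>k\<in>{2..Suc L}. 4 * S2 * R ^ 4) + \<bar>t\<bar> * (K * R)"
    proof (rule norm_triangle_le, rule add_mono, rule norm_triangle_le, rule add_mono, rule norm_triangle_le_diff, rule add_mono)
      show "cmod (of_real t * (coeff q 1 - d)) \<le> \<bar>t\<bar> * (K * R)"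
        unfolding norm_mult using qd by (intro mult_mono) auto
    qed (use q(2)[of t] q(2)[of 0] tR R rest in auto)
    also have "\<dots> = B * R * \<bar>t\<bar>"
      by (simp add: t B_def eval_nat_numeral algebra_simps)
    finally show ?thesis .
  qed
  show ?thesis
    unfolding has_vector_derivative_def has_derivative_at_alt
  proof (intro conjI allI impI bounded_linear_scaleR_left)
    fix e :: real assume e: "0 < e"
    define R1 where "R1 = min R0 (min (1/2) (e / (B + 1)))"
    have "0 < e / (B + 1)" using e B0 by simp
    then have R1: "0 < R1" "R1 \<le> R0" "R1 \<le> 1/2" "R1 \<le> e / (B + 1)"
      unfolding R1_def using R0 by (simp_all only: min_less_iff_conj) (simp_all add: min.coboundedI1 min.coboundedI2)
    have "norm (\<phi> y - \<phi> 0 - (y - 0) *\<^sub>R d) \<le> e * norm (y - 0)" if y: "norm (y - 0) < R1 ^ 3" for y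
    proof (cases "y = 0")
      case False
      define R where "R = root 3 \<bar>y\<bar>"
      have R3: "\<bar>y\<bar> = R ^ 3" by (simp add: R_def)
      have R: "0 < R" using False by (simp add: R_def)
      have "R ^ 3 < R1 ^ 3" using y R3 by simp
      then have RR1: "R < R1" using R1(1) power_less_imp_less_base by (meson less_imp_le)
      have "cmod (\<phi> y - \<phi> 0 - y *\<^sub>R d) \<le> B * R * \<bar>y\<bar>" using main[of R y] R RR1 R1 R3 by simp
      also have "\<dots> \<le> e * \<bar>y\<bar>"
      proof (rule mult_right_mono)
        have "B * R \<le> (B + 1) * R1" using R RR1 B0 by (intro mult_mono) auto
        also have "\<dots> \<le> e" using R1(4) B0 by (simp add: field_simps)
        finally show "B * R \<le> e" .
      qed simp
      finally show ?thesis by simp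
    qed simp
    then show "\<exists>da>0. \<forall>y. norm (y - 0) < da \<longrightarrow> norm (\<phi> y - \<phi> 0 - (y - 0) *\<^sub>R d) \<le> e * norm (y - 0)"
      using R1(1) by (intro exI[of _ "R1 ^ 3"]) auto
  qed
qed

section \<open>Cubes and polynomial approximation along their axes\<close>

definition cube :: "real \<Rightarrow> (real^'n::finite) set" where
  "cube s = {x. \<forall>i. \<bar>x $ i\<bar> < s}"

lemma cube_mono: "s \<le> s' \<Longrightarrow> cube s \<subseteq> cube s'"
  unfolding cube_def by (auto intro: less_le_trans)

lemma cube_shift:
  assumes "x \<in> cube (s - r)" "\<bar>t\<bar> \<le> r" shows "x + t *\<^sub>R axis i 1 \<in> cube s"
proof -
  have "\<bar>(x + t *\<^sub>R axis i 1) $ j\<bar> < s" for j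
  proof -
    have "\<bar>x $ j\<bar> < s - r" using assms by (simp add: cube_def)
    moreover have "\<bar>t * axis i 1 $ j\<bar> \<le> r" using assms by (auto simp: axis_def)
    ultimately show ?thesis by simp
  qed
  then show ?thesis by (simp add: cube_def)
qed

lemma zero_mem_cube:
  assumes "s > 0" shows "0 \<in> cube s"
  using assms by (simp add: cube_def)

lemma open_cube: "open (cube s)"
proof -
  have "cube s = (\<Inter>i. {x. \<bar>x $ i\<bar> < s})" by (auto simp: cube_def)
  also have "open \<dots>" by (intro open_INT ballI open_Collect_less continuous_intros) auto
  finally show ?thesis .
qed

text \<open>The polynomial may change with \<open>r\<close>, and its degree bound \<open>L\<close>
  is independent of the order \<kappa>: the quantitative theorem returns degree 5qN for an error of
  order r^N. So p is not a Taylor polynomial, and derivatives of \<open>f\<close> have to be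
  produced by other means.\<close>

definition line_approx :: "nat \<Rightarrow> real \<Rightarrow> real \<Rightarrow> real \<Rightarrow> nat \<Rightarrow> (real^'n::finite \<Rightarrow> complex) \<Rightarrow> bool" where
  "line_approx L s r0 K \<kappa> f \<longleftrightarrow> (\<forall>x i r. 0 < r \<longrightarrow> r \<le> r0 \<longrightarrow> x \<in> cube (s - r) \<longrightarrow>
     (\<exists>p. degree p \<le> L \<and> (\<forall>t. \<bar>t\<bar> \<le> r \<longrightarrow> cmod (f (x + t *\<^sub>R axis i 1) - poly p (of_real t)) \<le> K * r ^ \<kappa>)))"

lemma line_approx_mono:
  fixes f :: "real^'n::finite \<Rightarrow> complex"
  assumes "line_approx L s r0 K \<kappa> f" "s' \<le> s" "r0' \<le> r0"
  shows "line_approx L s' r0' K \<kappa> f"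
  unfolding line_approx_def
proof (intro allI impI)
  fix x :: "real^'n" and i r assume "0 < r" "r \<le> r0'" "x \<in> cube (s' - r)"
  then have "r \<le> r0" "x \<in> cube (s - r)" using assms cube_mono[of "s' - r" "s - r"] by auto
  with \<open>0 < r\<close> assms(1) show "\<exists>p. degree p \<le> L \<and> (\<forall>t. \<bar>t\<bar> \<le> r \<longrightarrow> cmod (f (x + t *\<^sub>R axis i 1) - poly p (of_real t)) \<le> K * r ^ \<kappa>)"
    unfolding line_approx_def by blast
qed

text \<open>Nodes and weights are those of the Lagrange functional. Fixing them once makes the
  difference quotients linear in \<open>f\<close> with coefficients independent of the point, so
  that they inherit approximations along every axis.\<close>

locale sampled_lines =
  fixes f :: "real^'n::finite \<Rightarrow> complex" and L \<kappa> :: nat and s r0 K S :: real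
    and node :: "nat \<Rightarrow> real" and w :: "nat \<Rightarrow> nat \<Rightarrow> complex"
  assumes node: "\<And>k. k \<le> L \<Longrightarrow> 0 \<le> node k \<and> node k \<le> 1"
    and weights: "\<And>b. (\<Sum>k\<le>L. cmod (w b k)) \<le> 60 ^ Suc L"
    and interp: "\<And>p b. degree p \<le> L \<Longrightarrow> coeff p b = (\<Sum>k\<le>L. w b k * poly p (of_real (node k)))"
    and r0: "0 < r0" "r0 \<le> 1" and K: "0 \<le> K"
    and approx: "line_approx L s r0 K \<kappa> f"
    and bounded: "\<And>x. x \<in> cube s \<Longrightarrow> cmod (f x) \<le> S"
begin

text \<open>The \<open>b\<close>-th derivative at \<open>y\<close> of the interpolant of \<open>f\<close> at \<open>L + 1\<close> nodes of mesh \<open>~ h\<close>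
  along the \<open>i\<close>-th axis.\<close>
definition fd :: "'n \<Rightarrow> nat \<Rightarrow> real \<Rightarrow> real^'n \<Rightarrow> complex" where
  "fd i b h y = of_real (fact b / h ^ b) * (\<Sum>k\<le>L. w b k * f (y + (h * node k) *\<^sub>R axis i 1))"

text \<open>The constant in the comparison of a difference quotient of mesh h with the coefficient
  of an approximating polynomial at scale r; the factor 2^b allows h down to r/2.\<close>

definition err :: "nat \<Rightarrow> real" where
  "err b = fact b * 2 ^ b * 60 ^ Suc L * K"

text \<open>The candidate for the b-th partial derivative along axis i, available before any
  differentiability of \<open>f\<close> is known.\<close>

definition D :: "'n \<Rightarrow> nat \<Rightarrow> real^'n \<Rightarrow> complex" where
  "D i b y = lim (\<lambda>n. fd i b (r0 / 2 ^ n) y)"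

lemma err_nonneg: "0 \<le> err b"
  using K by (simp add: err_def)

text \<open>The difference operator is exact on polynomials of degree at most \<open>L\<close>, so
  only the remainder of \<open>f\<close> is amplified, by the total weight over
  \<open>h ^ b\<close>.\<close>

lemma fd_poly:
  assumes p: "degree p \<le> L" and h: "0 < h" "\<And>t. 0 \<le> t \<Longrightarrow> t \<le> h \<Longrightarrow> cmod (f (y + t *\<^sub>R axis i 1) - poly p (of_real t)) \<le> \<eta>"
  shows "cmod (fd i b h y - fact b * coeff p b) \<le> fact b / h ^ b * (60 ^ Suc L * \<eta>)"
proof -
  have "degree (pcompose p [:0, of_real h:]) \<le> L" using p by (simp add: degree_pcompose)
  from interp[OF this, of b]
  have "of_real h ^ b * coeff p b = (\<Sum>k\<le>L. w b k * poly p (of_real (h * node k)))"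
    by (simp add: coeff_pcompose_linear poly_pcompose mult.commute)
  then have "fact b * coeff p b = of_real (fact b / h ^ b) * (\<Sum>k\<le>L. w b k * poly p (of_real (h * node k)))"
    using h(1) by (simp add: field_simps)
  then have "fd i b h y - fact b * coeff p b =
     of_real (fact b / h ^ b) * (\<Sum>k\<le>L. w b k * (f (y + (h * node k) *\<^sub>R axis i 1) - poly p (of_real (h * node k))))"
    by (simp only: fd_def right_diff_distrib sum_subtractf)
  also have "cmod \<dots> = fact b / h ^ b * cmod (\<Sum>k\<le>L. w b k * (f (y + (h * node k) *\<^sub>R axis i 1) - poly p (of_real (h * node k))))"
    using h(1) unfolding norm_mult by (subst norm_of_real) simp
  also have "\<dots> \<le> fact b / h ^ b * (\<Sum>k\<le>L. cmod (w b k) * \<eta>)"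
  proof (intro mult_left_mono sum_norm_le)
    fix k assume "k \<in> {..L}"
    then have "0 \<le> h * node k" "h * node k \<le> h" using node[of k] h(1) by (auto simp: mult_left_le)
    from h(2)[OF this] show "cmod (w b k * (f (y + (h * node k) *\<^sub>R axis i 1) - poly p (of_real (h * node k)))) \<le> cmod (w b k) * \<eta>"
      unfolding norm_mult by (intro mult_left_mono) auto
  qed (use h in auto)
  also have "\<dots> \<le> fact b / h ^ b * (60 ^ Suc L * \<eta>)"
    unfolding sum_distrib_right[symmetric] using weights[of b] h(1) order_trans[OF norm_ge_zero h(2)[of 0]]
    by (intro mult_left_mono mult_right_mono) auto
  finally show ?thesis .
qed

text \<open>One polynomial serves all meshes from r/2 to r. This links neighbouring dyadic scales
  although their own polynomials are unrelated.\<close>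

lemma fd_compare:
  assumes y: "y \<in> cube (s - r0)" and r: "0 < r" "r \<le> r0" and b: "b \<le> \<kappa>"
  obtains p where "degree p \<le> L" "\<And>t. \<bar>t\<bar> \<le> r \<Longrightarrow> cmod (f (y + t *\<^sub>R axis i 1) - poly p (of_real t)) \<le> K * r ^ \<kappa>"
    "\<And>h. r/2 \<le> h \<Longrightarrow> h \<le> r \<Longrightarrow> cmod (fd i b h y - fact b * coeff p b) \<le> err b * r ^ (\<kappa> - b)"
proof -
  have "y \<in> cube (s - r)" using y r cube_mono[of "s - r0" "s - r"] by auto
  then obtain p where p: "degree p \<le> L" "\<And>t. \<bar>t\<bar> \<le> r \<Longrightarrow> cmod (f (y + t *\<^sub>R axis i 1) - poly p (of_real t)) \<le> K * r ^ \<kappa>"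
    using approx r unfolding line_approx_def by blast
  show ?thesis
  proof (rule that[OF p])
    fix h assume h: "r/2 \<le> h" "h \<le> r"
    have h0: "0 < h" using h r by linarith
    have "cmod (fd i b h y - fact b * coeff p b) \<le> fact b / h ^ b * (60 ^ Suc L * (K * r ^ \<kappa>))"
      using h h0 by (intro fd_poly p) auto
    also have "\<dots> \<le> fact b / (r/2) ^ b * (60 ^ Suc L * (K * r ^ \<kappa>))"
      using h h0 r K by (intro mult_right_mono divide_left_mono power_mono) auto
    also have "\<dots> = err b * r ^ (\<kappa> - b)"
    proof -
      have "r ^ \<kappa> = r ^ b * r ^ (\<kappa> - b)" using b by (simp add: power_add[symmetric])
      then show ?thesis using r by (simp add: err_def power_divide field_simps)
    qed
    finally show "cmod (fd i b h y - fact b * coeff p b) \<le> err b * r ^ (\<kappa> - b)" .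
  qed
qed

lemma fd_step:
  assumes y: "y \<in> cube (s - r0)" and r: "0 < r" "r \<le> r0" and b: "b \<le> \<kappa>" and h: "r/2 \<le> h" "h \<le> r"
  shows "cmod (fd i b r y - fd i b h y) \<le> 2 * err b * r ^ (\<kappa> - b)"
proof -
  obtain p where "\<And>h. r/2 \<le> h \<Longrightarrow> h \<le> r \<Longrightarrow> cmod (fd i b h y - fact b * coeff p b) \<le> err b * r ^ (\<kappa> - b)"
    using fd_compare[OF y r b] by metis
  from this[of r] this[OF h] r
  have "cmod ((fd i b r y - fact b * coeff p b) - (fd i b h y - fact b * coeff p b)) \<le> err b * r ^ (\<kappa> - b) + err b * r ^ (\<kappa> - b)"
    by (intro norm_triangle_le_diff[OF add_mono]) auto
  then show ?thesis by simp
qed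

text \<open>Telescoping: since b < \<kappa>, successive differences decay at least like 2^(-n), and
  the tail is at most twice its first term.\<close>

lemma fd_dyadic:
  assumes y: "y \<in> cube (s - r0)" and b: "b < \<kappa>"
  shows "(\<lambda>n. fd i b (r0 / 2 ^ n) y) \<longlonglongrightarrow> D i b y"
    and "cmod (fd i b (r0 / 2 ^ n) y - D i b y) \<le> 4 * err b * (r0 / 2 ^ n) ^ (\<kappa> - b)"
proof -
  define g where "g n = fd i b (r0 / 2 ^ n) y" for n
  define B where "B n = 2 * err b * (r0 / 2 ^ n) ^ (\<kappa> - b)" for n :: nat
  have step: "cmod (g (Suc n) - g n) \<le> B n" for n
  proof -
    have "r0 / 2 ^ n \<le> r0" using r0 by (simp add: divide_le_eq mult_left_le)
    moreover have "r0 / 2 ^ Suc n \<le> r0 / 2 ^ n" using r0 by (intro divide_left_mono) auto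
    ultimately show ?thesis
      using fd_step[OF y, of "r0 / 2 ^ n" b "r0 / 2 ^ Suc n" i] r0 b
      by (simp add: g_def B_def norm_minus_commute)
  qed
  have B: "B (n + m) \<le> B n * (1/2) ^ m" for n m
  proof -
    have "(r0 / 2 ^ (n + m)) ^ (\<kappa> - b) = (r0 / 2 ^ n) ^ (\<kappa> - b) * ((1/2) ^ m) ^ (\<kappa> - b)"
    proof -
      have "r0 / 2 ^ (n + m) = r0 / 2 ^ n * (1/2) ^ m" by (simp add: power_add power_one_over)
      then show ?thesis by (simp only: power_mult_distrib)
    qed
    also have "\<dots> \<le> (r0 / 2 ^ n) ^ (\<kappa> - b) * ((1/2) ^ m) ^ 1"
      using r0 b by (intro mult_left_mono power_decreasing) (auto simp: power_le_one)
    finally show ?thesis unfolding B_def using err_nonneg[of b] by (simp add: mult_left_mono mult.assoc)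
  qed
  have sumB: "summable (\<lambda>m. B n * (1/2) ^ m)" for n by (intro summable_mult summable_geometric) simp
  have "summable (\<lambda>n. cmod (g (Suc n) - g n))"
    by (rule summable_comparison_test'[OF sumB[of 0], of 0]) (use step B[of 0] in \<open>auto intro: order_trans\<close>)
  then have "summable (\<lambda>n. g (Suc n) - g n)" by (rule summable_norm_cancel)
  then have "convergent g"
    by (simp add: summable_iff_convergent sum_lessThan_telescope convergent_diff_const_right_iff)
  then show lim: "(\<lambda>n. fd i b (r0 / 2 ^ n) y) \<longlonglongrightarrow> D i b y"
    by (simp add: D_def g_def[abs_def] convergent_LIMSEQ_iff)
  have fin: "cmod (g n - g (n + m)) \<le> 2 * B n" for m
  proof -
    have "g (n + m) - g n = (\<Sum>l<m. g (Suc (n + l)) - g (n + l))"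
      using sum_lessThan_telescope[of "\<lambda>l. g (n + l)" m] by simp
    then have "cmod (g n - g (n + m)) = cmod (\<Sum>l<m. g (Suc (n + l)) - g (n + l))"
      by (metis norm_minus_commute)
    also have "\<dots> \<le> (\<Sum>l<m. B n * (1/2) ^ l)"
      using step B by (intro sum_norm_le) (auto intro: order_trans)
    also have "\<dots> \<le> (\<Sum>l. B n * (1/2) ^ l)"
      using err_nonneg r0 by (intro sum_le_suminf sumB) (auto simp: B_def)
    also have "\<dots> = B n * 2" by (subst suminf_mult) (auto simp: suminf_geometric summable_geometric)
    finally show ?thesis by simp
  qed
  have "(\<lambda>m. cmod (g n - g (n + m))) \<longlonglongrightarrow> cmod (g n - D i b y)"
    using LIMSEQ_ignore_initial_segment[OF lim, of n] by (intro tendsto_intros) (simp add: g_def add.commute)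
  then have "cmod (g n - D i b y) \<le> 2 * B n"
    by (rule LIMSEQ_le_const2) (use fin in auto)
  then show "cmod (fd i b (r0 / 2 ^ n) y - D i b y) \<le> 4 * err b * (r0 / 2 ^ n) ^ (\<kappa> - b)"
    by (simp add: g_def B_def)
qed

text \<open>The limit was taken along dyadic meshes only. The largest dyadic mesh below r is at
  least r/2, so one comparison and the dyadic tail suffice: 6 = 2 + 4.\<close>

lemma fd_D:
  assumes y: "y \<in> cube (s - r0)" and b: "b < \<kappa>" and r: "0 < r" "r \<le> r0"
  shows "cmod (fd i b r y - D i b y) \<le> 6 * err b * r ^ (\<kappa> - b)"
proof -
  obtain n where n: "r / 2 \<le> r0 / 2 ^ n" "r0 / 2 ^ n \<le> r"
  proof -
    have "\<exists>n. r0 / 2 ^ n \<le> r"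
    proof -
      obtain n where "(1/2) ^ n < r / r0" using real_arch_pow_inv[of "r / r0" "1/2"] r r0 by auto
      then show ?thesis using r0 by (intro exI[of _ n]) (simp add: field_simps power_one_over)
    qed
    then have P: "r0 / 2 ^ (LEAST n. r0 / 2 ^ n \<le> r) \<le> r" by (rule LeastI_ex)
    define n where "n = (LEAST n. r0 / 2 ^ n \<le> r)"
    show ?thesis
    proof (rule that[of n])
      show "r0 / 2 ^ n \<le> r" using P by (simp add: n_def)
      show "r / 2 \<le> r0 / 2 ^ n"
      proof (cases n)
        case 0
        then show ?thesis using r by simp
      next
        case (Suc m)
        then have "\<not> r0 / 2 ^ m \<le> r" using not_less_Least[of m "\<lambda>n. r0 / 2 ^ n \<le> r"] by (simp add: n_def)
        then show ?thesis by (simp add: Suc)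
      qed
    qed
  qed
  have "cmod (fd i b (r0 / 2 ^ n) y - D i b y) \<le> 4 * err b * (r0 / 2 ^ n) ^ (\<kappa> - b)"
    by (rule fd_dyadic[OF y b])
  also have "\<dots> \<le> 4 * err b * r ^ (\<kappa> - b)"
    using n r0 err_nonneg[of b] by (intro mult_left_mono power_mono) auto
  finally have "cmod ((fd i b r y - fd i b (r0 / 2 ^ n) y) + (fd i b (r0 / 2 ^ n) y - D i b y)) \<le> 2 * err b * r ^ (\<kappa> - b) + 4 * err b * r ^ (\<kappa> - b)"
    using fd_step[OF y r _ n] b by (intro norm_triangle_le add_mono) auto
  then show ?thesis by simp
qed

lemma D_zero:
  assumes y: "y \<in> cube (s - r0)" and \<kappa>: "0 < \<kappa>"
  shows "D i 0 y = f y"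
proof -
  have "cmod (D i 0 y - f y) \<le> 0 + e" if "0 < e" for e
  proof -
    define M where "M = 7 * err 0 + K"
    have M: "0 \<le> M" using err_nonneg K by (simp add: M_def)
    define r where "r = min r0 (e / (M + 1))"
    have "0 < e / (M + 1)" using that M by simp
    then have r: "0 < r" "r \<le> r0" "r \<le> e / (M + 1)" unfolding r_def using r0 by auto
    obtain p where p: "\<And>t. \<bar>t\<bar> \<le> r \<Longrightarrow> cmod (f (y + t *\<^sub>R axis i 1) - poly p (of_real t)) \<le> K * r ^ \<kappa>"
      "\<And>h. r/2 \<le> h \<Longrightarrow> h \<le> r \<Longrightarrow> cmod (fd i 0 h y - fact 0 * coeff p 0) \<le> err 0 * r ^ (\<kappa> - 0)"
      by (rule fd_compare[OF y r(1,2) le0, of i]) blast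
    have "D i 0 y - f y = (coeff p 0 - f y) + (fd i 0 r y - coeff p 0) - (fd i 0 r y - D i 0 y)" by simp
    also have "cmod \<dots> \<le> K * r ^ \<kappa> + err 0 * r ^ \<kappa> + 6 * err 0 * r ^ \<kappa>"
    proof (rule norm_triangle_le_diff, rule add_mono, rule norm_triangle_le, rule add_mono)
      show "cmod (coeff p 0 - f y) \<le> K * r ^ \<kappa>" using p(1)[of 0] r by (simp add: poly_0_coeff_0 norm_minus_commute)
      show "cmod (fd i 0 r y - coeff p 0) \<le> err 0 * r ^ \<kappa>" using p(2)[of r] r by simp
      show "cmod (fd i 0 r y - D i 0 y) \<le> 6 * err 0 * r ^ \<kappa>" using fd_D[OF y \<kappa> r(1,2), of i] by simp
    qed
    also have "\<dots> = M * r ^ \<kappa>" by (simp add: M_def algebra_simps)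
    also have "\<dots> \<le> M * r ^ 1" using r r0 \<kappa> M by (intro mult_left_mono power_decreasing) auto
    also have "\<dots> \<le> (M + 1) * (e / (M + 1))" using r M by (simp only: power_one_right) (intro mult_mono, auto)
    also have "\<dots> = e" using M by simp
    finally show ?thesis by simp
  qed
  then have "cmod (D i 0 y - f y) \<le> 0" by (rule field_le_epsilon)
  then show ?thesis by simp
qed

text \<open>The polynomial p is recentred at the shifted point and compared with the difference of
  mesh R/2, which together with |t| \<le> R/2 stays inside the range of the approximation. Thus a
  single polynomial, the m-th derivative of p, approximates \<open>D i m\<close> along the
  segment.\<close>

lemma D_line:
  assumes y: "y + t *\<^sub>R axis i 1 \<in> cube (s - r0)" and R: "0 < R" "R \<le> r0" and m: "m < \<kappa>" and t: "\<bar>t\<bar> \<le> R/2"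
    and p: "degree p \<le> L" "\<And>u. \<bar>u\<bar> \<le> R \<Longrightarrow> cmod (f (y + u *\<^sub>R axis i 1) - poly p (of_real u)) \<le> K * R ^ \<kappa>"
  shows "cmod (D i m (y + t *\<^sub>R axis i 1) - poly ((pderiv ^^ m) p) (of_real t)) \<le> 7 * err m * R ^ (\<kappa> - m)"
proof -
  define q where "q = pcompose p [:of_real t, 1:]"
  let ?y = "y + t *\<^sub>R axis i 1"
  have dq: "degree q \<le> L" using p by (simp add: q_def degree_pcompose)
  have fq: "cmod (f (?y + u *\<^sub>R axis i 1) - poly q (of_real u)) \<le> K * R ^ \<kappa>" if "0 \<le> u" "u \<le> R/2" for u
  proof -
    have "\<bar>t + u\<bar> \<le> R" using t that by linarith
    from p(2)[OF this] show ?thesis by (simp add: q_def poly_pcompose scaleR_add_left add.assoc)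
  qed
  have "(pderiv ^^ m) q = pcompose ((pderiv ^^ m) p) [:of_real t, 1:]"
    unfolding q_def by (induction m) (auto simp: pderiv_pcompose pderiv_pCons)
  then have "poly ((pderiv ^^ m) p) (of_real t) = poly ((pderiv ^^ m) q) 0" by (simp add: poly_pcompose)
  also have "\<dots> = fact m * coeff q m" by (simp add: poly_0_coeff_0 coeff_higher_pderiv pochhammer_fact)
  finally have pq: "poly ((pderiv ^^ m) p) (of_real t) = fact m * coeff q m" .
  have "cmod (fd i m (R/2) ?y - fact m * coeff q m) \<le> fact m / (R/2) ^ m * (60 ^ Suc L * (K * R ^ \<kappa>))"
    using R by (intro fd_poly[OF dq _ fq]) auto
  also have "\<dots> = err m * R ^ (\<kappa> - m)"
  proof -
    have "R ^ \<kappa> = R ^ m * R ^ (\<kappa> - m)" using m by (simp add: power_add[symmetric])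
    then show ?thesis using R by (simp add: err_def power_divide field_simps)
  qed
  finally have 1: "cmod (fd i m (R/2) ?y - fact m * coeff q m) \<le> err m * R ^ (\<kappa> - m)" .
  have "cmod (fd i m (R/2) ?y - D i m ?y) \<le> 6 * err m * (R/2) ^ (\<kappa> - m)"
    using R by (intro fd_D[OF y m]) auto
  also have "\<dots> \<le> 6 * err m * R ^ (\<kappa> - m)"
    using R err_nonneg[of m] by (intro mult_left_mono power_mono) auto
  finally have 2: "cmod (fd i m (R/2) ?y - D i m ?y) \<le> 6 * err m * R ^ (\<kappa> - m)" .
  have "cmod ((fd i m (R/2) ?y - fact m * coeff q m) - (fd i m (R/2) ?y - D i m ?y)) \<le> err m * R ^ (\<kappa> - m) + 6 * err m * R ^ (\<kappa> - m)"
    using 1 2 by (rule norm_triangle_le_diff[OF add_mono])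
  then show ?thesis unfolding pq by simp
qed

lemma fd_bound:
  assumes y: "y \<in> cube (s - r0)"
  shows "cmod (fd i b r0 y) \<le> fact b / r0 ^ b * (60 ^ Suc L * S)"
proof -
  have "cmod (f (y + (t::real) *\<^sub>R axis i 1) - poly 0 (of_real t)) \<le> S" if "0 \<le> t" "t \<le> r0" for t
    using bounded[OF cube_shift[OF y]] that by simp
  with fd_poly[where p = 0 and h = r0 and y = y and i = i and \<eta> = S and b = b] r0(1) show ?thesis by simp
qed

lemma D_bound:
  assumes y: "y \<in> cube (s - r0)" and b: "b < \<kappa>"
  shows "cmod (D i b y) \<le> fact b / r0 ^ b * (60 ^ Suc L * S) + 6 * err b"
proof -
  have "cmod (fd i b r0 y - (fd i b r0 y - D i b y)) \<le> fact b / r0 ^ b * (60 ^ Suc L * S) + 6 * err b * r0 ^ (\<kappa> - b)"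
    using fd_bound[OF y] fd_D[OF y b r0(1) order_refl] by (intro norm_triangle_le_diff[OF add_mono])
  moreover have "err b * r0 ^ (\<kappa> - b) \<le> err b" using err_nonneg r0 by (simp add: mult_left_le power_le_one)
  ultimately show ?thesis by simp
qed

text \<open>Feeds the m-th derivatives of the approximating polynomials into the differentiability
  criterion. That criterion asks for errors of order R^4 for the function and R for the linear
  coefficient; the error here is R^(\<kappa>-m), hence \<open>m + 4 \<le> \<kappa>\<close>.\<close>

lemma D_has_vector_derivative:
  assumes y: "y \<in> cube (s - r0)" and m: "m + 4 \<le> \<kappa>"
  shows "((\<lambda>t. D i m (y + t *\<^sub>R axis i 1)) has_vector_derivative D i (Suc m) y) (at 0)"
proof -
  have "open ((\<lambda>t. y + t *\<^sub>R axis i 1) -` cube (s - r0))"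
    by (intro open_vimage open_cube continuous_intros)
  then obtain R1 where R1: "0 < R1" "ball 0 R1 \<subseteq> (\<lambda>t. y + t *\<^sub>R axis i 1) -` cube (s - r0)"
    using y unfolding open_contains_ball by (metis (no_types, lifting) add.right_neutral scale_zero_left vimageI)
  define R0 where "R0 = min (R1 / 2) r0"
  have R0: "0 < R0" "R0 \<le> r0" "R0 \<le> R1 / 2" using R1 r0 by (auto simp: R0_def)
  have mem: "y + t *\<^sub>R axis i 1 \<in> cube (s - r0)" if "\<bar>t\<bar> \<le> R0" for t
  proof -
    have "t \<in> ball 0 R1" using that R0 R1 by simp
    then show ?thesis using R1 by auto
  qed
  have m': "m < \<kappa>" "Suc m < \<kappa>" "Suc m \<le> \<kappa>" using m by auto
  show ?thesis
  proof (rule has_vector_derivative_from_poly_approx[where K = "7 * err m + 7 * err (Suc m)" and ?R0.0 = R0 and L = L])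
    show "0 \<le> 7 * err m + 7 * err (Suc m)" using err_nonneg by simp
    show "0 < R0" "R0 \<le> 1" using R0 r0 by auto
    fix t assume "\<bar>t\<bar> \<le> R0"
    from D_bound[OF mem[OF this] m'(1)]
    show "cmod (D i m (y + t *\<^sub>R axis i 1)) \<le> fact m / r0 ^ m * (60 ^ Suc L * S) + 6 * err m" .
  next
    fix R assume R: "0 < R" "R \<le> R0"
    have Rr: "R \<le> r0" "R \<le> 1" using R R0 r0 by auto
    obtain p where p: "degree p \<le> L" "\<And>t. \<bar>t\<bar> \<le> R \<Longrightarrow> cmod (f (y + t *\<^sub>R axis i 1) - poly p (of_real t)) \<le> K * R ^ \<kappa>"
      and pd: "\<And>h. R/2 \<le> h \<Longrightarrow> h \<le> R \<Longrightarrow> cmod (fd i (Suc m) h y - fact (Suc m) * coeff p (Suc m)) \<le> err (Suc m) * R ^ (\<kappa> - Suc m)"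
      using fd_compare[OF y R(1) Rr(1) m'(3), of i] by blast
    show "\<exists>q. degree q \<le> L \<and> (\<forall>t. \<bar>t\<bar> \<le> R/2 \<longrightarrow> cmod (D i m (y + t *\<^sub>R axis i 1) - poly q (of_real t)) \<le> (7 * err m + 7 * err (Suc m)) * R ^ 4)
       \<and> cmod (coeff q 1 - D i (Suc m) y) \<le> (7 * err m + 7 * err (Suc m)) * R"
    proof (intro exI[of _ "(pderiv ^^ m) p"] conjI allI impI)
      show "degree ((pderiv ^^ m) p) \<le> L" using p(1) by (simp add: degree_higher_pderiv)
      fix t :: real assume t: "\<bar>t\<bar> \<le> R/2"
      have "\<bar>t\<bar> \<le> R0" using t R by linarith
      from D_line[OF mem[OF this] R(1) Rr(1) m'(1) t p]
      have "cmod (D i m (y + t *\<^sub>R axis i 1) - poly ((pderiv ^^ m) p) (of_real t)) \<le> 7 * err m * R ^ (\<kappa> - m)" .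
      also have "\<dots> \<le> (7 * err m + 7 * err (Suc m)) * R ^ 4"
        using R Rr m err_nonneg by (intro mult_mono power_decreasing) auto
      finally show "cmod (D i m (y + t *\<^sub>R axis i 1) - poly ((pderiv ^^ m) p) (of_real t)) \<le> (7 * err m + 7 * err (Suc m)) * R ^ 4" .
    next
      have "coeff ((pderiv ^^ m) p) 1 = pochhammer 2 m * coeff p (Suc m)"
        by (simp add: coeff_higher_pderiv)
      also have "pochhammer 2 m = (fact (Suc m) :: complex)"
        unfolding pochhammer_fact pochhammer_rec by simp
      finally have c: "coeff ((pderiv ^^ m) p) 1 = fact (Suc m) * coeff p (Suc m)" .
      have "cmod (fd i (Suc m) R y - D i (Suc m) y - (fd i (Suc m) R y - fact (Suc m) * coeff p (Suc m)))
         \<le> 6 * err (Suc m) * R ^ (\<kappa> - Suc m) + err (Suc m) * R ^ (\<kappa> - Suc m)"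
        using fd_D[OF y m'(2) R(1) Rr(1)] pd[of R] R by (intro norm_triangle_le_diff[OF add_mono]) auto
      then have "cmod (coeff ((pderiv ^^ m) p) 1 - D i (Suc m) y) \<le> 7 * err (Suc m) * R ^ (\<kappa> - Suc m)"
        unfolding c by (simp add: norm_minus_commute)
      also have "\<dots> \<le> (7 * err m + 7 * err (Suc m)) * R ^ 1"
        using R Rr m err_nonneg by (intro mult_mono power_decreasing) auto
      finally show "cmod (coeff ((pderiv ^^ m) p) 1 - D i (Suc m) y) \<le> (7 * err m + 7 * err (Suc m)) * R" by simp
    qed
  qed
qed

text \<open>Order m is reached by differentiating \<open>D i (m - 1)\<close>, so 3 spare orders
  suffice instead of 4. The identity is carried on the whole open cube because each further partial
  derivative looks at a neighbourhood.\<close>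

lemma partials_eq_D:
  assumes "m + 3 \<le> \<kappa>" "y \<in> cube (s - r0)"
  shows "partials (replicate m i) f y = D i m y"
  using assms
proof (induction m arbitrary: y)
  case 0
  then show ?case by (simp add: D_zero)
next
  case (Suc m)
  define g where "g = partials (replicate m i) f"
  have IH: "g y = D i m y" if "y \<in> cube (s - r0)" for y using Suc that by (simp add: g_def)
  have "((\<lambda>t. g (y + t *\<^sub>R axis i 1)) has_vector_derivative D i (Suc m) y) (at 0)"
  proof (rule has_vector_derivative_transform_within_open)
    show "((\<lambda>t. D i m (y + t *\<^sub>R axis i 1)) has_vector_derivative D i (Suc m) y) (at 0)"
      using Suc by (intro D_has_vector_derivative) auto
    show "open ((\<lambda>t. y + t *\<^sub>R axis i 1) -` cube (s - r0))"
      by (intro open_vimage open_cube continuous_intros)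
  qed (use Suc IH in auto)
  then show ?case by (simp add: g_def[symmetric] partial_def vector_derivative_at)
qed

text \<open>The step that makes mixed derivatives accessible: the axis l of the approximation need
  not be the axis i of differentiation. The difference of mesh r along i is a fixed combination of
  translates of \<open>f\<close>, each approximable along l; the passage from it to
  \<open>D i b\<close> costs the same order r^(\<kappa>-b).\<close>

lemma D_line_approx:
  assumes b: "b < \<kappa>"
  shows "line_approx L (s - r0) r0 (7 * err b) (\<kappa> - b) (D i b)"
  unfolding line_approx_def
proof (intro allI impI)
  fix x :: "real^'n" and l r assume r: "0 < r" "r \<le> r0" and x: "x \<in> cube (s - r0 - r)"
  have xk: "x + (r * node k) *\<^sub>R axis i 1 \<in> cube (s - r)" if "k \<le> L" for k
  proof (rule cube_shift)
    show "x \<in> cube (s - r - r)" using x r cube_mono[of "s - r0 - r" "s - r - r"] by auto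
    show "\<bar>r * node k\<bar> \<le> r" using node[OF that] r by (simp add: abs_mult mult_left_le)
  qed
  have "\<exists>p. \<forall>k\<le>L. degree (p k) \<le> L \<and> (\<forall>t. \<bar>t\<bar> \<le> r \<longrightarrow>
      cmod (f (x + (r * node k) *\<^sub>R axis i 1 + t *\<^sub>R axis l 1) - poly (p k) (of_real t)) \<le> K * r ^ \<kappa>)"
    by (rule choice[of "\<lambda>k p. k \<le> L \<longrightarrow> degree p \<le> L \<and> (\<forall>t. \<bar>t\<bar> \<le> r \<longrightarrow>
      cmod (f (x + (r * node k) *\<^sub>R axis i 1 + t *\<^sub>R axis l 1) - poly p (of_real t)) \<le> K * r ^ \<kappa>)"])
       (use approx xk r in \<open>auto simp: line_approx_def\<close>)
  then obtain p where p: "\<And>k. k \<le> L \<Longrightarrow> degree (p k) \<le> L"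
    "\<And>k t. k \<le> L \<Longrightarrow> \<bar>t\<bar> \<le> r \<Longrightarrow> cmod (f (x + (r * node k) *\<^sub>R axis i 1 + t *\<^sub>R axis l 1) - poly (p k) (of_real t)) \<le> K * r ^ \<kappa>"
    by blast
  define c where "c = complex_of_real (fact b / r ^ b)"
  define q where "q = smult c (\<Sum>k\<le>L. smult (w b k) (p k))"
  have nc: "cmod c = fact b / r ^ b" unfolding c_def norm_of_real using r by simp
  show "\<exists>q. degree q \<le> L \<and> (\<forall>t. \<bar>t\<bar> \<le> r \<longrightarrow> cmod (D i b (x + t *\<^sub>R axis l 1) - poly q (of_real t)) \<le> 7 * err b * r ^ (\<kappa> - b))"
  proof (intro exI[of _ q] conjI allI impI)
    show "degree q \<le> L"
      unfolding q_def using p(1)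
      by (intro order_trans[OF degree_smult_le] degree_sum_le) (auto intro: order_trans[OF degree_smult_le])
    fix t :: real assume t: "\<bar>t\<bar> \<le> r"
    let ?y = "x + t *\<^sub>R axis l 1"
    have y: "?y \<in> cube (s - r0)" by (rule cube_shift[OF x t])
    have "fd i b r ?y - poly q (of_real t) = c * (\<Sum>k\<le>L. w b k * (f (x + (r * node k) *\<^sub>R axis i 1 + t *\<^sub>R axis l 1) - poly (p k) (of_real t)))"
      by (simp add: fd_def q_def c_def poly_sum right_diff_distrib sum_subtractf add_ac)
    also have "cmod \<dots> \<le> fact b / r ^ b * (\<Sum>k\<le>L. cmod (w b k) * (K * r ^ \<kappa>))"
      unfolding norm_mult nc
    proof (intro mult_left_mono sum_norm_le)
      fix k assume "k \<in> {..L}"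
      then show "cmod (w b k * (f (x + (r * node k) *\<^sub>R axis i 1 + t *\<^sub>R axis l 1) - poly (p k) (of_real t))) \<le> cmod (w b k) * (K * r ^ \<kappa>)"
        unfolding norm_mult using p(2)[OF _ t] by (intro mult_left_mono) auto
    qed (use r in auto)
    also have "\<dots> \<le> fact b / r ^ b * (60 ^ Suc L * (K * r ^ \<kappa>))"
      unfolding sum_distrib_right[symmetric] using weights[of b] r K
      by (intro mult_left_mono mult_right_mono) auto
    also have "\<dots> = fact b * 1 * 60 ^ Suc L * K * r ^ (\<kappa> - b)"
    proof -
      have "r ^ \<kappa> = r ^ b * r ^ (\<kappa> - b)" using b by (simp add: power_add[symmetric])
      then show ?thesis using r by (simp add: field_simps)
    qed
    also have "\<dots> \<le> err b * r ^ (\<kappa> - b)"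
      unfolding err_def using r K by (intro mult_right_mono mult_left_mono) auto
    finally have 1: "cmod (fd i b r ?y - poly q (of_real t)) \<le> err b * r ^ (\<kappa> - b)" .
    have "cmod ((fd i b r ?y - poly q (of_real t)) - (fd i b r ?y - D i b ?y)) \<le> err b * r ^ (\<kappa> - b) + 6 * err b * r ^ (\<kappa> - b)"
      using 1 fd_D[OF y b r] by (rule norm_triangle_le_diff[OF add_mono])
    then show "cmod (D i b ?y - poly q (of_real t)) \<le> 7 * err b * r ^ (\<kappa> - b)" by simp
  qed
qed

lemma continuous_on_D:
  assumes b: "b < \<kappa>" and f: "continuous_on (cube s) f"
  shows "continuous_on (cube (s - r0)) (D i b)"
proof (rule uniform_limit_theorem)
  show "uniform_limit (cube (s - r0)) (\<lambda>n. fd i b (r0 / 2 ^ n)) (D i b) sequentially"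
    unfolding uniform_limit_iff
  proof (intro allI impI)
    fix e :: real assume e: "0 < e"
    have "(\<lambda>n. 4 * err b * (r0 * (1/2) ^ n)) \<longlonglongrightarrow> 4 * err b * (r0 * 0)"
      by (intro tendsto_intros LIMSEQ_power_zero) simp
    then have "\<forall>\<^sub>F n in sequentially. 4 * err b * (r0 * (1/2) ^ n) < e"
      using e by (intro order_tendstoD(2)[of _ "4 * err b * (r0 * 0)"]) auto
    then show "\<forall>\<^sub>F n in sequentially. \<forall>y\<in>cube (s - r0). dist (fd i b (r0 / 2 ^ n) y) (D i b y) < e"
    proof eventually_elim
      case (elim n)
      show ?case
      proof
        fix y :: "real^'n" assume y: "y \<in> cube (s - r0)"
        have "cmod (fd i b (r0 / 2 ^ n) y - D i b y) \<le> 4 * err b * (r0 / 2 ^ n) ^ (\<kappa> - b)"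
          by (rule fd_dyadic[OF y b])
        also have "\<dots> \<le> 4 * err b * (r0 / 2 ^ n) ^ 1"
        proof (intro mult_left_mono power_decreasing)
          have "r0 / 2 ^ n \<le> 1 / 1" using r0 by (intro frac_le) auto
          then show "r0 / 2 ^ n \<le> 1" by simp
        qed (use b r0 err_nonneg[of b] in auto)
        also have "\<dots> < e" using elim by (simp add: power_one_over field_simps)
        finally show "dist (fd i b (r0 / 2 ^ n) y) (D i b y) < e" by (simp add: dist_norm)
      qed
    qed
  qed
  show "\<forall>\<^sub>F n in sequentially. continuous_on (cube (s - r0)) (fd i b (r0 / 2 ^ n))"
  proof (intro always_eventually allI)
    fix n :: nat
    have h: "0 \<le> r0 / 2 ^ n" "r0 / 2 ^ n \<le> r0" using r0 by (auto simp: divide_le_eq mult_left_le)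
    show "continuous_on (cube (s - r0)) (fd i b (r0 / 2 ^ n))"
      unfolding fd_def
    proof (intro continuous_intros continuous_on_compose2[OF f])
      fix k assume k: "k \<in> {..L}"
      have "\<bar>r0 / 2 ^ n * node k\<bar> \<le> r0"
        using node[of k] k h mult_mono[of "r0 / 2 ^ n" r0 "node k" 1] by (simp add: abs_mult)
      then show "(\<lambda>y. y + (r0 / 2 ^ n * node k) *\<^sub>R axis i 1) ` cube (s - r0) \<subseteq> cube s"
        using cube_shift by blast
    qed
  qed
qed simp

end

text \<open>The loss \<open>\<Gamma>\<close> is only exponential in \<open>b\<close> and \<open>L\<close>, which moderate growth absorbs.\<close>
lemma partials_replicate_step:
  fixes f :: "real^'n::finite \<Rightarrow> complex"
  assumes r0: "0 < r0" "r0 \<le> 1" and K: "0 \<le> K" and LA: "line_approx L (s + r0) r0 K (\<kappa> + b) f" and \<kappa>: "4 \<le> \<kappa>"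
    and S: "\<And>x. x \<in> cube (s + r0) \<Longrightarrow> cmod (f x) \<le> S" and cont: "continuous_on (cube (s + r0)) f"
    and \<Gamma>: "7 * 2 ^ b * 60 ^ Suc L \<le> \<Gamma>"
  shows "line_approx L s r0 (fact b * \<Gamma> * K) \<kappa> (partials (replicate b i) f)"
    and "\<And>x. x \<in> cube s \<Longrightarrow> cmod (partials (replicate b i) f x) \<le> fact b * \<Gamma> * (S / r0 ^ b + K)"
    and "continuous_on (cube s) (partials (replicate b i) f)"
    and "\<And>x. x \<in> cube s \<Longrightarrow> (\<lambda>t. f (x + t *\<^sub>R axis i 1)) differentiable (at 0)"
proof -
  obtain t c where tc: "\<And>k. k \<le> L \<Longrightarrow> 0 \<le> t k \<and> t k \<le> (1::real)"
    "\<And>b. (\<Sum>k\<le>L. cmod (c b k)) \<le> 60 ^ Suc L"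
    "\<And>p b. degree p \<le> L \<Longrightarrow> coeff p b = (\<Sum>k\<le>L. c b k * poly p (of_real (t k)))"
    using lagrange_functional[of L] by blast
  interpret sampled_lines f L "\<kappa> + b" "s + r0" r0 K S t c
    by standard (use tc r0 K LA S in auto)
  have b: "b < \<kappa> + b" using \<kappa> by simp
  have eq: "partials (replicate b i) f x = D i b x" if "x \<in> cube s" for x
    using \<kappa> that by (intro partials_eq_D) auto
  have err7: "7 * err b \<le> fact b * \<Gamma> * K"
    using mult_right_mono[OF mult_left_mono[OF \<Gamma>, of "fact b"] K] by (simp add: err_def mult_ac)
  have S0: "0 \<le> S" if "x \<in> cube s" for x :: "real^'n"
    using order_trans[OF norm_ge_zero S, of x] that r0 cube_mono[of s "s + r0"] by auto
  show "line_approx L s r0 (fact b * \<Gamma> * K) \<kappa> (partials (replicate b i) f)"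
    unfolding line_approx_def
  proof (intro allI impI)
    fix x :: "real^'n" and l r assume r: "0 < r" "r \<le> r0" and x: "x \<in> cube (s - r)"
    obtain p where p: "degree p \<le> L" "\<And>t. \<bar>t\<bar> \<le> r \<Longrightarrow> cmod (D i b (x + t *\<^sub>R axis l 1) - poly p (of_real t)) \<le> 7 * err b * r ^ \<kappa>"
      using D_line_approx[OF b, of i] r x unfolding line_approx_def by simp metis
    show "\<exists>p. degree p \<le> L \<and> (\<forall>t. \<bar>t\<bar> \<le> r \<longrightarrow> cmod (partials (replicate b i) f (x + t *\<^sub>R axis l 1) - poly p (of_real t)) \<le> fact b * \<Gamma> * K * r ^ \<kappa>)"
    proof (intro exI[of _ p] conjI allI impI p(1))
      fix t assume t: "\<bar>t\<bar> \<le> r"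
      have "7 * err b * r ^ \<kappa> \<le> fact b * \<Gamma> * K * r ^ \<kappa>" using err7 r by (intro mult_right_mono) auto
      then show "cmod (partials (replicate b i) f (x + t *\<^sub>R axis l 1) - poly p (of_real t)) \<le> fact b * \<Gamma> * K * r ^ \<kappa>"
        using p(2)[OF t] eq[OF cube_shift[OF x t]] by simp
    qed
  qed
  show "cmod (partials (replicate b i) f x) \<le> fact b * \<Gamma> * (S / r0 ^ b + K)" if x: "x \<in> cube s" for x
  proof -
    have "cmod (D i b x) \<le> fact b / r0 ^ b * (60 ^ Suc L * S) + 6 * err b"
      using x by (intro D_bound b) simp
    also have "\<dots> \<le> fact b * \<Gamma> * (S / r0 ^ b) + fact b * \<Gamma> * K"
    proof (rule add_mono)
      have "(1::real) \<le> 2 ^ b" by simp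
      then have "(1::real) * 60 ^ Suc L \<le> 7 * 2 ^ b * 60 ^ Suc L"
        by (intro mult_right_mono) (linarith, simp)
      then have "60 ^ Suc L \<le> \<Gamma>" using \<Gamma> by (simp only: mult_1)
      then have "(60 ^ Suc L) * (fact b / r0 ^ b * S) \<le> \<Gamma> * (fact b / r0 ^ b * S)"
        using S0[OF x] r0 by (intro mult_right_mono) auto
      then show "fact b / r0 ^ b * (60 ^ Suc L * S) \<le> fact b * \<Gamma> * (S / r0 ^ b)" by (simp add: mult_ac)
      show "6 * err b \<le> fact b * \<Gamma> * K" using err7 err_nonneg[of b] by linarith
    qed
    finally show ?thesis by (simp add: eq[OF x] distrib_left)
  qed
  show "continuous_on (cube s) (partials (replicate b i) f)"
    using continuous_on_D[OF b cont, of i] eq by (simp cong: continuous_on_cong)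
  show "(\<lambda>t. f (x + t *\<^sub>R axis i 1)) differentiable (at 0)" if x: "x \<in> cube s" for x
  proof -
    have "((\<lambda>t. f (x + t *\<^sub>R axis i 1)) has_vector_derivative D i (Suc 0) x) (at 0)"
    proof (rule has_vector_derivative_transform_within_open)
      show "((\<lambda>t. D i 0 (x + t *\<^sub>R axis i 1)) has_vector_derivative D i (Suc 0) x) (at 0)"
        using x \<kappa> by (intro D_has_vector_derivative) auto
      show "open ((\<lambda>t. x + t *\<^sub>R axis i 1) -` cube s)"
        by (intro open_vimage open_cube continuous_intros)
    qed (use x \<kappa> in \<open>auto intro!: D_zero\<close>)
    then show ?thesis by (rule differentiableI_vector)
  qed
qed

section \<open>Mixed partial derivatives, one axis at a time\<close>

lemma partials_append: "partials (l1 @ l2) f = partials l1 (partials l2 f)"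
  by (induction l1) auto

text \<open>Each block uses up one margin \<open>r0\<close> of the cube and b units of the order, so
  the outermost block is peeled off and the induction hypothesis used on the larger cube at order
  \<kappa> + b. The constant \<Gamma> is paid once per block, not once per derivative. The 2 in
  \<open>2 * \<Gamma>\<close> comes from merging the sup bound and the error bound.\<close>

lemma partials_blocks:
  fixes f :: "real^'n::finite \<Rightarrow> complex" and bs :: "('n \<times> nat) list"
  assumes r0: "0 < r0" "r0 \<le> 1" and K: "0 \<le> K" and S0: "0 \<le> S" and \<kappa>: "4 \<le> \<kappa>"
    and LA: "line_approx L (s + real (length bs) * r0) r0 K (\<kappa> + sum_list (map snd bs)) f"
    and S: "\<And>x. x \<in> cube (s + real (length bs) * r0) \<Longrightarrow> cmod (f x) \<le> S"
    and cont: "continuous_on (cube (s + real (length bs) * r0)) f"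
    and \<Gamma>: "\<And>i b. (i, b) \<in> set bs \<Longrightarrow> 7 * 2 ^ b * 60 ^ Suc L \<le> \<Gamma>" "0 \<le> \<Gamma>"
  defines "g \<equiv> partials (concat (map (\<lambda>(i, b). replicate b i) bs)) f"
    and "c \<equiv> prod_list (map (\<lambda>(i, b). fact b) bs)"
  shows "line_approx L s r0 (c * \<Gamma> ^ length bs * K) \<kappa> g \<and> continuous_on (cube s) g \<and>
    (\<forall>x\<in>cube s. cmod (g x) \<le> c * (2 * \<Gamma>) ^ length bs * (S + K) / r0 ^ sum_list (map snd bs))"
  using \<kappa> LA S cont \<Gamma>(1) unfolding g_def c_def
proof (induction bs arbitrary: s \<kappa>)
  case Nil
  then show ?case using K by (auto intro: add_increasing2)
next
  case (Cons ib bs)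
  obtain i b where ib: "ib = (i, b)" by (cases ib)
  define g where "g = partials (concat (map (\<lambda>(i, b). replicate b i) bs)) f"
  define c where "c = (prod_list (map (\<lambda>(i, b). fact b) bs) :: real)"
  define n where "n = length bs"
  define B where "B = sum_list (map snd bs)"
  define S1 where "S1 = c * (2 * \<Gamma>) ^ n * (S + K) / r0 ^ B"
  define K1 where "K1 = c * \<Gamma> ^ n * K"
  have c0: "0 \<le> c" unfolding c_def by (intro prod_list_nonneg) auto
  have sn: "s + real (length (ib # bs)) * r0 = (s + r0) + real n * r0" by (simp add: n_def algebra_simps)
  have \<kappa>n: "\<kappa> + sum_list (map snd (ib # bs)) = (\<kappa> + b) + B" by (simp add: ib B_def)
  have IH: "line_approx L (s + r0) r0 K1 (\<kappa> + b) g \<and> continuous_on (cube (s + r0)) g \<and> (\<forall>x\<in>cube (s + r0). cmod (g x) \<le> S1)"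
    unfolding K1_def S1_def g_def c_def n_def B_def
  proof (rule Cons.IH)
    show "4 \<le> \<kappa> + b" using Cons.prems(1) by simp
    show "line_approx L (s + r0 + real (length bs) * r0) r0 K (\<kappa> + b + sum_list (map snd bs)) f"
      using Cons.prems(2) unfolding sn \<kappa>n n_def B_def .
    show "cmod (f x) \<le> S" if "x \<in> cube (s + r0 + real (length bs) * r0)" for x
      using Cons.prems(3)[of x] that unfolding sn n_def by blast
    show "continuous_on (cube (s + r0 + real (length bs) * r0)) f"
      using Cons.prems(4) unfolding sn n_def .
    show "7 * 2 ^ b * 60 ^ Suc L \<le> \<Gamma>" if "(i, b) \<in> set bs" for i b
      using Cons.prems(5)[of i b] that by simp
  qed
  have K10: "0 \<le> K1" using c0 K \<Gamma> by (simp add: K1_def)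
  have \<Gamma>b: "7 * 2 ^ b * 60 ^ Suc L \<le> \<Gamma>" using Cons.prems(5)[of i b] by (simp add: ib)
  note step = partials_replicate_step[where ?r0.0 = r0 and K = K1 and L = L and s = s and \<kappa> = \<kappa> and b = b and f = g and S = S1 and \<Gamma> = \<Gamma>]
  have g: "partials (concat (map (\<lambda>(i, b). replicate b i) (ib # bs))) f = partials (replicate b i) g"
    by (simp add: ib partials_append g_def)
  have cc: "prod_list (map (\<lambda>(i, b). fact b) (ib # bs)) = fact b * c" by (simp add: ib c_def)
  have 1: "line_approx L s r0 (fact b * c * \<Gamma> ^ length (ib # bs) * K) \<kappa> (partials (replicate b i) g)"
    using step(1) r0 K10 IH Cons.prems(1) \<Gamma>b by (simp add: K1_def n_def mult_ac)
  have 2: "continuous_on (cube s) (partials (replicate b i) g)"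
    using step(3) r0 K10 IH Cons.prems(1) \<Gamma>b by simp
  have 3: "cmod (partials (replicate b i) g x) \<le> fact b * c * (2 * \<Gamma>) ^ length (ib # bs) * (S + K) / r0 ^ sum_list (map snd (ib # bs))"
    if x: "x \<in> cube s" for x
  proof -
    have "cmod (partials (replicate b i) g x) \<le> fact b * \<Gamma> * (S1 / r0 ^ b + K1)"
      using step(2)[OF _ _ _ _ _ _ _ _ x] r0 K10 IH Cons.prems(1) \<Gamma>b by simp
    also have "K1 \<le> S1 / r0 ^ b"
    proof -
      have "K1 \<le> c * (2 * \<Gamma>) ^ n * (S + K)"
        unfolding K1_def using c0 \<Gamma> K S0 by (intro mult_mono power_mono) auto
      also have "\<dots> \<le> c * (2 * \<Gamma>) ^ n * (S + K) / r0 ^ (B + b)"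
        using r0 c0 \<Gamma> K S0 by (intro divide_left_mono[of _ 1, simplified]) (auto simp: power_le_one)
      finally show ?thesis by (simp add: S1_def power_add)
    qed
    then have "fact b * \<Gamma> * (S1 / r0 ^ b + K1) \<le> fact b * \<Gamma> * (S1 / r0 ^ b + S1 / r0 ^ b)"
      using \<Gamma> by (intro mult_left_mono add_left_mono) auto
    also have "\<dots> = fact b * c * (2 * \<Gamma>) ^ length (ib # bs) * (S + K) / r0 ^ sum_list (map snd (ib # bs))"
      by (simp add: S1_def n_def B_def ib power_add field_simps)
    finally show ?thesis .
  qed
  show ?case unfolding g cc using 1 2 3 by blast
qed

text \<open>Smoothness quantifies over arbitrary lists of axes, so each entry becomes a block of its
  own. The constants then grow badly with the length of the list, which is harmless for a
  qualitative statement.\<close>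

lemma smooth_on_cube:
  fixes f :: "real^'n::finite \<Rightarrow> complex"
  assumes s: "0 < s" and r0: "0 < r0" and S: "\<And>x. x \<in> cube (2 * s) \<Longrightarrow> cmod (f x) \<le> S"
    and cont: "continuous_on (cube (2 * s)) f"
    and LA: "\<And>N. 1 \<le> N \<Longrightarrow> \<exists>L K. 0 \<le> K \<and> line_approx L (2 * s) r0 K N f"
  shows "smooth_on (cube s) f"
  unfolding smooth_on_def
proof (intro allI conjI ballI)
  fix "is" :: "'n list"
  define n where "n = length is"
  define r where "r = min r0 (min 1 (s / real (n + 1)))"
  have "0 < s / real (n + 1)" using s by simp
  then have r: "0 < r" "r \<le> 1" "r \<le> r0" "r \<le> s / real (n + 1)" using r0 unfolding r_def by auto
  have rs: "s + r + real n * r \<le> 2 * s"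
  proof -
    have "r * real (n + 1) \<le> s" using r(4) by (simp add: le_divide_eq)
    then show ?thesis by (simp add: algebra_simps)
  qed
  \<comment> \<open>n orders are spent on the list; the remaining 5 = 4 + 1 allow one further
    differentiation at the end, for which the extra margin r is kept as well.\<close>
  obtain L K where K: "0 \<le> K" "line_approx L (2 * s) r0 K (5 + n) f" using LA[of "5 + n"] by auto
  define bs where "bs = map (\<lambda>i. (i, 1::nat)) is"
  have bs: "length bs = n" "sum_list (map snd bs) = n" "concat (map (\<lambda>(i, b). replicate b i) bs) = is"
  proof -
    show "length bs = n" by (simp add: bs_def n_def)
    show "sum_list (map snd bs) = n" unfolding bs_def n_def by (induction "is") auto
    show "concat (map (\<lambda>(i, b). replicate b i) bs) = is" unfolding bs_def by (induction "is") auto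
  qed
  have S0: "0 \<le> S" using order_trans[OF norm_ge_zero S[OF zero_mem_cube]] s by simp
  define \<Gamma> where "\<Gamma> = (7 * 2 ^ 1 * 60 ^ Suc L :: real)"
  have sub: "cube (s + r + real n * r) \<subseteq> cube (2 * s)" by (rule cube_mono[OF rs])
  define g where "g = partials is f"
  obtain K' S' where g: "line_approx L (s + r) r K' 5 g" "continuous_on (cube (s + r)) g" "\<And>x. x \<in> cube (s + r) \<Longrightarrow> cmod (g x) \<le> S'" and K': "0 \<le> K'"
  proof -
    have "line_approx L (s + r) r (prod_list (map (\<lambda>(i, b). fact b) bs) * \<Gamma> ^ length bs * K) 5 g \<and> continuous_on (cube (s + r)) g \<and>
      (\<forall>x\<in>cube (s + r). cmod (g x) \<le> prod_list (map (\<lambda>(i, b). fact b) bs) * (2 * \<Gamma>) ^ length bs * (S + K) / r ^ sum_list (map snd bs))"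
      unfolding g_def bs(3)[symmetric]
    proof (rule partials_blocks[OF r(1,2) K(1) S0])
      show "(4::nat) \<le> 5" by simp
      show "line_approx L (s + r + real (length bs) * r) r K (5 + sum_list (map snd bs)) f"
        using line_approx_mono[OF K(2) rs r(3)] unfolding bs .
      show "cmod (f x) \<le> S" if "x \<in> cube (s + r + real (length bs) * r)" for x
        using S sub that unfolding bs by blast
      show "continuous_on (cube (s + r + real (length bs) * r)) f"
        using continuous_on_subset[OF cont sub] unfolding bs .
      show "7 * 2 ^ b * 60 ^ Suc L \<le> \<Gamma>" if "(i, b) \<in> set bs" for i b
        using that by (auto simp: bs_def \<Gamma>_def)
      show "0 \<le> \<Gamma>" by (simp add: \<Gamma>_def)
    qed
    moreover have "0 \<le> prod_list (map (\<lambda>(i, b). fact b) bs) * \<Gamma> ^ length bs * K"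
      using K by (intro mult_nonneg_nonneg prod_list_nonneg zero_le_power) (auto simp: \<Gamma>_def)
    ultimately show ?thesis using that by blast
  qed
  have sub': "cube s \<subseteq> cube (s + r)" using r by (intro cube_mono) auto
  show "continuous_on (cube s) (partials is f)" using continuous_on_subset[OF g(2) sub'] by (simp add: g_def)
  fix x :: "real^'n" and i assume x: "x \<in> cube s"
  show "(\<lambda>t. partials is f (x + t *\<^sub>R axis i 1)) differentiable (at 0)"
    using partials_replicate_step(4)[where ?r0.0 = r and K = K' and L = L and s = s and \<kappa> = 4 and b = 1 and f = g and S = S' and \<Gamma> = \<Gamma> and x = x and i = i] r K' g x
    by (simp add: g_def \<Gamma>_def)
qed

lemma fact_mult_le: "fact a * fact b \<le> (fact (a + b) :: real)"
proof -
  have "(fact a * fact b :: nat) \<le> fact (a + b)"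
    by (intro dvd_imp_le fact_fact_dvd_fact) simp
  then show ?thesis by (metis of_nat_fact of_nat_le_iff of_nat_mult)
qed

lemma prod_list_fact_le: "prod_list (map (\<lambda>i. fact (\<alpha> i)) xs) \<le> (fact (sum_list (map \<alpha> xs)) :: real)"
proof (induction xs)
  case (Cons x xs)
  have "fact (\<alpha> x) * prod_list (map (\<lambda>i. fact (\<alpha> i)) xs) \<le> (fact (\<alpha> x) * fact (sum_list (map \<alpha> xs)) :: real)"
    using Cons by (intro mult_left_mono) auto
  also have "\<dots> \<le> fact (\<alpha> x + sum_list (map \<alpha> xs))" by (rule fact_mult_le)
  finally show ?case by simp
qed simp

text \<open>With one block per coordinate, \<Gamma> enters only to the power of the dimension and
  the loss stays exponential in the order of the derivative. The factorials of the blocks multiply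
  to at most the factorial of the total order.\<close>

lemma dpartial_bound:
  fixes f :: "real^'n::finite \<Rightarrow> complex"
  assumes r0: "0 < r0" "r0 \<le> 1" "s + real CARD('n) * r0 \<le> s1" and K: "0 \<le> K" and s: "0 < s"
    and S: "\<And>x. x \<in> cube s1 \<Longrightarrow> cmod (f x) \<le> S" and cont: "continuous_on (cube s1) f"
    and LA: "line_approx L s1 r0 K (mi_length \<alpha> + 4) f" and x: "x \<in> cube s"
  shows "cmod (dpartial \<alpha> f x) \<le> fact (mi_length \<alpha>) * (14 * 2 ^ mi_length \<alpha> * 60 ^ Suc L) ^ CARD('n) * (S + K) / r0 ^ mi_length \<alpha>"
proof -
  define xs where "xs = (SOME xs. distinct xs \<and> set xs = (UNIV :: 'n set))"
  have "distinct xs \<and> set xs = (UNIV :: 'n set)"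
    unfolding xs_def by (rule someI_ex) (use finite_distinct_list[of "UNIV :: 'n set"] in auto)
  then have xs: "distinct xs" "set xs = (UNIV :: 'n set)" by auto
  define bs where "bs = map (\<lambda>i. (i, \<alpha> i)) xs"
  define k where "k = mi_length \<alpha>"
  have len: "length bs = CARD('n)" using distinct_card[OF xs(1)] xs(2) by (simp add: bs_def)
  have sum': "sum_list (map \<alpha> xs) = k"
    unfolding k_def mi_length_def using xs by (metis sum_list_distinct_conv_sum_set)
  have sum: "sum_list (map snd bs) = k" using sum' by (simp add: bs_def o_def)
  have dp: "dpartial \<alpha> f = partials (concat (map (\<lambda>(i, b). replicate b i) bs)) f"
    by (simp add: dpartial_def xs_def[symmetric] bs_def o_def)
  have pl: "prod_list (map (\<lambda>(i, b). fact b) bs) \<le> (fact k :: real)"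
    using prod_list_fact_le[of \<alpha> xs] by (simp add: bs_def o_def sum')
  have pl0: "0 \<le> (prod_list (map (\<lambda>(i, b). fact b) bs) :: real)" by (intro prod_list_nonneg) auto
  define \<Gamma> where "\<Gamma> = (7 * 2 ^ k * 60 ^ Suc L :: real)"
  have \<Gamma>: "7 * 2 ^ b * 60 ^ Suc L \<le> \<Gamma>" if "(i, b) \<in> set bs" for i b
  proof -
    have "b = \<alpha> i" using that by (auto simp: bs_def)
    also have "\<dots> \<le> k" unfolding k_def mi_length_def by (rule member_le_sum) auto
    finally show ?thesis unfolding \<Gamma>_def by (intro mult_right_mono mult_left_mono power_increasing) auto
  qed
  have "0 \<in> cube s1" using s r0 by (intro zero_mem_cube) (smt (verit) mult_nonneg_nonneg of_nat_0_le_iff)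
  from order_trans[OF norm_ge_zero S[OF this]] have S0: "0 \<le> S" .
  have sub: "cube (s + real (length bs) * r0) \<subseteq> (cube s1 :: (real^'n) set)" using r0(3) by (intro cube_mono) (simp add: len)
  have "cmod (dpartial \<alpha> f x) \<le> prod_list (map (\<lambda>(i, b). fact b) bs) * (2 * \<Gamma>) ^ length bs * (S + K) / r0 ^ k"
  proof -
    have "line_approx L (s + real (length bs) * r0) r0 K (4 + sum_list (map snd bs)) f"
      using line_approx_mono[OF LA, of "s + real (length bs) * r0" r0] r0(3) by (simp add: len sum k_def add.commute)
    moreover have "cmod (f x) \<le> S" if "x \<in> cube (s + real (length bs) * r0)" for x using S sub that by blast
    moreover have "0 \<le> \<Gamma>" by (simp add: \<Gamma>_def)
    ultimately have "\<forall>x\<in>cube s. cmod (partials (concat (map (\<lambda>(i, b). replicate b i) bs)) f x)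
      \<le> prod_list (map (\<lambda>(i, b). fact b) bs) * (2 * \<Gamma>) ^ length bs * (S + K) / r0 ^ sum_list (map snd bs)"
      using partials_blocks[OF r0(1,2) K S0 order_refl _ _ continuous_on_subset[OF cont sub], where \<Gamma> = \<Gamma>] \<Gamma> by blast
    then show ?thesis using x unfolding dp sum by blast
  qed
  also have "\<dots> \<le> fact k * (2 * \<Gamma>) ^ length bs * (S + K) / r0 ^ k"
    using pl S0 K r0 by (intro divide_right_mono mult_right_mono) (auto simp: \<Gamma>_def)
  also have "2 * \<Gamma> = 14 * 2 ^ k * 60 ^ Suc L" by (simp add: \<Gamma>_def)
  finally show ?thesis by (simp only: k_def len)
qed

section \<open>Weight sequences and Taylor expansion along lines\<close>

lemma cube_subset_cball:
  assumes "0 \<le> s" shows "(cube s :: (real^'n::finite) set) \<subseteq> cball 0 (real CARD('n) * s)"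
proof
  fix x :: "real^'n" assume "x \<in> cube s"
  then have "(\<Sum>i\<in>UNIV. \<bar>x $ i\<bar>) \<le> (\<Sum>i\<in>(UNIV::'n set). s)" by (intro sum_mono) (simp add: cube_def less_imp_le)
  then show "x \<in> cball 0 (real CARD('n) * s)" using norm_le_l1_cart[of x] by simp
qed

text \<open>Whatever enumeration of the coordinates is chosen, every block except that of i is
  empty.\<close>

lemma dpartial_single_axis:
  fixes i :: "'n::finite"
  shows "dpartial (\<lambda>l. if l = i then N else 0) f = partials (replicate N i) f"
    and "mi_length (\<lambda>l. if l = i then N else 0) = N"
proof -
  define xs where "xs = (SOME xs. distinct xs \<and> set xs = (UNIV :: 'n set))"
  have "distinct xs \<and> set xs = (UNIV :: 'n set)"
    unfolding xs_def by (rule someI_ex) (use finite_distinct_list[of "UNIV :: 'n set"] in auto)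
  then have xs: "distinct xs" "i \<in> set xs" by auto
  have none: "concat (map (\<lambda>l. replicate (if l = i then N else 0) l) ys) = []" if "i \<notin> set ys" for ys
    using that by (induction ys) auto
  obtain ys zs where ys: "xs = ys @ i # zs" "i \<notin> set ys" "i \<notin> set zs"
    using xs by (metis distinct.simps(2) distinct_append not_distinct_conv_prefix split_list disjoint_insert(1) list.simps(15))
  have "concat (map (\<lambda>l. replicate (if l = i then N else 0) l) xs) =
     concat (map (\<lambda>l. replicate (if l = i then N else 0) l) ys) @ replicate N i @ concat (map (\<lambda>l. replicate (if l = i then N else 0) l) zs)"
    by (simp add: ys(1))
  then have "concat (map (\<lambda>l. replicate (if l = i then N else 0) l) xs) = replicate N i"
    unfolding none[OF ys(2)] none[OF ys(3)] by simp
  then show "dpartial (\<lambda>l. if l = i then N else 0) f = partials (replicate N i) f"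
    by (simp add: dpartial_def xs_def[symmetric])
  show "mi_length (\<lambda>l. if l = i then N else 0) = N" by (simp add: mi_length_def)
qed

lemma smooth_on_line_derivative:
  fixes g :: "real^'n::finite \<Rightarrow> complex"
  assumes "smooth_on U g" "x + t *\<^sub>R axis i 1 \<in> U"
  shows "((\<lambda>t. partials (replicate m i) g (x + t *\<^sub>R axis i 1)) has_vector_derivative
     partials (replicate (Suc m) i) g (x + t *\<^sub>R axis i 1)) (at t)"
proof -
  let ?y = "x + t *\<^sub>R axis i 1"
  let ?h = "partials (replicate m i) g"
  have "(\<lambda>u. ?h (?y + u *\<^sub>R axis i 1)) differentiable (at 0)"
    using assms unfolding smooth_on_def by blast
  then have "((\<lambda>u. ?h (?y + u *\<^sub>R axis i 1)) has_vector_derivative partial i ?h ?y) (at (t - t))"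
    by (simp add: partial_def vector_derivative_works)
  moreover have "((\<lambda>u. u - t) has_vector_derivative 1) (at t)"
    by (auto intro!: derivative_eq_intros)
  ultimately have "((\<lambda>u. ?h (?y + u *\<^sub>R axis i 1)) \<circ> (\<lambda>u. u - t) has_vector_derivative 1 *\<^sub>R partial i ?h ?y) (at t)"
    by (intro vector_diff_chain_at)
  then show ?thesis by (simp add: o_def algebra_simps)
qed

text \<open>The expansion is taken at the left end of the segment, so that one integral remainder
  from -r to t covers all t. The remainder N (2r)^N / N! is simplified by N \<le> 2^N, whence
  4r.\<close>

lemma line_taylor:
  fixes g :: "real^'n::finite \<Rightarrow> complex"
  assumes g: "smooth_on U g" and N: "1 \<le> N" and r: "0 < r" and seg: "\<And>t. \<bar>t\<bar> \<le> r \<Longrightarrow> x + t *\<^sub>R axis i 1 \<in> U"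
    and B: "\<And>y. y \<in> U \<Longrightarrow> cmod (partials (replicate N i) g y) \<le> B"
  shows "\<exists>p. degree p \<le> N \<and> (\<forall>t. \<bar>t\<bar> \<le> r \<longrightarrow> cmod (g (x + t *\<^sub>R axis i 1) - poly p (of_real t)) \<le> B * (4 * r) ^ N / fact N)"
proof -
  define Df where "Df m t = partials (replicate m i) g (x + t *\<^sub>R axis i 1)" for m t
  define p where "p = (\<Sum>k<N. smult (Df k (-r) / fact k) ([:of_real r, 1:] ^ k))"
  have B0: "0 \<le> B" using order_trans[OF norm_ge_zero B[OF seg[of 0]]] r by simp
  show ?thesis
  proof (intro exI[of _ p] conjI allI impI)
    show "degree p \<le> N"
      unfolding p_def
    proof (rule degree_sum_le)
      fix k assume "k \<in> {..<N}"
      have "degree (smult (Df k (-r) / fact k) ([:of_real r, 1:] ^ k)) \<le> degree ([:complex_of_real r, 1:] ^ k)"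
        by (rule degree_smult_le)
      also have "\<dots> \<le> N" using degree_power_le[of "[:complex_of_real r, 1:]" k] \<open>k \<in> {..<N}\<close> by simp
      finally show "degree (smult (Df k (-r) / fact k) ([:of_real r, 1:] ^ k)) \<le> N" .
    qed simp
    fix t :: real assume t: "\<bar>t\<bar> \<le> r"
    have D: "(Df m has_vector_derivative Df (Suc m) u) (at u within {-r..t})" if "m < N" "-r \<le> u" "u \<le> t" for m u
      unfolding Df_def
      by (rule has_vector_derivative_at_within, rule smooth_on_line_derivative[OF g], rule seg) (use that t in auto)
    have N0: "0 < N" using N by simp
    let ?I = "\<lambda>u. ((t - u) ^ (N - 1) / fact (N - 1)) *\<^sub>R Df N u"
    have tay: "(?I has_integral Df 0 t - (\<Sum>k<N. ((t - - r) ^ k / fact k) *\<^sub>R Df k (-r))) {-r..t}"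
      by (rule Taylor_has_integral[where Df = Df and f = "Df 0", OF N0 refl]) (use t D in auto)
    have P: "poly p (of_real t) = (\<Sum>k<N. ((t - - r) ^ k / fact k) *\<^sub>R Df k (-r))"
      unfolding p_def by (auto simp: poly_sum scaleR_conv_of_real add.commute intro!: sum.cong)
    have G: "g (x + t *\<^sub>R axis i 1) = Df 0 t" by (simp add: Df_def)
    have "cmod (Df 0 t - poly p (of_real t)) \<le> ((2 * r) ^ (N - 1) / fact (N - 1) * B) * measure lborel (cbox (-r) t)"
      unfolding P
    proof (rule has_integral_bound)
      show "0 \<le> (2 * r) ^ (N - 1) / fact (N - 1) * B" using B0 r by simp
      show "(?I has_integral Df 0 t - (\<Sum>k<N. ((t - - r) ^ k / fact k) *\<^sub>R Df k (-r))) (cbox (-r) t)" using tay by simp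
      fix u assume u: "u \<in> cbox (-r) t"
      have "cmod (?I u) = \<bar>(t - u) ^ (N - 1) / fact (N - 1)\<bar> * cmod (Df N u)" by simp
      also have "\<dots> \<le> (2 * r) ^ (N - 1) / fact (N - 1) * B"
      proof (rule mult_mono)
        have "\<bar>t - u\<bar> ^ (N - 1) \<le> (2 * r) ^ (N - 1)" using u t by (intro power_mono) auto
        then show "\<bar>(t - u) ^ (N - 1) / fact (N - 1)\<bar> \<le> (2 * r) ^ (N - 1) / fact (N - 1)"
          by (simp add: power_abs divide_right_mono)
        show "cmod (Df N u) \<le> B" unfolding Df_def using u t by (intro B seg) auto
      qed (use r in auto)
      finally show "norm (?I u) \<le> (2 * r) ^ (N - 1) / fact (N - 1) * B" .
    qed
    also have "\<dots> \<le> ((2 * r) ^ (N - 1) / fact (N - 1) * B) * (2 * r)"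
      using t r B0 by (intro mult_left_mono) auto
    also have "\<dots> = B * (real N * (2 * r) ^ N) / fact N"
    proof -
      obtain n where "N = Suc n" using N0 gr0_implies_Suc by blast
      then show ?thesis by (simp del: of_nat_Suc add: field_simps)
    qed
    also have "\<dots> \<le> B * (2 ^ N * (2 * r) ^ N) / fact N"
    proof -
      have "real N \<le> 2 ^ N" using of_nat_less_two_power[of N, where 'a=real] by simp
      then have "real N * (2 * r) ^ N \<le> 2 ^ N * (2 * r) ^ N" using r by (intro mult_right_mono) auto
      then have "B * (real N * (2 * r) ^ N) \<le> B * (2 ^ N * (2 * r) ^ N)" using B0 by (rule mult_left_mono)
      then show ?thesis by (rule divide_right_mono) simp
    qed
    also have "2 ^ N * (2 * r) ^ N = (2 * (2 * r)) ^ N" unfolding power_mult_distrib ..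
    also have "2 * (2 * r) = 4 * r" by simp
    finally show "cmod (g (x + t *\<^sub>R axis i 1) - poly p (of_real t)) \<le> B * (4 * r) ^ N / fact N" by (simp add: G)
  qed
qed

section \<open>Growth properties of weight sequences\<close>

lemma weight_sequence_pos:
  assumes "weight_sequence M" shows "0 < M k" "M 0 = 1"
proof -
  obtain \<mu> :: "nat \<Rightarrow> real" where "\<forall>k. \<mu> k > 0" "\<forall>k. M k = (\<Prod>i\<in>{1..k}. \<mu> i)"
    using assms unfolding weight_sequence_def by blast
  then show "0 < M k" "M 0 = 1" by (auto intro!: prod_pos)
qed

text \<open>Splitting off N indices at a time gives the exponent N(1 + ... + q), bounded by q^2 N;
  the constant is enlarged to at least 1 so that exponents may be raised freely.\<close>

lemma moderate_growth_multiple: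
  assumes M: "weight_sequence M" and mg: "moderate_growth M"
  obtains C where "1 \<le> C" "\<And>j k. M (j + k) \<le> C ^ (j + k) * M j * M k" "\<And>q N. M (q * N) \<le> C ^ (q * q * N) * M N ^ q"
proof -
  note pos = weight_sequence_pos[OF M]
  obtain C0 where C0: "0 < C0" "\<And>j k. M (j + k) \<le> C0 ^ (j + k) * M j * M k"
    using mg unfolding moderate_growth_def by blast
  define C where "C = max 1 C0"
  have C1: "1 \<le> C" by (simp add: C_def)
  have C: "M (j + k) \<le> C ^ (j + k) * M j * M k" for j k
  proof -
    have "C0 ^ (j + k) * M j * M k \<le> C ^ (j + k) * M j * M k"
      using C0(1) pos(1) by (intro mult_right_mono power_mono) (auto simp: C_def less_imp_le)
    then show ?thesis using C0(2)[of j k] by linarith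
  qed
  have "M (q * N) \<le> C ^ (q * q * N) * M N ^ q" for q N
  proof (induction q)
    case 0
    then show ?case using pos by simp
  next
    case (Suc q)
    have "M (Suc q * N) \<le> C ^ (Suc q * N) * M N * M (q * N)" using C[of N "q * N"] by simp
    also have "\<dots> \<le> C ^ (Suc q * N) * M N * (C ^ (q * q * N) * M N ^ q)"
      using Suc C1 pos(1)[of N] by (intro mult_left_mono) auto
    also have "\<dots> = C ^ (Suc q * N + q * q * N) * M N ^ Suc q" by (simp add: power_add)
    also have "\<dots> \<le> C ^ (Suc q * Suc q * N) * M N ^ Suc q"
      using C1 pos(1)[of N] by (intro mult_right_mono power_increasing) (auto simp: algebra_simps)
    finally show ?case .
  qed
  then show ?thesis using that[OF C1 C] by blast
qed

lemma fact_power_le: "fact N ^ q \<le> (fact (q * N) :: real)"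
proof (induction q)
  case (Suc q)
  have "fact N * fact N ^ q \<le> (fact N * fact (q * N) :: real)" using Suc by (intro mult_left_mono) auto
  also have "\<dots> \<le> fact (N + q * N)" by (rule fact_mult_le)
  finally show ?case by simp
qed simp

text \<open>Since \<open>1/\<mu>\<^sub>k\<close> is decreasing and summable, \<open>k/\<mu>\<^sub>k \<rightarrow> 0\<close>.\<close>
lemma non_quasianalytic_dominates_fact:
  assumes M: "weight_sequence M" and nq: "non_quasianalytic M" and a: "0 < a"
  obtains A where "0 < A" "\<And>k. fact k * a ^ k \<le> A * M k"
proof -
  obtain \<mu> :: "nat \<Rightarrow> real" where \<mu>: "\<And>k. \<mu> k > 0" "mono \<mu>" "\<And>k. M k = (\<Prod>i\<in>{1..k}. \<mu> i)"
    using M unfolding weight_sequence_def by blast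
  note pos = weight_sequence_pos[OF M]
  have MS: "M (Suc k) = M k * \<mu> (Suc k)" for k by (simp add: \<mu>(3) atLeastAtMostSuc_conv mult.commute)
  define x where "x k = 1 / \<mu> (Suc k)" for k
  have x: "x = (\<lambda>k. 1 / (M (Suc k) / M k))" using pos(1) by (auto simp: x_def MS less_imp_neq[symmetric] fun_eq_iff)
  have "summable x" using nq by (simp add: x non_quasianalytic_def)
  then obtain n0 where n0: "\<And>m n. n0 \<le> m \<Longrightarrow> \<bar>sum x {m..<n}\<bar> < 1 / (4 * a)"
    using a unfolding summable_Cauchy by (metis divide_pos_pos mult_pos_pos real_norm_def zero_less_numeral zero_less_one)
  have xdec: "x k \<le> x l" if "l \<le> k" for k l
    using \<mu>(1) monoD[OF \<mu>(2), of "Suc l" "Suc k"] that by (auto simp: x_def intro!: divide_left_mono)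
  \<comment> \<open>For k \<ge> 2 n0 at least half of the indices 0, ..., k lie at or beyond n0, and
    each of their terms is at least \<open>x k\<close>. So (k+1)/2 times \<open>x k\<close> lies
    below the Cauchy bound.\<close>
  have big: "a * real (Suc k) \<le> \<mu> (Suc k)" if k: "2 * n0 \<le> k" for k
  proof -
    have "real (Suc k - n0) * x k \<le> sum x {n0..<Suc k}"
      using sum_mono[of "{n0..<Suc k}" "\<lambda>_. x k" x] xdec by simp
    also have "\<dots> < 1 / (4 * a)" using n0[of n0 "Suc k"] by simp
    finally have 1: "real (Suc k - n0) * x k < 1 / (4 * a)" .
    have "real (Suc k) / 2 \<le> real (Suc k - n0)" using k by (simp add: of_nat_diff)
    then have "real (Suc k) / 2 * x k \<le> real (Suc k - n0) * x k"
      using \<mu>(1)[of "Suc k"] by (intro mult_right_mono) (auto simp: x_def)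
    then have "real (Suc k) / 2 * x k < 1 / (4 * a)" using 1 by linarith
    then have "a * real (Suc k) * 2 < \<mu> (Suc k)" using a \<mu>(1)[of "Suc k"] by (simp add: x_def field_simps)
    moreover have "0 \<le> a * real (Suc k)" using a by simp
    ultimately show ?thesis by linarith
  qed
  define A where "A = (\<Sum>k\<le>2*n0. fact k * a ^ k / M k)"
  have A: "fact k * a ^ k \<le> A * M k" for k
  proof (cases "k \<le> 2 * n0")
    case True
    then have "fact k * a ^ k / M k \<le> A"
      unfolding A_def using a pos(1) by (intro member_le_sum) (auto simp: less_imp_le)
    then show ?thesis using pos(1)[of k] by (simp add: divide_le_eq)
  next
    case False
    then have "2 * n0 \<le> k" by simp
    then show ?thesis
    proof (induction k rule: dec_induct)
      case base
      have "fact (2 * n0) * a ^ (2 * n0) / M (2 * n0) \<le> A"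
        unfolding A_def using a pos(1) by (intro member_le_sum) (auto simp: less_imp_le)
      then show ?case using pos(1)[of "2 * n0"] by (simp add: divide_le_eq)
    next
      case (step k)
      have "fact (Suc k) * a ^ Suc k = (fact k * a ^ k) * (a * real (Suc k))" by (simp add: algebra_simps)
      also have "\<dots> \<le> (A * M k) * \<mu> (Suc k)"
      proof (rule mult_mono)
        show "0 \<le> A * M k" using step(3) a by (intro order_trans[OF _ step(3)]) auto
      qed (use step a big[of k] in auto)
      finally show ?case by (simp add: MS)
    qed
  qed
  have "0 < A" using A[of 0] pos by simp
  then show ?thesis using that A by blast
qed

section \<open>Powers of ultradifferentiable germs\<close>

lemma smooth_on_subset: "smooth_on U f \<Longrightarrow> V \<subseteq> U \<Longrightarrow> smooth_on V f"
  unfolding smooth_on_def by (meson continuous_on_subset subsetD)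

text \<open>Near a point where f does not vanish, f is the quotient of the two powers; at a zero,
  |f| is the j-th root of |f^j|, which is continuous.\<close>

lemma continuous_on_from_powers:
  fixes f :: "'a::topological_space \<Rightarrow> complex"
  assumes j: "1 \<le> j" and f1: "continuous_on U (\<lambda>x. f x ^ j)" and f2: "continuous_on U (\<lambda>x. f x ^ (j + 1))"
  shows "continuous_on U f"
  unfolding continuous_on_def
proof
  fix x assume x: "x \<in> U"
  have t1: "((\<lambda>x. f x ^ j) \<longlongrightarrow> f x ^ j) (at x within U)" and t2: "((\<lambda>x. f x ^ (j + 1)) \<longlongrightarrow> f x ^ (j + 1)) (at x within U)"
    using f1 f2 x unfolding continuous_on_def by blast+
  show "(f \<longlongrightarrow> f x) (at x within U)"
  proof (cases "f x = 0")
    case False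
    have "((\<lambda>x. f x ^ (j + 1) / f x ^ j) \<longlongrightarrow> f x ^ (j + 1) / f x ^ j) (at x within U)"
      using False by (intro tendsto_divide t1 t2) auto
    \<comment> \<open>This holds at zeros of f as well, by the convention that division by 0 yields
      0.\<close>
    moreover have "f y ^ (j + 1) / f y ^ j = f y" for y by (cases "f y = 0") auto
    ultimately show ?thesis by simp
  next
    case True
    have "((\<lambda>y. root j (cmod (f y ^ j))) \<longlongrightarrow> root j (cmod (f x ^ j))) (at x within U)"
      by (intro tendsto_real_root tendsto_norm t1)
    moreover have eq: "root j (cmod (f y ^ j)) = cmod (f y)" for y
      using j by (simp add: norm_power real_root_power_cancel)
    ultimately have "((\<lambda>y. cmod (f y)) \<longlongrightarrow> cmod (f x)) (at x within U)" unfolding eq by blast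
    then show ?thesis using True by (simp add: tendsto_norm_zero_iff)
  qed
qed

text \<open>Joins Taylor's formula for the powers to the interval theorem. The exponent c lost there
  is compensated by expanding to order qN with q \<ge> 1/c, which is why the degree is a multiple of
  N while the error has order N only.\<close>

lemma line_approx_of_powers:
  fixes f :: "real^'n::finite \<Rightarrow> complex"
  assumes M: "weight_sequence M" and mg: "moderate_growth M" and j: "1 \<le> j" and s: "0 < s"
    and smooth: "smooth_on (cube s) (\<lambda>x. f x ^ j)" "smooth_on (cube s) (\<lambda>x. f x ^ (j + 1))"
    and bd: "\<And>\<sigma> k. 0 < \<sigma> \<Longrightarrow> k \<in> {j, j + 1} \<Longrightarrow> \<exists>A. \<forall>x\<in>cube s. \<forall>i N. cmod (partials (replicate N i) (\<lambda>x. f x ^ k) x) \<le> A * \<sigma> ^ N * M N"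
    and B: "1 \<le> B" "\<And>x. x \<in> cube s \<Longrightarrow> cmod (f x) \<le> B"
  obtains q where "\<And>\<rho>. 0 < \<rho> \<Longrightarrow> \<exists>A\<ge>0. \<forall>N\<ge>1. line_approx (q * N) (s/2) (s/2) (A * \<rho> ^ N * M N / fact N) N f"
proof -
  note pos = weight_sequence_pos[OF M]
  obtain C c where C: "1 \<le> C" and c: "0 < c" "c \<le> 1"
    and core: "\<And>N \<delta> f P Q. 1 \<le> N \<Longrightarrow> 0 < \<delta> \<Longrightarrow> \<delta> \<le> 1 \<Longrightarrow> degree P \<le> N \<Longrightarrow> degree Q \<le> N \<Longrightarrow>
      (\<And>t. \<bar>t\<bar> \<le> 1 \<Longrightarrow> cmod (f t) \<le> 1) \<Longrightarrow>
      (\<And>t. \<bar>t\<bar> \<le> 1 \<Longrightarrow> cmod (f t ^ j - poly P (of_real t)) \<le> \<delta>) \<Longrightarrow>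
      (\<And>t. \<bar>t\<bar> \<le> 1 \<Longrightarrow> cmod (f t ^ (j + 1) - poly Q (of_real t)) \<le> \<delta>) \<Longrightarrow>
      \<exists>F. degree F \<le> 5 * N \<and> (\<forall>t. \<bar>t\<bar> \<le> 1/2 \<longrightarrow> cmod (f t - poly F (of_real t)) \<le> C ^ N * \<delta> powr c)"
    using quantitative_joris_interval[OF j] by blast
  obtain H where H: "1 \<le> H" "\<And>q N. M (q * N) \<le> H ^ (q * q * N) * M N ^ q"
    using moderate_growth_multiple[OF M mg] by metis
  define q where "q = nat \<lceil>1 / c\<rceil>"
  have qc: "1 / c \<le> real q" using c by (simp add: q_def of_nat_ceiling)
  have "1 \<le> 1 / c" using c by simp
  then have q: "1 \<le> q" "0 < real q" using qc by linarith+
  have qc': "1 / real q \<le> c" using qc c q by (simp add: field_simps)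
  show ?thesis
  proof (rule that[of "5 * q"])
    fix \<rho> :: real assume \<rho>: "0 < \<rho>"
    \<comment> \<open>All exponential losses are known in advance: C^(qN) from the interval theorem,
      8^N from Taylor's formula at length 2r, H^(qN) from moderate growth. The rate \<sigma> for the
      powers is chosen to leave exactly \<rho>.\<close>
    define \<sigma> where "\<sigma> = \<rho> / (C ^ q * 8 * H ^ q)"
    have CH: "0 < C ^ q * 8 * H ^ q" using C H by simp
    have \<sigma>: "0 < \<sigma>" using \<rho> CH by (simp add: \<sigma>_def)
    obtain A1 where A1: "\<And>x i N. x \<in> cube s \<Longrightarrow> cmod (partials (replicate N i) (\<lambda>x. f x ^ j) x) \<le> A1 * \<sigma> ^ N * M N"
      using bd[OF \<sigma>, of j] by blast
    obtain A2 where A2: "\<And>x i N. x \<in> cube s \<Longrightarrow> cmod (partials (replicate N i) (\<lambda>x. f x ^ (j + 1)) x) \<le> A2 * \<sigma> ^ N * M N"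
      using bd[OF \<sigma>, of "j + 1"] by blast
    define A where "A = max 1 (max A1 A2)"
    have A: "1 \<le> A" "A1 \<le> A" "A2 \<le> A" by (auto simp: A_def)
    have le: "a * \<sigma> ^ N * M N \<le> A * \<sigma> ^ N * M N" if "a \<le> A" for a N
      using that \<sigma> pos(1)[of N] by (intro mult_right_mono) auto
    have "line_approx (5 * q * N) (s/2) (s/2) (B * A * \<rho> ^ N * M N / fact N) N f" if N: "1 \<le> N" for N
      unfolding line_approx_def
    proof (intro allI impI)
      fix x :: "real^'n" and i r assume r: "0 < r" "r \<le> s/2" and x: "x \<in> cube (s/2 - r)"
      define N' where "N' = q * N"
      have N': "1 \<le> N'" using q N by (simp add: N'_def)
      \<comment> \<open>The interval theorem yields its approximation on half of the interval only,
        so the powers are expanded on segments of half-length 2r.\<close>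
      have x2: "x \<in> cube (s - 2 * r)" using x r cube_mono[of "s/2 - r" "s - 2 * r"] by auto
      have seg: "x + t *\<^sub>R axis i 1 \<in> cube s" if "\<bar>t\<bar> \<le> 2 * r" for t by (rule cube_shift[OF x2 that])
      define \<delta> where "\<delta> = A * \<sigma> ^ N' * M N' * (4 * (2 * r)) ^ N' / fact N'"
      have \<delta>0: "0 < \<delta>" using A \<sigma> pos(1)[of N'] r by (simp add: \<delta>_def)
      \<comment> \<open>Built so that \<open>\<delta> \<le> Z ^ q\<close>: the q-th root of the
        error of order qN is an error of order N.\<close>
      define Z where "Z = A * (8 * \<sigma> * r) ^ N * H ^ (q * N) * M N / fact N"
      have Z0: "0 < Z" using A \<sigma> r H pos(1)[of N] by (simp add: Z_def)
      have "\<delta> \<le> Z ^ q"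
      proof -
        have "\<delta> = A * ((8 * \<sigma> * r) ^ N) ^ q * (M (q * N) / fact (q * N))"
        proof -
          have e: "\<sigma> ^ N' * (4 * (2 * r)) ^ N' = ((8 * \<sigma> * r) ^ N) ^ q"
            unfolding N'_def power_mult_distrib[symmetric] power_mult[symmetric] by (simp add: mult_ac)
          have "\<delta> = A * (\<sigma> ^ N' * (4 * (2 * r)) ^ N') * (M N' / fact N')" by (simp add: \<delta>_def mult_ac)
          then show ?thesis unfolding e unfolding N'_def .
        qed
        also have "\<dots> \<le> A ^ q * ((8 * \<sigma> * r) ^ N) ^ q * (H ^ (q * q * N) * M N ^ q / fact N ^ q)"
        proof (rule mult_mono)
          show "A * ((8 * \<sigma> * r) ^ N) ^ q \<le> A ^ q * ((8 * \<sigma> * r) ^ N) ^ q"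
            using A q \<sigma> r power_increasing[of 1 q A] by (intro mult_right_mono) auto
          show "M (q * N) / fact (q * N) \<le> H ^ (q * q * N) * M N ^ q / fact N ^ q"
            using H fact_power_le[of N q] pos(1)[of "q * N"] by (intro frac_le) (auto intro: order_trans[OF less_imp_le])
        qed (use A \<sigma> r pos(1)[of "q * N"] in auto)
        also have "\<dots> = Z ^ q"
          by (simp add: Z_def power_mult_distrib power_divide power_mult[symmetric] mult_ac)
        finally show ?thesis .
      qed
      then have "\<delta> powr (1 / real q) \<le> (Z ^ q) powr (1 / real q)" using \<delta>0 q by (intro powr_mono2) auto
      also have "\<dots> = Z" using Z0 q by (simp add: powr_realpow[symmetric] powr_powr)
      finally have \<delta>Z: "\<delta> powr (1 / real q) \<le> Z" .
      have CZ: "C ^ N' * Z = A * \<rho> ^ N * M N / fact N * r ^ N"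
      proof -
        have "C ^ N' * ((8 * \<sigma> * r) ^ N * H ^ (q * N)) = (C ^ q * 8 * H ^ q * \<sigma> * r) ^ N"
          unfolding N'_def power_mult power_mult_distrib by (simp add: mult_ac)
        also have "C ^ q * 8 * H ^ q * \<sigma> = \<rho>"
        proof -
          have "a * (\<rho> / a) = \<rho>" if "0 < a" for a using that by simp
          from this[OF CH] show ?thesis unfolding \<sigma>_def .
        qed
        finally show ?thesis by (simp add: Z_def power_mult_distrib field_simps)
      qed
      show "\<exists>p. degree p \<le> 5 * q * N \<and> (\<forall>t. \<bar>t\<bar> \<le> r \<longrightarrow> cmod (f (x + t *\<^sub>R axis i 1) - poly p (of_real t)) \<le> B * A * \<rho> ^ N * M N / fact N * r ^ N)"
      proof (cases "\<delta> \<le> 1")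
        case False
        \<comment> \<open>For \<delta> > 1 the permitted error is at least the sup bound B, and the
          zero polynomial serves.\<close>
        have "1 \<le> \<delta> powr (1 / real q)" using False q by (intro ge_one_powr_ge_zero) auto
        then have "1 * 1 \<le> C ^ N' * Z" using \<delta>Z C by (intro mult_mono) auto
        then have "B * 1 \<le> B * (C ^ N' * Z)" using B by (intro mult_left_mono) auto
        then have "cmod (f (x + t *\<^sub>R axis i 1)) \<le> B * A * \<rho> ^ N * M N / fact N * r ^ N" if "\<bar>t\<bar> \<le> r" for t
          using B(2)[OF seg[of t]] that r unfolding CZ by (simp add: mult_ac)
        then show ?thesis by (intro exI[of _ 0]) simp
      next
        case True
        have r2: "0 < 2 * r" using r by simp
        obtain p1 where p1: "degree p1 \<le> N'" "\<And>t. \<bar>t\<bar> \<le> 2 * r \<Longrightarrow> cmod (f (x + t *\<^sub>R axis i 1) ^ j - poly p1 (of_real t)) \<le> \<delta>"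
          using line_taylor[OF smooth(1) N' r2 seg order_trans[OF A1 le[OF A(2)]]] unfolding \<delta>_def by blast
        obtain p2 where p2: "degree p2 \<le> N'" "\<And>t. \<bar>t\<bar> \<le> 2 * r \<Longrightarrow> cmod (f (x + t *\<^sub>R axis i 1) ^ (j + 1) - poly p2 (of_real t)) \<le> \<delta>"
          using line_taylor[OF smooth(2) N' r2 seg order_trans[OF A2 le[OF A(3)]]] unfolding \<delta>_def by blast
        define \<phi> where "\<phi> t = f (x + (2 * r * t) *\<^sub>R axis i 1) / of_real B" for t
        define sc where "sc k p = smult (1 / of_real B ^ k) (pcompose p [:0, of_real (2 * r):])" for k and p :: "complex poly"
        have dsc: "degree (sc k p) \<le> N'" if "degree p \<le> N'" for k p
          unfolding sc_def using that by (intro order_trans[OF degree_smult_le]) (simp add: degree_pcompose)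
        have rt: "\<bar>2 * r * t\<bar> \<le> 2 * r" if "\<bar>t\<bar> \<le> 1" for t
          using that r by (simp add: abs_mult mult_left_le)
        have sc: "cmod (\<phi> t ^ k - poly (sc k p) (of_real t)) \<le> \<delta>"
          if "\<And>t. \<bar>t\<bar> \<le> 2 * r \<Longrightarrow> cmod (f (x + t *\<^sub>R axis i 1) ^ k - poly p (of_real t)) \<le> \<delta>" "\<bar>t\<bar> \<le> 1" for t k p
        proof -
          have "\<phi> t ^ k - poly (sc k p) (of_real t) = (f (x + (2 * r * t) *\<^sub>R axis i 1) ^ k - poly p (of_real (2 * r * t))) / of_real B ^ k"
            by (simp add: \<phi>_def sc_def poly_pcompose power_divide diff_divide_distrib mult_ac)
          also have "cmod \<dots> \<le> \<delta> / 1"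
            unfolding norm_divide norm_power using that(1)[OF rt[OF that(2)]] B(1) \<delta>0 by (intro frac_le) auto
          finally show ?thesis by simp
        qed
        have \<phi>1: "cmod (\<phi> t) \<le> 1" if "\<bar>t\<bar> \<le> 1" for t
          using B(2)[OF seg[OF rt[OF that]]] B(1) by (simp add: \<phi>_def norm_divide divide_le_eq)
        obtain F where F: "degree F \<le> 5 * N'" "\<And>t. \<bar>t\<bar> \<le> 1/2 \<Longrightarrow> cmod (\<phi> t - poly F (of_real t)) \<le> C ^ N' * \<delta> powr c"
          using core[OF N' \<delta>0 True dsc[OF p1(1)] dsc[OF p2(1)] \<phi>1 sc[OF p1(2)] sc[OF p2(2)]] by blast
        define p where "p = smult (of_real B) (pcompose F [:0, of_real (1 / (2 * r)):])"
        show ?thesis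
        proof (intro exI[of _ p] conjI allI impI)
          show "degree p \<le> 5 * q * N"
            unfolding p_def using F(1) by (intro order_trans[OF degree_smult_le]) (simp add: degree_pcompose N'_def mult_ac)
          fix t :: real assume t: "\<bar>t\<bar> \<le> r"
          define u where "u = t / (2 * r)"
          have u: "\<bar>u\<bar> \<le> 1/2" "2 * r * u = t" using t r by (auto simp: u_def field_simps)
          have "f (x + t *\<^sub>R axis i 1) - poly p (of_real t) = of_real B * (\<phi> u - poly F (of_real u))"
            using B(1) u(2) by (simp add: \<phi>_def p_def poly_pcompose u_def right_diff_distrib mult_ac)
          also have "cmod \<dots> \<le> B * (C ^ N' * \<delta> powr c)"
            unfolding norm_mult using F(2)[OF u(1)] B(1) by (intro mult_mono) auto
          also have "\<delta> powr c \<le> \<delta> powr (1 / real q)" using \<delta>0 True qc' by (intro powr_mono') auto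
          also note \<delta>Z
          also have "B * (C ^ N' * Z) = B * A * \<rho> ^ N * M N / fact N * r ^ N" unfolding CZ by (simp add: mult_ac)
          finally show "cmod (f (x + t *\<^sub>R axis i 1) - poly p (of_real t)) \<le> B * A * \<rho> ^ N * M N / fact N * r ^ N"
            using B(1) C by (auto simp: mult_left_mono)
        qed
      qed
    qed
    then show "\<exists>A\<ge>0. \<forall>N\<ge>1. line_approx (5 * q * N) (s/2) (s/2) (A * \<rho> ^ N * M N / fact N) N f"
      using A B(1) by (intro exI[of _ "B * A"]) auto
  qed
qed

text \<open>A derivative of order k is bounded through the approximation of order N = k + 4 by k!
  G^k (S + K), up to a constant. In the K-part the factor 1/(k+4)! cancels k!, moderate growth
  reduces \<open>M (k + 4)\<close> to \<open>M k\<close>, and a small \<rho> beats G. The S-part has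
  no such factor; there k! (G/\<sigma>)^k is dominated by \<open>M k\<close> through
  non-quasianalyticity.\<close>

lemma E_M_cube:
  fixes f :: "real^'n::finite \<Rightarrow> complex"
  assumes M: "weight_sequence M" and nq: "non_quasianalytic M" and mg: "moderate_growth M" and s: "0 < s"
    and S: "\<And>x. x \<in> cube (2 * s) \<Longrightarrow> cmod (f x) \<le> S" and cont: "continuous_on (cube (2 * s)) f" and r0: "0 < r0"
    and LA: "\<And>\<rho>. 0 < \<rho> \<Longrightarrow> \<exists>A\<ge>0. \<forall>N\<ge>1. line_approx (q * N) (2 * s) r0 (A * \<rho> ^ N * M N / fact N) N f"
  shows "f \<in> E_M M (cube s)"
proof -
  note pos = weight_sequence_pos[OF M]
  have S0: "0 \<le> S" using order_trans[OF norm_ge_zero S[OF zero_mem_cube]] s by simp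
  have smooth: "smooth_on (cube s) f"
  proof (rule smooth_on_cube[OF s r0 S cont])
    fix N :: nat assume N: "1 \<le> N"
    obtain A where "A \<ge> 0" "\<forall>N\<ge>1. line_approx (q * N) (2 * s) r0 (A * 1 ^ N * M N / fact N) N f"
      using LA[of 1] by auto
    then show "\<exists>L K. 0 \<le> K \<and> line_approx L (2 * s) r0 K N f"
      using N pos(1)[of N] by (intro exI[of _ "q * N"] exI[of _ "A * 1 ^ N * M N / fact N"]) auto
  qed
  obtain H where H: "1 \<le> H" "\<And>j k. M (j + k) \<le> H ^ (j + k) * M j * M k"
    using moderate_growth_multiple[OF M mg] by metis
  define d where "d = CARD('n)"
  define r where "r = min r0 (min 1 (s / real (d + 1)))"
  have "0 < s / real (d + 1)" using s by simp
  then have r: "0 < r" "r \<le> 1" "r \<le> r0" "r \<le> s / real (d + 1)" using r0 unfolding r_def by auto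
  have rs: "s + real CARD('n) * r \<le> 2 * s"
  proof -
    have "r * real (d + 1) \<le> s" using r(4) by (simp add: le_divide_eq)
    then show ?thesis using r(1) by (simp add: d_def algebra_simps)
  qed
  \<comment> \<open>The constant of the derivative bound is split into a part independent of k and
    the base of a k-th power; the degree q(k+4) contributes 4q to the former and q to the
    latter.\<close>
  define G0 where "G0 = (14 * 60 ^ Suc (4 * q) :: real) ^ d"
  define G where "G = (2 * 60 ^ q :: real) ^ d / r"
  have G: "0 < G0" "0 < G" using r by (auto simp: G0_def G_def)
  have "\<exists>C. \<forall>x\<in>cube s. \<forall>\<alpha>. cmod (dpartial \<alpha> f x) / (\<sigma> ^ mi_length \<alpha> * M (mi_length \<alpha>)) \<le> C" if \<sigma>: "0 < \<sigma>" for \<sigma>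
  proof -
    \<comment> \<open>Besides \<open>G * H * \<rho> \<le> \<sigma>\<close>, the bound \<rho> \<le> 1
      is wanted in order to drop the four surplus powers in \<rho>^(k+4).\<close>
    define \<rho> where "\<rho> = min 1 (\<sigma> / (G * H))"
    have GH: "0 < G * H" using G H by simp
    have \<rho>: "0 < \<rho>" "\<rho> \<le> 1" "G * H * \<rho> \<le> \<sigma>"
    proof -
      have "\<rho> \<le> \<sigma> / (G * H)" by (simp add: \<rho>_def)
      then show "G * H * \<rho> \<le> \<sigma>" using GH by (simp add: field_simps)
      show "0 < \<rho>" "\<rho> \<le> 1" using GH \<sigma> by (auto simp: \<rho>_def)
    qed
    obtain A where A: "0 \<le> A" "\<And>N. 1 \<le> N \<Longrightarrow> line_approx (q * N) (2 * s) r0 (A * \<rho> ^ N * M N / fact N) N f"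
      using LA[OF \<rho>(1)] by blast
    obtain A2 where A2: "0 < A2" "\<And>k. fact k * (G / \<sigma>) ^ k \<le> A2 * M k"
      using non_quasianalytic_dominates_fact[OF M nq, of "G / \<sigma>"] G \<sigma> by auto
    have "cmod (dpartial \<alpha> f x) / (\<sigma> ^ mi_length \<alpha> * M (mi_length \<alpha>)) \<le> G0 * (A2 * S + A * H ^ 4 * M 4)" if x: "x \<in> cube s" for x \<alpha>
    proof -
      define k where "k = mi_length \<alpha>"
      define K where "K = A * \<rho> ^ (k + 4) * M (k + 4) / fact (k + 4)"
      have K0: "0 \<le> K" using A \<rho> pos(1)[of "k + 4"] by (simp add: K_def)
      have la: "line_approx (q * (k + 4)) (2 * s) r K (mi_length \<alpha> + 4) f"
        using line_approx_mono[OF A(2)[of "k + 4"] order_refl r(3)] by (simp add: K_def k_def)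
      have "cmod (dpartial \<alpha> f x) \<le> fact k * (14 * 2 ^ k * 60 ^ Suc (q * (k + 4))) ^ d * (S + K) / r ^ k"
        using dpartial_bound[OF r(1,2) rs K0 s S cont la x] unfolding k_def d_def .
      also have "\<dots> = G0 * (fact k * G ^ k) * (S + K)"
      proof -
        have 1: "14 * 2 ^ k * 60 ^ Suc (q * (k + 4)) = (14 * 60 ^ Suc (4 * q)) * (2 * 60 ^ q :: real) ^ k"
          by (simp add: power_mult_distrib power_add[symmetric] power_mult[symmetric] algebra_simps)
        have 2: "(a * b ^ k) ^ d / r ^ k = a ^ d * (b ^ d / r) ^ k" for a b :: real
          by (simp add: power_mult_distrib power_divide power_mult[symmetric] mult.commute)
        have 3: "fact k * Y * (S + K) / R = (Y / R) * fact k * (S + K)" for Y R :: real by simp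
        show ?thesis unfolding 1 3 2 G0_def G_def by (simp only: mult_ac)
      qed
      also have "\<dots> \<le> G0 * ((A2 * S + A * H ^ 4 * M 4) * (\<sigma> ^ k * M k))"
      proof -
        have "fact k * G ^ k = (fact k * (G / \<sigma>) ^ k) * \<sigma> ^ k" using \<sigma> by (simp add: power_divide)
        also have "\<dots> \<le> (A2 * M k) * \<sigma> ^ k" using A2(2) \<sigma> by (intro mult_right_mono) auto
        finally have 1: "fact k * G ^ k * S \<le> (A2 * M k) * \<sigma> ^ k * S" using S0 by (intro mult_right_mono)
        have "fact k * G ^ k * K = (fact k / fact (k + 4)) * (A * (G ^ k * \<rho> ^ (k + 4)) * M (k + 4))"
          by (simp add: K_def)
        also have "\<dots> \<le> 1 * (A * (G ^ k * \<rho> ^ k) * (H ^ (k + 4) * M k * M 4))"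
        proof (intro mult_mono)
          show "fact k / fact (k + 4) \<le> (1::real)" using fact_mono[of k "k + 4", where 'a=real] by simp
          show "\<rho> ^ (k + 4) \<le> \<rho> ^ k" using \<rho> by (intro power_decreasing) auto
          show "M (k + 4) \<le> H ^ (k + 4) * M k * M 4" by (rule H(2))
        qed (use A \<rho> G pos(1)[of "k + 4"] in auto)
        also have "\<dots> = A * H ^ 4 * M 4 * ((G * H * \<rho>) ^ k * M k)"
          by (simp add: power_add power_mult_distrib mult_ac)
        also have "\<dots> \<le> A * H ^ 4 * M 4 * (\<sigma> ^ k * M k)"
          using A H G \<rho> pos(1)[of 4] pos(1)[of k] by (intro mult_left_mono mult_right_mono power_mono) auto
        finally have 2: "fact k * G ^ k * K \<le> A * H ^ 4 * M 4 * (\<sigma> ^ k * M k)" .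
        have "fact k * G ^ k * (S + K) \<le> (A2 * S + A * H ^ 4 * M 4) * (\<sigma> ^ k * M k)"
          using 1 2 by (simp add: algebra_simps)
        then show ?thesis using G by (simp add: mult.assoc mult_left_mono)
      qed
      finally have "cmod (dpartial \<alpha> f x) \<le> G0 * (A2 * S + A * H ^ 4 * M 4) * (\<sigma> ^ k * M k)" by (simp add: mult.assoc)
      then show ?thesis using \<sigma> pos(1)[of k] by (simp add: k_def divide_le_eq)
    qed
    then show ?thesis by blast
  qed
  then show ?thesis
    unfolding E_M_def B_M_def using smooth smooth_on_subset[OF smooth]
    by (auto dest: subsetD closure_subset[THEN subsetD]) (meson closure_subset subsetD subset_trans)+
qed

lemma E_M_axis_bound:
  assumes f: "f \<in> E_M M U" and V: "open V" "compact (closure V)" "closure V \<subseteq> U" and M: "weight_sequence M" and \<sigma>: "0 < \<sigma>"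
  shows "\<exists>A. \<forall>x\<in>V. \<forall>i N. cmod (partials (replicate N i) f x) \<le> A * \<sigma> ^ N * M N"
proof -
  obtain C where C: "\<forall>x\<in>V. \<forall>\<alpha>. cmod (dpartial \<alpha> f x) / (\<sigma> ^ mi_length \<alpha> * M (mi_length \<alpha>)) \<le> C"
    using f V \<sigma> unfolding E_M_def B_M_def by blast
  have "cmod (partials (replicate N i) f x) \<le> C * \<sigma> ^ N * M N" if "x \<in> V" for x i N
  proof -
    have "cmod (partials (replicate N i) f x) / (\<sigma> ^ N * M N) \<le> C"
      using C that dpartial_single_axis[of i N] by metis
    then show ?thesis using \<sigma> weight_sequence_pos(1)[OF M, of N] by (simp add: divide_le_eq mult.assoc)
  qed
  then show ?thesis by blast
qed

theorem theorem2p5: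
  fixes M :: "nat \<Rightarrow> real"
  assumes "weight_sequence M"
    and "non_quasianalytic M"
    and "moderate_growth M"
    and "log_convex (\<lambda>k. M k / fact k)"
  shows "property_D (germ_E_M M :: (real^'n::finite \<Rightarrow> complex) \<Rightarrow> bool)"
  unfolding property_D_def
proof (intro allI impI, elim conjE)
  fix f :: "real^'n \<Rightarrow> complex" and j :: nat
  assume j: "1 \<le> j" and g1: "germ_E_M M (\<lambda>x. f x ^ j)" and g2: "germ_E_M M (\<lambda>x. f x ^ (j + 1))"
  obtain U1 U2 where U1: "open U1" "0 \<in> U1" "(\<lambda>x. f x ^ j) \<in> E_M M U1"
    and U2: "open U2" "0 \<in> U2" "(\<lambda>x. f x ^ (j + 1)) \<in> E_M M U2"
    using g1 g2 unfolding germ_E_M_def by blast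
  have "open (U1 \<inter> U2)" "0 \<in> U1 \<inter> U2" using U1 U2 by auto
  then obtain e where e: "0 < e" "cball 0 e \<subseteq> U1 \<inter> U2" by (meson open_contains_cball)
  define s where "s = e / real CARD('n)"
  have s: "0 < s" using e by (simp add: s_def)
  have cl: "closure (cube s :: (real^'n) set) \<subseteq> cball 0 e"
    using cube_subset_cball[of s, where 'n='n] s by (intro closure_minimal) (auto simp: s_def)
  have "bounded (cube s :: (real^'n) set)"
    using bounded_subset[OF bounded_cball subset_trans[OF closure_subset cl]] .
  then have V: "open (cube s :: (real^'n) set)" "compact (closure (cube s :: (real^'n) set))"
    using open_cube by (auto simp: compact_closure)
  have V1: "closure (cube s) \<subseteq> U1" and V2: "closure (cube s) \<subseteq> U2" using cl e by auto
  have bd: "\<exists>A. \<forall>x\<in>cube s. \<forall>i N. cmod (partials (replicate N i) (\<lambda>x. f x ^ k) x) \<le> A * \<sigma> ^ N * M N"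
    if "0 < \<sigma>" "k \<in> {j, j + 1}" for \<sigma> k
    using E_M_axis_bound[OF U1(3) V V1 assms(1) that(1)] E_M_axis_bound[OF U2(3) V V2 assms(1) that(1)] that(2) by blast
  have smooth: "smooth_on (cube s) (\<lambda>x. f x ^ j)" "smooth_on (cube s) (\<lambda>x. f x ^ (j + 1))"
    using U1(3) U2(3) V1 V2 closure_subset[of "cube s"] unfolding E_M_def by (auto intro: smooth_on_subset)
  have cont: "continuous_on (cube s) f"
  proof (rule continuous_on_from_powers[OF j])
    show "continuous_on (cube s) (\<lambda>x. f x ^ j)" "continuous_on (cube s) (\<lambda>x. f x ^ (j + 1))"
      using smooth[unfolded smooth_on_def, THEN spec[of _ "[]"]] by auto
  qed
  obtain B where B: "1 \<le> B" "\<And>x. x \<in> cube s \<Longrightarrow> cmod (f x) \<le> B"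
  proof -
    obtain A where A: "\<And>x i N. x \<in> cube s \<Longrightarrow> cmod (partials (replicate N i) (\<lambda>x. f x ^ j) x) \<le> A * 1 ^ N * M N"
      using bd[of 1 j] by auto
    have "cmod (f x) \<le> max 1 A" if "x \<in> cube s" for x
    proof (cases "cmod (f x) \<le> 1")
      case False
      then have "cmod (f x) \<le> cmod (f x) ^ j" using j power_increasing[of 1 j "cmod (f x)"] by simp
      \<comment> \<open>The derivative bound at N = 0, where \<open>M 0 = 1\<close>, is a sup bound
        for f^j.\<close>
      also have "\<dots> \<le> A" using A[OF that, of 0] weight_sequence_pos(2)[OF assms(1)] by (simp add: norm_power)
      finally show ?thesis by simp
    qed simp
    then show ?thesis using that[of "max 1 A"] by simp
  qed
  obtain q where q: "\<And>\<rho>. 0 < \<rho> \<Longrightarrow> \<exists>A\<ge>0. \<forall>N\<ge>1. line_approx (q * N) (s/2) (s/2) (A * \<rho> ^ N * M N / fact N) N f"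
    using line_approx_of_powers[OF assms(1,3) j s smooth bd B] by blast
  have sub: "cube (s/2) \<subseteq> (cube s :: (real^'n) set)" using s by (intro cube_mono) auto
  \<comment> \<open>The line approximations live on \<open>cube (s/2)\<close>; taking derivatives
    uses up another half of the side as margin.\<close>
  have "f \<in> E_M M (cube (s/4))"
    by (rule E_M_cube[OF assms(1-3), where S = B and ?r0.0 = "s/2" and q = q])
       (use s q B sub continuous_on_subset[OF cont sub] in auto)
  then show "germ_E_M M f"
    unfolding germ_E_M_def using s by (intro exI[of _ "cube (s/4)"]) (auto intro: open_cube zero_mem_cube)
qed

end
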